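(* There are equivalences, of 1-categories and of 2-categories respectively, $$\mathbf{CwA}^{\mathrm{str1}}\simeq\mathbf{CompCat}^{\mathrm{str1}}_{\mathrm{disc}},\qquad \mathbf{CwA}^{\mathrm{ps}}\simeq\mathbf{CompCat}^{\mathrm{ps}}_{\mathrm{disc}},$$ between categories with attributes and discrete comprehension categories (in the first, with strict maps only; in the second, with pseudo maps and transformations).
   Context: **Comprehension categories.** A comprehension category $(\mathcal C,\mathcal T,p,\chi)$ is a category $\mathcal C$, a fibration $p:\mathcal T\to\mathcal C$, and a functor $\chi:\mathcal T\to\mathcal C^{\to}$ to the arrow category with $\mathrm{cod}\circ\chi=p$ strictly, sending $p$-cartesian maps to pullback squares. For $A\in\mathcal T_\Gamma=p^{-1}(\Gamma)$ the domain of $\chi(A)$ is written $\Gamma.A$. A *pseudo map* $(F,\bar F,\varphi)$ is a functor $F:\mathcal C\to\mathcal C'$, a functor $\bar F:\mathcal T\to\mathcal T'$ strictly over $F$ preserving cartesian maps, and a natural isomorphism $\varphi:\chi'\bar F\cong F^{\to}\chi$ lying strictly over the identity of $F$; it is *strict* if $\chi'\bar F=F^{\to}\chi$ and $\varphi$ is the identity. A *transformation* $(F,\bar F,\varphi)\Rightarrow(G,\bar G,\gamma)$ is a natural transformation $\alpha:F\Rightarrow G$ and another $\bar\alpha:\bar F\Rightarrow\bar G$ strictly over $\alpha$, with $\gamma_A\circ\chi'(\bar\alpha_A)=\alpha_{\Gamma.A}\circ\varphi_A$ for all $A\in\mathcal T_\Gamma$. A comprehension category is *discrete* if $p$ is a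 discrete fibration. $\mathbf{CompCat}^{\mathrm{str1}}_{\mathrm{disc}}$ is the 1-category of discrete comprehension categories and strict maps; $\mathbf{CompCat}^{\mathrm{ps}}_{\mathrm{disc}}$ is the 2-category of discrete comprehension categories, pseudo maps and transformations. **Categories with attributes.** A category with attributes (CwA) consists of a category $\mathcal C$; a presheaf $\mathrm{Ty}:\mathcal C^{\mathrm{op}}\to\mathbf{Set}$; a functor $(-.-):\int_{\mathcal C}\mathrm{Ty}\to\mathcal C$ on the category of elements; and a natural transformation $p:(-.-)\to\pi_1$ (where $\pi_1:\int_{\mathcal C}\mathrm{Ty}\to\mathcal C$ is the projection), cartesian in that its naturality squares are pullbacks. Thus for $A\in\mathrm{Ty}(\Gamma)$ there is $p_A:\Gamma.A\to\Gamma$, and for $f:\Gamma'\to\Gamma$ a pullback square with top map $f.A:\Gamma'.f^*A\to\Gamma.A$ over $f$. A *strict map* of CwA's is a functor $F:\mathcal C\to\mathcal C'$ and natural transformation $\bar F:\mathrm{Ty}\to\mathrm{Ty}'\cdot F$ commuting on the nose with $(-.-)$ and $p$. A *pseudo map* consists of $F$ and $\bar F$ and a natural isomorphism $\varphi_{\Gamma,A}:F(\Gamma.A)\cong F\Gamma.\bar FA$ commuting with $p$, i.e. $p_{\bar FA}\circ\varphi_{\Gamma,A}=F(p_A)$ for all $\Gamma,A$. A *transformation* $(F,\bar F,\varphi)\to(G,\bar G,\psi)$ is a natural transformation $\alpha:F\to G$ such that for each $\Gamma$ and $A\in\mathrm{Ty}(\Gamma)$, $(\alpha_\Gamma)^*(\bar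 GA)=\bar FA$ and $\psi_{\Gamma,A}\circ\alpha_{\Gamma.A}=(\alpha_\Gamma.\bar GA)\circ\varphi_{\Gamma,A}$. $\mathbf{CwA}^{\mathrm{str1}}$ is the 1-category of CwA's with strict maps; $\mathbf{CwA}^{\mathrm{ps}}$ is the 2-category of CwA's with pseudo maps and transformations. **Conventions.** 2-categories are strict; an equivalence of 2-categories is a 2-functor inducing equivalences on hom-categories and surjective on objects up to internal equivalence. *)

theory Defs
  imports Main "HOL-Library.FuncSet"
begin

text \<open>
  Conventions used throughout. The operations of a category, the two components of a functor and
  the components of a natural transformation are functions with an explicit carrier, and they are
  required to be \<^const>\<open>undefined\<close> outside of it. So HOL equality of such data is the strict (on the
  nose) equality of the mathematical objects.
\<close>

section \<open>Categories, functors and natural transformations\<close>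

record ('o, 'a) cat =
  Obj :: "'o set"
  Arr :: "'a set"
  Dom :: "'a \<Rightarrow> 'o"
  Cod :: "'a \<Rightarrow> 'o"
  Ident :: "'o \<Rightarrow> 'a"
  Comp :: "'a \<Rightarrow> 'a \<Rightarrow> 'a"  (infixl "\<cdot>\<index>" 70)

definition hom :: "('o, 'a) cat \<Rightarrow> 'o \<Rightarrow> 'o \<Rightarrow> 'a set" where
  "hom C x y = {f \<in> Arr C. Dom C f = x \<and> Cod C f = y}"

locale category =
  fixes C :: "('o, 'a) cat" (structure)
  assumes Dom_closed: "Dom C \<in> Arr C \<rightarrow>\<^sub>E Obj C"
    and Cod_closed: "Cod C \<in> Arr C \<rightarrow>\<^sub>E Obj C"
    and Ident_extensional: "Ident C \<in> extensional (Obj C)"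
    and Ident_hom: "x \<in> Obj C \<Longrightarrow> Ident C x \<in> hom C x x"
    and Comp_hom: "\<lbrakk>f \<in> hom C x y; g \<in> hom C y z\<rbrakk> \<Longrightarrow> g \<cdot> f \<in> hom C x z"
    and Comp_extensional:
      "\<not> (f \<in> Arr C \<and> g \<in> Arr C \<and> Dom C g = Cod C f) \<Longrightarrow> g \<cdot> f = undefined"
    and Comp_Ident_left: "f \<in> hom C x y \<Longrightarrow> Ident C y \<cdot> f = f"
    and Comp_Ident_right: "f \<in> hom C x y \<Longrightarrow> f \<cdot> Ident C x = f"
    and Comp_assoc: "\<lbrakk>f \<in> hom C w x; g \<in> hom C x y; h \<in> hom C y z\<rbrakk> \<Longrightarrow> (h \<cdot> g) \<cdot> f = h \<cdot> (g \<cdot> f)"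

text \<open>The category with the given data, made \<^const>\<open>undefined\<close> outside of the carriers.\<close>

definition mk_cat ::
  "'o set \<Rightarrow> 'a set \<Rightarrow> ('a \<Rightarrow> 'o) \<Rightarrow> ('a \<Rightarrow> 'o) \<Rightarrow> ('o \<Rightarrow> 'a) \<Rightarrow> ('a \<Rightarrow> 'a \<Rightarrow> 'a) \<Rightarrow> ('o, 'a) cat" where
  "mk_cat Ob Ar d c i m =
     \<lparr>Obj = Ob, Arr = Ar, Dom = restrict d Ar, Cod = restrict c Ar, Ident = restrict i Ob,
      Comp = (\<lambda>g f. if f \<in> Ar \<and> g \<in> Ar \<and> d g = c f then m g f else undefined)\<rparr>"

definition op_cat :: "('o, 'a) cat \<Rightarrow> ('o, 'a) cat" where
  "op_cat C = mk_cat (Obj C) (Arr C) (Cod C) (Dom C) (Ident C) (\<lambda>g f. Comp C f g)"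

definition prod_cat :: "('o, 'a) cat \<Rightarrow> ('p, 'b) cat \<Rightarrow> ('o \<times> 'p, 'a \<times> 'b) cat" where
  "prod_cat C D =
     mk_cat (Obj C \<times> Obj D) (Arr C \<times> Arr D)
       (\<lambda>(f, g). (Dom C f, Dom D g)) (\<lambda>(f, g). (Cod C f, Cod D g))
       (\<lambda>(x, y). (Ident C x, Ident D y)) (\<lambda>(f', g') (f, g). (Comp C f' f, Comp D g' g))"

record ('o, 'a, 'p, 'b) ftor =
  onO :: "'o \<Rightarrow> 'p"
  onA :: "'a \<Rightarrow> 'b"

definition is_functor :: "('o, 'a) cat \<Rightarrow> ('p, 'b) cat \<Rightarrow> ('o, 'a, 'p, 'b) ftor \<Rightarrow> bool" where
  "is_functor C D F \<longleftrightarrow>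
     category C \<and> category D \<and>
     onO F \<in> Obj C \<rightarrow>\<^sub>E Obj D \<and> onA F \<in> extensional (Arr C) \<and>
     (\<forall>f\<in>Arr C. onA F f \<in> hom D (onO F (Dom C f)) (onO F (Cod C f))) \<and>
     (\<forall>x\<in>Obj C. onA F (Ident C x) = Ident D (onO F x)) \<and>
     (\<forall>f\<in>Arr C. \<forall>g\<in>Arr C. Dom C g = Cod C f \<longrightarrow> onA F (g \<cdot>\<^bsub>C\<^esub> f) = onA F g \<cdot>\<^bsub>D\<^esub> onA F f)"

definition id_functor :: "('o, 'a) cat \<Rightarrow> ('o, 'a, 'o, 'a) ftor" where
  "id_functor C = \<lparr>onO = (\<lambda>x\<in>Obj C. x), onA = (\<lambda>f\<in>Arr C. f)\<rparr>"

definition comp_functor ::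
  "('o, 'a) cat \<Rightarrow> ('p, 'b, 'q, 'c) ftor \<Rightarrow> ('o, 'a, 'p, 'b) ftor \<Rightarrow> ('o, 'a, 'q, 'c) ftor" where
  "comp_functor C G F =
     \<lparr>onO = compose (Obj C) (onO G) (onO F), onA = compose (Arr C) (onA G) (onA F)\<rparr>"

definition is_iso :: "('o, 'a) cat \<Rightarrow> 'a \<Rightarrow> bool" where
  "is_iso C f \<longleftrightarrow>
     f \<in> Arr C \<and>
     (\<exists>g \<in> hom C (Cod C f) (Dom C f).
        g \<cdot>\<^bsub>C\<^esub> f = Ident C (Dom C f) \<and> f \<cdot>\<^bsub>C\<^esub> g = Ident C (Cod C f))"

definition isomorphic :: "('o, 'a) cat \<Rightarrow> 'o \<Rightarrow> 'o \<Rightarrow> bool" where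
  "isomorphic C x y \<longleftrightarrow> (\<exists>f \<in> hom C x y. is_iso C f)"

definition nat_trans ::
  "('o, 'a) cat \<Rightarrow> ('p, 'b) cat \<Rightarrow> ('o, 'a, 'p, 'b) ftor \<Rightarrow> ('o, 'a, 'p, 'b) ftor \<Rightarrow> ('o \<Rightarrow> 'b) \<Rightarrow> bool"
  where
  "nat_trans C D F G \<alpha> \<longleftrightarrow>
     is_functor C D F \<and> is_functor C D G \<and> \<alpha> \<in> extensional (Obj C) \<and>
     (\<forall>x\<in>Obj C. \<alpha> x \<in> hom D (onO F x) (onO G x)) \<and>
     (\<forall>f\<in>Arr C. \<alpha> (Cod C f) \<cdot>\<^bsub>D\<^esub> onA F f = onA G f \<cdot>\<^bsub>D\<^esub> \<alpha> (Dom C f))"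

definition nat_iso ::
  "('o, 'a) cat \<Rightarrow> ('p, 'b) cat \<Rightarrow> ('o, 'a, 'p, 'b) ftor \<Rightarrow> ('o, 'a, 'p, 'b) ftor \<Rightarrow> ('o \<Rightarrow> 'b) \<Rightarrow> bool"
  where
  "nat_iso C D F G \<alpha> \<longleftrightarrow> nat_trans C D F G \<alpha> \<and> (\<forall>x\<in>Obj C. is_iso D (\<alpha> x))"

definition cat_equivalence ::
  "('o, 'a) cat \<Rightarrow> ('p, 'b) cat \<Rightarrow> ('o, 'a, 'p, 'b) ftor \<Rightarrow> bool" where
  "cat_equivalence C D F \<longleftrightarrow>
     is_functor C D F \<and>
     (\<exists>G \<eta> \<epsilon>. is_functor D C G \<and>
        nat_iso C C (id_functor C) (comp_functor C G F) \<eta> \<and>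
        nat_iso D D (comp_functor D F G) (id_functor D) \<epsilon>)"

definition equivalent_categories :: "('o, 'a) cat \<Rightarrow> ('p, 'b) cat \<Rightarrow> bool" where
  "equivalent_categories C D \<longleftrightarrow> (\<exists>F. cat_equivalence C D F)"


section \<open>Strict 2-categories and their equivalences\<close>

text \<open>
  Strict 2-categories as categories enriched in categories: \<open>Comp2 K x y z\<close> is the
  composition functor from \<open>Hom2 K y z \<times> Hom2 K x y\<close> to \<open>Hom2 K x z\<close>.
\<close>

record ('o, 'm, 'c) cat2 =
  Obj2 :: "'o set"
  Hom2 :: "'o \<Rightarrow> 'o \<Rightarrow> ('m, 'c) cat"
  Ident2 :: "'o \<Rightarrow> 'm"
  Comp2 :: "'o \<Rightarrow> 'o \<Rightarrow> 'o \<Rightarrow> ('m \<times> 'm, 'c \<times> 'c, 'm, 'c) ftor"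

locale two_category =
  fixes K :: "('o, 'm, 'c) cat2"
  assumes Hom_category:
      "\<lbrakk>x \<in> Obj2 K; y \<in> Obj2 K\<rbrakk> \<Longrightarrow> category (Hom2 K x y)"
    and Ident2_Hom: "x \<in> Obj2 K \<Longrightarrow> Ident2 K x \<in> Obj (Hom2 K x x)"
    and Comp2_functor:
      "\<lbrakk>x \<in> Obj2 K; y \<in> Obj2 K; z \<in> Obj2 K\<rbrakk> \<Longrightarrow>
       is_functor (prod_cat (Hom2 K y z) (Hom2 K x y)) (Hom2 K x z) (Comp2 K x y z)"
    and unit_left_1:
      "\<lbrakk>x \<in> Obj2 K; y \<in> Obj2 K; f \<in> Obj (Hom2 K x y)\<rbrakk> \<Longrightarrow>
       onO (Comp2 K x y y) (Ident2 K y, f) = f"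
    and unit_right_1:
      "\<lbrakk>x \<in> Obj2 K; y \<in> Obj2 K; f \<in> Obj (Hom2 K x y)\<rbrakk> \<Longrightarrow>
       onO (Comp2 K x x y) (f, Ident2 K x) = f"
    and assoc_1:
      "\<lbrakk>w \<in> Obj2 K; x \<in> Obj2 K; y \<in> Obj2 K; z \<in> Obj2 K;
        f \<in> Obj (Hom2 K w x); g \<in> Obj (Hom2 K x y); h \<in> Obj (Hom2 K y z)\<rbrakk> \<Longrightarrow>
       onO (Comp2 K w x z) (onO (Comp2 K x y z) (h, g), f) =
       onO (Comp2 K w y z) (h, onO (Comp2 K w x y) (g, f))"
    and unit_left_2:
      "\<lbrakk>x \<in> Obj2 K; y \<in> Obj2 K; \<alpha> \<in> Arr (Hom2 K x y)\<rbrakk> \<Longrightarrow>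
       onA (Comp2 K x y y) (Ident (Hom2 K y y) (Ident2 K y), \<alpha>) = \<alpha>"
    and unit_right_2:
      "\<lbrakk>x \<in> Obj2 K; y \<in> Obj2 K; \<alpha> \<in> Arr (Hom2 K x y)\<rbrakk> \<Longrightarrow>
       onA (Comp2 K x x y) (\<alpha>, Ident (Hom2 K x x) (Ident2 K x)) = \<alpha>"
    and assoc_2:
      "\<lbrakk>w \<in> Obj2 K; x \<in> Obj2 K; y \<in> Obj2 K; z \<in> Obj2 K;
        \<alpha> \<in> Arr (Hom2 K w x); \<beta> \<in> Arr (Hom2 K x y); \<gamma> \<in> Arr (Hom2 K y z)\<rbrakk> \<Longrightarrow>
       onA (Comp2 K w x z) (onA (Comp2 K x y z) (\<gamma>, \<beta>), \<alpha>) =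
       onA (Comp2 K w y z) (\<gamma>, onA (Comp2 K w x y) (\<beta>, \<alpha>))"

definition internally_equivalent :: "('o, 'm, 'c) cat2 \<Rightarrow> 'o \<Rightarrow> 'o \<Rightarrow> bool" where
  "internally_equivalent K x y \<longleftrightarrow>
     (\<exists>f \<in> Obj (Hom2 K x y). \<exists>g \<in> Obj (Hom2 K y x).
        isomorphic (Hom2 K x x) (Ident2 K x) (onO (Comp2 K x y x) (g, f)) \<and>
        isomorphic (Hom2 K y y) (onO (Comp2 K y x y) (f, g)) (Ident2 K y))"

record ('o, 'm, 'c, 'p, 'n, 'd) ftor2 =
  onObj2 :: "'o \<Rightarrow> 'p"
  onHom2 :: "'o \<Rightarrow> 'o \<Rightarrow> ('m, 'c, 'n, 'd) ftor"

definition is_two_functor ::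
  "('o, 'm, 'c) cat2 \<Rightarrow> ('p, 'n, 'd) cat2 \<Rightarrow> ('o, 'm, 'c, 'p, 'n, 'd) ftor2 \<Rightarrow> bool" where
  "is_two_functor K L P \<longleftrightarrow>
     two_category K \<and> two_category L \<and>
     onObj2 P \<in> Obj2 K \<rightarrow> Obj2 L \<and>
     (\<forall>x\<in>Obj2 K. \<forall>y\<in>Obj2 K.
        is_functor (Hom2 K x y) (Hom2 L (onObj2 P x) (onObj2 P y)) (onHom2 P x y)) \<and>
     (\<forall>x\<in>Obj2 K. onO (onHom2 P x x) (Ident2 K x) = Ident2 L (onObj2 P x)) \<and>
     (\<forall>x\<in>Obj2 K. \<forall>y\<in>Obj2 K. \<forall>z\<in>Obj2 K.
        (\<forall>g\<in>Obj (Hom2 K y z). \<forall>f\<in>Obj (Hom2 K x y).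
           onO (onHom2 P x z) (onO (Comp2 K x y z) (g, f)) =
           onO (Comp2 L (onObj2 P x) (onObj2 P y) (onObj2 P z))
             (onO (onHom2 P y z) g, onO (onHom2 P x y) f)) \<and>
        (\<forall>\<beta>\<in>Arr (Hom2 K y z). \<forall>\<alpha>\<in>Arr (Hom2 K x y).
           onA (onHom2 P x z) (onA (Comp2 K x y z) (\<beta>, \<alpha>)) =
           onA (Comp2 L (onObj2 P x) (onObj2 P y) (onObj2 P z))
             (onA (onHom2 P y z) \<beta>, onA (onHom2 P x y) \<alpha>)))"

definition two_equivalence ::
  "('o, 'm, 'c) cat2 \<Rightarrow> ('p, 'n, 'd) cat2 \<Rightarrow> ('o, 'm, 'c, 'p, 'n, 'd) ftor2 \<Rightarrow> bool" where
  "two_equivalence K L P \<longleftrightarrow>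
     is_two_functor K L P \<and>
     (\<forall>x\<in>Obj2 K. \<forall>y\<in>Obj2 K.
        cat_equivalence (Hom2 K x y) (Hom2 L (onObj2 P x) (onObj2 P y)) (onHom2 P x y)) \<and>
     (\<forall>z\<in>Obj2 L. \<exists>x\<in>Obj2 K. internally_equivalent L (onObj2 P x) z)"

definition equivalent_two_categories :: "('o, 'm, 'c) cat2 \<Rightarrow> ('p, 'n, 'd) cat2 \<Rightarrow> bool" where
  "equivalent_two_categories K L \<longleftrightarrow> (\<exists>P. two_equivalence K L P)"


section \<open>Sets, arrow categories, pullbacks and fibrations\<close>

text \<open>The category of sets of elements of \<open>'t\<close>; the triple \<open>(A, f, B)\<close> is the map \<open>f : A \<rightarrow> B\<close>.\<close>

type_synonym 't set_map = "'t set \<times> ('t \<Rightarrow> 't) \<times> 't set"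

definition set_cat :: "('t set, 't set_map) cat" where
  "set_cat =
     mk_cat UNIV {(A, f, B). f \<in> A \<rightarrow>\<^sub>E B} (\<lambda>(A, f, B). A) (\<lambda>(A, f, B). B)
       (\<lambda>A. (A, (\<lambda>x\<in>A. x), A)) (\<lambda>(_, g, D) (A, f, _). (A, compose A g f, D))"

definition set_app :: "'t set_map \<Rightarrow> 't \<Rightarrow> 't" where
  "set_app m = fst (snd m)"

text \<open>
  In the arrow category, \<open>(f, (h, k), g)\<close> is the commutative square from \<open>f\<close> to \<open>g\<close> with
  top side \<open>h\<close> (between the domains) and bottom side \<open>k\<close> (between the codomains).
\<close>

type_synonym 'a square = "'a \<times> ('a \<times> 'a) \<times> 'a"

definition top_side :: "'a square \<Rightarrow> 'a" where
  "top_side s = fst (fst (snd s))"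

definition bot_side :: "'a square \<Rightarrow> 'a" where
  "bot_side s = snd (fst (snd s))"

definition arrow_cat :: "('o, 'a) cat \<Rightarrow> ('a, 'a square) cat" where
  "arrow_cat C =
     mk_cat (Arr C)
       {(f, (h, k), g). f \<in> Arr C \<and> g \<in> Arr C \<and>
          h \<in> hom C (Dom C f) (Dom C g) \<and> k \<in> hom C (Cod C f) (Cod C g) \<and>
          g \<cdot>\<^bsub>C\<^esub> h = k \<cdot>\<^bsub>C\<^esub> f}
       (\<lambda>(f, _, g). f) (\<lambda>(f, _, g). g)
       (\<lambda>f. (f, (Ident C (Dom C f), Ident C (Cod C f)), f))
       (\<lambda>(_, (h', k'), g') (f, (h, k), _). (f, (h' \<cdot>\<^bsub>C\<^esub> h, k' \<cdot>\<^bsub>C\<^esub> k), g'))"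

definition cod_functor :: "('o, 'a) cat \<Rightarrow> ('a, 'a square, 'o, 'a) ftor" where
  "cod_functor C = \<lparr>onO = (\<lambda>f\<in>Arr C. Cod C f), onA = (\<lambda>s\<in>Arr (arrow_cat C). bot_side s)\<rparr>"

definition arrow_functor ::
  "('o, 'a) cat \<Rightarrow> ('o, 'a, 'p, 'b) ftor \<Rightarrow> ('a, 'a square, 'b, 'b square) ftor" where
  "arrow_functor C F =
     \<lparr>onO = (\<lambda>f\<in>Arr C. onA F f),
      onA = (\<lambda>(f, (h, k), g) \<in> Arr (arrow_cat C). (onA F f, (onA F h, onA F k), onA F g))\<rparr>"

text \<open>The square has top side \<open>t\<close>, left side \<open>l\<close>, right side \<open>r\<close> and bottom side \<open>b\<close>.\<close>

definition is_pullback :: "('o, 'a) cat \<Rightarrow> 'a \<Rightarrow> 'a \<Rightarrow> 'a \<Rightarrow> 'a \<Rightarrow> bool" where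
  "is_pullback C t l r b \<longleftrightarrow>
     t \<in> Arr C \<and> l \<in> Arr C \<and> r \<in> Arr C \<and> b \<in> Arr C \<and>
     Dom C t = Dom C l \<and> Cod C t = Dom C r \<and> Cod C l = Dom C b \<and> Cod C r = Cod C b \<and>
     r \<cdot>\<^bsub>C\<^esub> t = b \<cdot>\<^bsub>C\<^esub> l \<and>
     (\<forall>u\<in>Arr C. \<forall>v\<in>Arr C.
        Dom C u = Dom C v \<and> Cod C u = Dom C r \<and> Cod C v = Dom C b \<and> r \<cdot>\<^bsub>C\<^esub> u = b \<cdot>\<^bsub>C\<^esub> v \<longrightarrow>
        (\<exists>!w. w \<in> hom C (Dom C u) (Dom C t) \<and> t \<cdot>\<^bsub>C\<^esub> w = u \<and> l \<cdot>\<^bsub>C\<^esub> w = v))"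

definition is_cartesian ::
  "('p, 'b) cat \<Rightarrow> ('o, 'a) cat \<Rightarrow> ('p, 'b, 'o, 'a) ftor \<Rightarrow> 'b \<Rightarrow> bool" where
  "is_cartesian T C p u \<longleftrightarrow>
     u \<in> Arr T \<and>
     (\<forall>v\<in>Arr T. \<forall>w\<in>hom C (onO p (Dom T v)) (onO p (Dom T u)).
        Cod T v = Cod T u \<and> onA p v = onA p u \<cdot>\<^bsub>C\<^esub> w \<longrightarrow>
        (\<exists>!z. z \<in> hom T (Dom T v) (Dom T u) \<and> onA p z = w \<and> u \<cdot>\<^bsub>T\<^esub> z = v))"

definition is_fibration ::
  "('p, 'b) cat \<Rightarrow> ('o, 'a) cat \<Rightarrow> ('p, 'b, 'o, 'a) ftor \<Rightarrow> bool" where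
  "is_fibration T C p \<longleftrightarrow>
     is_functor T C p \<and>
     (\<forall>A\<in>Obj T. \<forall>f\<in>Arr C. Cod C f = onO p A \<longrightarrow>
        (\<exists>u. is_cartesian T C p u \<and> Cod T u = A \<and> onA p u = f))"

definition is_discrete_fibration ::
  "('p, 'b) cat \<Rightarrow> ('o, 'a) cat \<Rightarrow> ('p, 'b, 'o, 'a) ftor \<Rightarrow> bool" where
  "is_discrete_fibration T C p \<longleftrightarrow>
     is_functor T C p \<and>
     (\<forall>A\<in>Obj T. \<forall>f\<in>Arr C. Cod C f = onO p A \<longrightarrow>
        (\<exists>!u. u \<in> Arr T \<and> Cod T u = A \<and> onA p u = f))"


section \<open>Comprehension categories\<close>

record ('o, 'a, 'p, 'b) compcat =
  Base :: "('o, 'a) cat"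
  Tot :: "('p, 'b) cat"
  Proj :: "('p, 'b, 'o, 'a) ftor"
  Compr :: "('p, 'b, 'a, 'a square) ftor"

definition is_compcat :: "('o, 'a, 'p, 'b) compcat \<Rightarrow> bool" where
  "is_compcat X \<longleftrightarrow>
     is_fibration (Tot X) (Base X) (Proj X) \<and>
     is_functor (Tot X) (arrow_cat (Base X)) (Compr X) \<and>
     comp_functor (Tot X) (cod_functor (Base X)) (Compr X) = Proj X \<and>
     (\<forall>u. is_cartesian (Tot X) (Base X) (Proj X) u \<longrightarrow>
        is_pullback (Base X) (top_side (onA (Compr X) u))
          (onO (Compr X) (Dom (Tot X) u)) (onO (Compr X) (Cod (Tot X) u))
          (bot_side (onA (Compr X) u)))"

definition is_discrete_compcat :: "('o, 'a, 'p, 'b) compcat \<Rightarrow> bool" where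
  "is_discrete_compcat X \<longleftrightarrow> is_compcat X \<and> is_discrete_fibration (Tot X) (Base X) (Proj X)"

record ('o, 'a, 'p, 'b) cc_map =
  ccF :: "('o, 'a, 'o, 'a) ftor"
  ccT :: "('p, 'b, 'p, 'b) ftor"
  ccIso :: "'p \<Rightarrow> 'a square"

definition cc_pseudo_map ::
  "('o, 'a, 'p, 'b) compcat \<Rightarrow> ('o, 'a, 'p, 'b) compcat \<Rightarrow> ('o, 'a, 'p, 'b) cc_map \<Rightarrow> bool" where
  "cc_pseudo_map X Y P \<longleftrightarrow>
     is_functor (Base X) (Base Y) (ccF P) \<and>
     is_functor (Tot X) (Tot Y) (ccT P) \<and>
     comp_functor (Tot X) (Proj Y) (ccT P) = comp_functor (Tot X) (ccF P) (Proj X) \<and>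
     (\<forall>u. is_cartesian (Tot X) (Base X) (Proj X) u \<longrightarrow>
        is_cartesian (Tot Y) (Base Y) (Proj Y) (onA (ccT P) u)) \<and>
     nat_iso (Tot X) (arrow_cat (Base Y))
       (comp_functor (Tot X) (Compr Y) (ccT P))
       (comp_functor (Tot X) (arrow_functor (Base X) (ccF P)) (Compr X))
       (ccIso P) \<and>
     (\<forall>A\<in>Obj (Tot X). bot_side (ccIso P A) = Ident (Base Y) (onO (ccF P) (onO (Proj X) A)))"

definition cc_strict_map ::
  "('o, 'a, 'p, 'b) compcat \<Rightarrow> ('o, 'a, 'p, 'b) compcat \<Rightarrow> ('o, 'a, 'p, 'b) cc_map \<Rightarrow> bool" where
  "cc_strict_map X Y P \<longleftrightarrow>
     cc_pseudo_map X Y P \<and>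
     comp_functor (Tot X) (Compr Y) (ccT P) =
       comp_functor (Tot X) (arrow_functor (Base X) (ccF P)) (Compr X) \<and>
     ccIso P = (\<lambda>A\<in>Obj (Tot X). Ident (arrow_cat (Base Y)) (onO (Compr Y) (onO (ccT P) A)))"

text \<open>
  The compatibility condition is an equation in the base between maps out of the comprehension
  of \<open>ccT P A\<close>, so the squares enter through their top sides; \<open>\<Gamma>.A\<close> is the domain of
  \<open>onO (Compr X) A\<close>.
\<close>

definition cc_transformation ::
  "('o, 'a, 'p, 'b) compcat \<Rightarrow> ('o, 'a, 'p, 'b) compcat \<Rightarrow>
   ('o, 'a, 'p, 'b) cc_map \<Rightarrow> ('o, 'a, 'p, 'b) cc_map \<Rightarrow> ('o \<Rightarrow> 'a) \<times> ('p \<Rightarrow> 'b) \<Rightarrow> bool" where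
  "cc_transformation X Y P Q = (\<lambda>(\<alpha>, \<alpha>').
     nat_trans (Base X) (Base Y) (ccF P) (ccF Q) \<alpha> \<and>
     nat_trans (Tot X) (Tot Y) (ccT P) (ccT Q) \<alpha>' \<and>
     (\<forall>A\<in>Obj (Tot X). onA (Proj Y) (\<alpha>' A) = \<alpha> (onO (Proj X) A)) \<and>
     (\<forall>A\<in>Obj (Tot X).
        top_side (ccIso Q A) \<cdot>\<^bsub>Base Y\<^esub> top_side (onA (Compr Y) (\<alpha>' A)) =
        \<alpha> (Dom (Base X) (onO (Compr X) A)) \<cdot>\<^bsub>Base Y\<^esub> top_side (ccIso P A)))"

definition cc_id :: "('o, 'a, 'p, 'b) compcat \<Rightarrow> ('o, 'a, 'p, 'b) cc_map" where
  "cc_id X =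
     \<lparr>ccF = id_functor (Base X), ccT = id_functor (Tot X),
      ccIso = (\<lambda>A\<in>Obj (Tot X). Ident (arrow_cat (Base X)) (onO (Compr X) A))\<rparr>"

definition cc_comp ::
  "('o, 'a, 'p, 'b) compcat \<Rightarrow> ('o, 'a, 'p, 'b) compcat \<Rightarrow> ('o, 'a, 'p, 'b) compcat \<Rightarrow>
   ('o, 'a, 'p, 'b) cc_map \<Rightarrow> ('o, 'a, 'p, 'b) cc_map \<Rightarrow> ('o, 'a, 'p, 'b) cc_map" where
  "cc_comp X Y Z Q P =
     \<lparr>ccF = comp_functor (Base X) (ccF Q) (ccF P),
      ccT = comp_functor (Tot X) (ccT Q) (ccT P),
      ccIso = (\<lambda>A\<in>Obj (Tot X).
        onA (arrow_functor (Base Y) (ccF Q)) (ccIso P A) \<cdot>\<^bsub>arrow_cat (Base Z)\<^esub>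
        ccIso Q (onO (ccT P) A))\<rparr>"

definition compcat_disc_str1 ::
  "(('o, 'a, 'p, 'b) compcat,
    ('o, 'a, 'p, 'b) compcat \<times> ('o, 'a, 'p, 'b) cc_map \<times> ('o, 'a, 'p, 'b) compcat) cat" where
  "compcat_disc_str1 =
     mk_cat {X. is_discrete_compcat X}
       {(X, P, Y). is_discrete_compcat X \<and> is_discrete_compcat Y \<and> cc_strict_map X Y P}
       (\<lambda>(X, P, Y). X) (\<lambda>(X, P, Y). Y)
       (\<lambda>X. (X, cc_id X, X))
       (\<lambda>(Y, Q, Z) (X, P, _). (X, cc_comp X Y Z Q P, Z))"

type_synonym ('o, 'a, 'p, 'b) cc_cell =
  "('o, 'a, 'p, 'b) cc_map \<times> (('o \<Rightarrow> 'a) \<times> ('p \<Rightarrow> 'b)) \<times> ('o, 'a, 'p, 'b) cc_map"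

definition cc_hom ::
  "('o, 'a, 'p, 'b) compcat \<Rightarrow> ('o, 'a, 'p, 'b) compcat \<Rightarrow>
   (('o, 'a, 'p, 'b) cc_map, ('o, 'a, 'p, 'b) cc_cell) cat" where
  "cc_hom X Y =
     mk_cat {P. cc_pseudo_map X Y P}
       {(P, \<alpha>, Q). cc_pseudo_map X Y P \<and> cc_pseudo_map X Y Q \<and> cc_transformation X Y P Q \<alpha>}
       (\<lambda>(P, \<alpha>, Q). P) (\<lambda>(P, \<alpha>, Q). Q)
       (\<lambda>P. (P, (\<lambda>x\<in>Obj (Base X). Ident (Base Y) (onO (ccF P) x),
                 \<lambda>A\<in>Obj (Tot X). Ident (Tot Y) (onO (ccT P) A)), P))
       (\<lambda>(_, (\<beta>, \<beta>'), R) (P, (\<alpha>, \<alpha>'), _).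
          (P, (\<lambda>x\<in>Obj (Base X). \<beta> x \<cdot>\<^bsub>Base Y\<^esub> \<alpha> x,
               \<lambda>A\<in>Obj (Tot X). \<beta>' A \<cdot>\<^bsub>Tot Y\<^esub> \<alpha>' A), R))"

definition cc_hcomp ::
  "('o, 'a, 'p, 'b) compcat \<Rightarrow> ('o, 'a, 'p, 'b) compcat \<Rightarrow> ('o, 'a, 'p, 'b) compcat \<Rightarrow>
   ('o, 'a, 'p, 'b) cc_cell \<Rightarrow> ('o, 'a, 'p, 'b) cc_cell \<Rightarrow> ('o, 'a, 'p, 'b) cc_cell" where
  "cc_hcomp X Y Z = (\<lambda>(Q, (\<beta>, \<beta>'), Q') (P, (\<alpha>, \<alpha>'), P').
     (cc_comp X Y Z Q P,
      (\<lambda>x\<in>Obj (Base X). \<beta> (onO (ccF P') x) \<cdot>\<^bsub>Base Z\<^esub> onA (ccF Q) (\<alpha> x),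
       \<lambda>A\<in>Obj (Tot X). \<beta>' (onO (ccT P') A) \<cdot>\<^bsub>Tot Z\<^esub> onA (ccT Q) (\<alpha>' A)),
      cc_comp X Y Z Q' P'))"

definition compcat_disc_ps ::
  "(('o, 'a, 'p, 'b) compcat, ('o, 'a, 'p, 'b) cc_map, ('o, 'a, 'p, 'b) cc_cell) cat2" where
  "compcat_disc_ps =
     \<lparr>Obj2 = {X. is_discrete_compcat X},
      Hom2 = cc_hom,
      Ident2 = cc_id,
      Comp2 = (\<lambda>X Y Z.
        \<lparr>onO = (\<lambda>(Q, P) \<in> Obj (cc_hom Y Z) \<times> Obj (cc_hom X Y). cc_comp X Y Z Q P),
         onA = (\<lambda>(\<beta>, \<alpha>) \<in> Arr (cc_hom Y Z) \<times> Arr (cc_hom X Y). cc_hcomp X Y Z \<beta> \<alpha>)\<rparr>)\<rparr>"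


section \<open>Categories with attributes\<close>

text \<open>Presheaves on \<open>C\<close> are functors from \<^term>\<open>op_cat C\<close> to \<^const>\<open>set_cat\<close>.\<close>

type_synonym ('o, 'a, 't) presheaf = "('o, 'a, 't set, 't set_map) ftor"

text \<open>
  In the category of elements, the pair \<open>(f, A)\<close> with \<open>f : \<Gamma>' \<rightarrow> \<Gamma>\<close> and \<open>A \<in> Ty \<Gamma>\<close> is the unique
  arrow over \<open>f\<close> with codomain \<open>(\<Gamma>, A)\<close>; its domain is \<open>(\<Gamma>', f\<^sup>* A)\<close>.
\<close>

definition elements_cat ::
  "('o, 'a) cat \<Rightarrow> ('o, 'a, 't) presheaf \<Rightarrow> ('o \<times> 't, 'a \<times> 't) cat" where
  "elements_cat C T =
     mk_cat {(x, A). x \<in> Obj C \<and> A \<in> onO T x}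
       {(f, A). f \<in> Arr C \<and> A \<in> onO T (Cod C f)}
       (\<lambda>(f, A). (Dom C f, set_app (onA T f) A)) (\<lambda>(f, A). (Cod C f, A))
       (\<lambda>(x, A). (Ident C x, A)) (\<lambda>(g, B) (f, A). (g \<cdot>\<^bsub>C\<^esub> f, B))"

definition elements_proj ::
  "('o, 'a) cat \<Rightarrow> ('o, 'a, 't) presheaf \<Rightarrow> ('o \<times> 't, 'a \<times> 't, 'o, 'a) ftor" where
  "elements_proj C T =
     \<lparr>onO = (\<lambda>(x, A) \<in> Obj (elements_cat C T). x), onA = (\<lambda>(f, A) \<in> Arr (elements_cat C T). f)\<rparr>"

record ('o, 'a, 't) cwa =
  Ctx :: "('o, 'a) cat"
  Ty :: "('o, 'a, 't) presheaf"
  Ext :: "('o \<times> 't, 'a \<times> 't, 'o, 'a) ftor"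
  Pr :: "'o \<times> 't \<Rightarrow> 'a"

abbreviation Elts :: "('o, 'a, 't) cwa \<Rightarrow> ('o \<times> 't, 'a \<times> 't) cat" where
  "Elts X \<equiv> elements_cat (Ctx X) (Ty X)"

definition is_cwa :: "('o, 'a, 't) cwa \<Rightarrow> bool" where
  "is_cwa X \<longleftrightarrow>
     category (Ctx X) \<and>
     is_functor (op_cat (Ctx X)) set_cat (Ty X) \<and>
     is_functor (Elts X) (Ctx X) (Ext X) \<and>
     nat_trans (Elts X) (Ctx X) (Ext X) (elements_proj (Ctx X) (Ty X)) (Pr X) \<and>
     (\<forall>e\<in>Arr (Elts X).
        is_pullback (Ctx X) (onA (Ext X) e) (Pr X (Dom (Elts X) e)) (Pr X (Cod (Elts X) e))
          (onA (elements_proj (Ctx X) (Ty X)) e))"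

record ('o, 'a, 't) cwa_map =
  mapF :: "('o, 'a, 'o, 'a) ftor"
  mapTy :: "'o \<Rightarrow> 't set_map"

record ('o, 'a, 't) cwa_pmap = "('o, 'a, 't) cwa_map" +
  mapIso :: "'o \<times> 't \<Rightarrow> 'a"

text \<open>
  The action on types is a natural transformation from \<open>Ty\<close> to \<open>Ty' \<cdot> F\<close>. The opposite of a
  functor has the same underlying data, so \<open>F\<close> itself is used for its opposite.
\<close>

definition cwa_premap ::
  "('o, 'a, 't) cwa \<Rightarrow> ('o, 'a, 't) cwa \<Rightarrow> ('o, 'a, 't, 'z) cwa_map_scheme \<Rightarrow> bool" where
  "cwa_premap X Y P \<longleftrightarrow>
     is_functor (Ctx X) (Ctx Y) (mapF P) \<and>
     nat_trans (op_cat (Ctx X)) set_cat (Ty X) (comp_functor (op_cat (Ctx X)) (Ty Y) (mapF P))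
       (mapTy P)"

text \<open>The functor between categories of elements induced by \<open>F\<close> and the action on types.\<close>

definition elements_functor ::
  "('o, 'a, 't) cwa \<Rightarrow> ('o, 'a, 't, 'z) cwa_map_scheme \<Rightarrow> ('o \<times> 't, 'a \<times> 't, 'o \<times> 't, 'a \<times> 't) ftor"
  where
  "elements_functor X P =
     \<lparr>onO = (\<lambda>(x, A) \<in> Obj (Elts X). (onO (mapF P) x, set_app (mapTy P x) A)),
      onA = (\<lambda>(f, A) \<in> Arr (Elts X). (onA (mapF P) f, set_app (mapTy P (Cod (Ctx X) f)) A))\<rparr>"

definition cwa_strict_map ::
  "('o, 'a, 't) cwa \<Rightarrow> ('o, 'a, 't) cwa \<Rightarrow> ('o, 'a, 't) cwa_map \<Rightarrow> bool" where
  "cwa_strict_map X Y P \<longleftrightarrow>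
     cwa_premap X Y P \<and>
     comp_functor (Elts X) (mapF P) (Ext X) = comp_functor (Elts X) (Ext Y) (elements_functor X P) \<and>
     (\<forall>e\<in>Obj (Elts X). onA (mapF P) (Pr X e) = Pr Y (onO (elements_functor X P) e))"

definition cwa_pseudo_map ::
  "('o, 'a, 't) cwa \<Rightarrow> ('o, 'a, 't) cwa \<Rightarrow> ('o, 'a, 't) cwa_pmap \<Rightarrow> bool" where
  "cwa_pseudo_map X Y P \<longleftrightarrow>
     cwa_premap X Y P \<and>
     nat_iso (Elts X) (Ctx Y)
       (comp_functor (Elts X) (mapF P) (Ext X))
       (comp_functor (Elts X) (Ext Y) (elements_functor X P))
       (mapIso P) \<and>
     (\<forall>e\<in>Obj (Elts X).
        Pr Y (onO (elements_functor X P) e) \<cdot>\<^bsub>Ctx Y\<^esub> mapIso P e = onA (mapF P) (Pr X e))"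

definition cwa_transformation ::
  "('o, 'a, 't) cwa \<Rightarrow> ('o, 'a, 't) cwa \<Rightarrow>
   ('o, 'a, 't) cwa_pmap \<Rightarrow> ('o, 'a, 't) cwa_pmap \<Rightarrow> ('o \<Rightarrow> 'a) \<Rightarrow> bool" where
  "cwa_transformation X Y P Q \<alpha> \<longleftrightarrow>
     nat_trans (Ctx X) (Ctx Y) (mapF P) (mapF Q) \<alpha> \<and>
     (\<forall>(x, A) \<in> Obj (Elts X).
        set_app (onA (Ty Y) (\<alpha> x)) (set_app (mapTy Q x) A) = set_app (mapTy P x) A \<and>
        mapIso Q (x, A) \<cdot>\<^bsub>Ctx Y\<^esub> \<alpha> (onO (Ext X) (x, A)) =
        onA (Ext Y) (\<alpha> x, set_app (mapTy Q x) A) \<cdot>\<^bsub>Ctx Y\<^esub> mapIso P (x, A))"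

definition cwa_strict_id :: "('o, 'a, 't) cwa \<Rightarrow> ('o, 'a, 't) cwa_map" where
  "cwa_strict_id X =
     \<lparr>mapF = id_functor (Ctx X), mapTy = (\<lambda>x\<in>Obj (Ctx X). Ident set_cat (onO (Ty X) x))\<rparr>"

definition cwa_strict_comp ::
  "('o, 'a, 't) cwa \<Rightarrow> ('o, 'a, 't) cwa_map \<Rightarrow> ('o, 'a, 't) cwa_map \<Rightarrow> ('o, 'a, 't) cwa_map" where
  "cwa_strict_comp X Q P =
     \<lparr>mapF = comp_functor (Ctx X) (mapF Q) (mapF P),
      mapTy = (\<lambda>x\<in>Obj (Ctx X). mapTy Q (onO (mapF P) x) \<cdot>\<^bsub>set_cat\<^esub> mapTy P x)\<rparr>"

definition cwa_str1 ::
  "(('o, 'a, 't) cwa, ('o, 'a, 't) cwa \<times> ('o, 'a, 't) cwa_map \<times> ('o, 'a, 't) cwa) cat" where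
  "cwa_str1 =
     mk_cat {X. is_cwa X}
       {(X, P, Y). is_cwa X \<and> is_cwa Y \<and> cwa_strict_map X Y P}
       (\<lambda>(X, P, Y). X) (\<lambda>(X, P, Y). Y)
       (\<lambda>X. (X, cwa_strict_id X, X))
       (\<lambda>(_, Q, Z) (X, P, _). (X, cwa_strict_comp X Q P, Z))"

definition cwa_id :: "('o, 'a, 't) cwa \<Rightarrow> ('o, 'a, 't) cwa_pmap" where
  "cwa_id X =
     \<lparr>mapF = id_functor (Ctx X),
      mapTy = (\<lambda>x\<in>Obj (Ctx X). Ident set_cat (onO (Ty X) x)),
      mapIso = (\<lambda>e\<in>Obj (Elts X). Ident (Ctx X) (onO (Ext X) e))\<rparr>"

definition cwa_comp ::
  "('o, 'a, 't) cwa \<Rightarrow> ('o, 'a, 't) cwa \<Rightarrow>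
   ('o, 'a, 't) cwa_pmap \<Rightarrow> ('o, 'a, 't) cwa_pmap \<Rightarrow> ('o, 'a, 't) cwa_pmap" where
  "cwa_comp X Z Q P =
     \<lparr>mapF = comp_functor (Ctx X) (mapF Q) (mapF P),
      mapTy = (\<lambda>x\<in>Obj (Ctx X). mapTy Q (onO (mapF P) x) \<cdot>\<^bsub>set_cat\<^esub> mapTy P x),
      mapIso = (\<lambda>e\<in>Obj (Elts X).
        mapIso Q (onO (elements_functor X P) e) \<cdot>\<^bsub>Ctx Z\<^esub> onA (mapF Q) (mapIso P e))\<rparr>"

type_synonym ('o, 'a, 't) cwa_cell =
  "('o, 'a, 't) cwa_pmap \<times> ('o \<Rightarrow> 'a) \<times> ('o, 'a, 't) cwa_pmap"

definition cwa_hom ::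
  "('o, 'a, 't) cwa \<Rightarrow> ('o, 'a, 't) cwa \<Rightarrow> (('o, 'a, 't) cwa_pmap, ('o, 'a, 't) cwa_cell) cat" where
  "cwa_hom X Y =
     mk_cat {P. cwa_pseudo_map X Y P}
       {(P, \<alpha>, Q). cwa_pseudo_map X Y P \<and> cwa_pseudo_map X Y Q \<and> cwa_transformation X Y P Q \<alpha>}
       (\<lambda>(P, \<alpha>, Q). P) (\<lambda>(P, \<alpha>, Q). Q)
       (\<lambda>P. (P, \<lambda>x\<in>Obj (Ctx X). Ident (Ctx Y) (onO (mapF P) x), P))
       (\<lambda>(_, \<beta>, R) (P, \<alpha>, _). (P, \<lambda>x\<in>Obj (Ctx X). \<beta> x \<cdot>\<^bsub>Ctx Y\<^esub> \<alpha> x, R))"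

definition cwa_hcomp ::
  "('o, 'a, 't) cwa \<Rightarrow> ('o, 'a, 't) cwa \<Rightarrow>
   ('o, 'a, 't) cwa_cell \<Rightarrow> ('o, 'a, 't) cwa_cell \<Rightarrow> ('o, 'a, 't) cwa_cell" where
  "cwa_hcomp X Z = (\<lambda>(Q, \<beta>, Q') (P, \<alpha>, P').
     (cwa_comp X Z Q P,
      \<lambda>x\<in>Obj (Ctx X). \<beta> (onO (mapF P') x) \<cdot>\<^bsub>Ctx Z\<^esub> onA (mapF Q) (\<alpha> x),
      cwa_comp X Z Q' P'))"

definition cwa_ps :: "(('o, 'a, 't) cwa, ('o, 'a, 't) cwa_pmap, ('o, 'a, 't) cwa_cell) cat2" where
  "cwa_ps =
     \<lparr>Obj2 = {X. is_cwa X},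
      Hom2 = cwa_hom,
      Ident2 = cwa_id,
      Comp2 = (\<lambda>X Y Z.
        \<lparr>onO = (\<lambda>(Q, P) \<in> Obj (cwa_hom Y Z) \<times> Obj (cwa_hom X Y). cwa_comp X Z Q P),
         onA = (\<lambda>(\<beta>, \<alpha>) \<in> Arr (cwa_hom Y Z) \<times> Arr (cwa_hom X Y). cwa_hcomp X Z \<beta> \<alpha>)\<rparr>)\<rparr>"


section \<open>Small structures\<close>

text \<open>
  HOL has no type of all small sets. An infinite type \<open>'u\<close> plays the role of the universe:
  ``small'' means carried by subsets of \<open>'u\<close>, both for the categories involved and for the sets
  \<open>Ty \<Gamma>\<close>. Infinity of \<open>'u\<close> makes the universe closed under binary products, as needed for the
  category of elements of a small presheaf to be small up to isomorphism.
\<close>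

type_synonym 'u small_cwa = "('u, 'u, 'u) cwa"
type_synonym 'u small_cwa_map = "('u, 'u, 'u) cwa_map"
type_synonym 'u small_cwa_pmap = "('u, 'u, 'u) cwa_pmap"
type_synonym 'u small_cwa_cell = "('u, 'u, 'u) cwa_cell"
type_synonym 'u small_compcat = "('u, 'u, 'u, 'u) compcat"
type_synonym 'u small_cc_map = "('u, 'u, 'u, 'u) cc_map"
type_synonym 'u small_cc_cell = "('u, 'u, 'u, 'u) cc_cell"

end

theory Submission
  imports Defs
begin

text \<open>
  A category with attributes is a discrete comprehension category whose total category is presented
  as a category of elements: the arrows into \<open>A\<close> of a discrete fibration are the unique lifts of the
  arrows into its base point, so the fibres form a presheaf \<open>Ty\<close> with \<open>\<integral>Ty\<close> isomorphic to the total
  category. Call an isomorphism between \<open>\<integral>Ty\<close> and the total category of a comprehension category,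
  compatible with projections and comprehensions, a presentation. Over any two presentations, pseudo
  maps of categories with attributes correspond bijectively to pseudo maps of comprehension categories
  (the comparison isomorphisms being inverted, as they point in opposite directions), and likewise for
  transformations, whose component on types is forced by unique lifting. Discrete comprehension
  categories have strictly associative structure for formal reasons, and categories with attributes
  inherit theirs along this bijection. Every category with attributes has a presentation with total
  category carried by \<open>'u\<close>, using an injection of \<open>'u \<times> 'u\<close> into \<open>'u\<close>; every discrete comprehension
  category has one by its fibres; and two presentations of the same category with attributes are
  connected by a strict isomorphism.
\<close>


section \<open>Categories\<close>

text \<open>The category of elements lives on pairs, while the total category has to be carried by
  the universe, so passing from a CwA to a comprehension category involves an arbitrary coding. For
  this reason the correspondence of maps is stated between any two presentations, not for one fixed
  coding. Comparing a chosen presentation with the fibre presentation of a given comprehension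
  category then gives essential surjectivity from the same lemmas that give full faithfulness. On
  1-cells the correspondence is a bijection on the nose, so the hom-functors are even isomorphisms
  of categories. Laws for CwA's are therefore reflected from those for comprehension categories: an
  equation between maps or transformations holds once it holds after an injective assignment. A
  2-cell of comprehension categories has an extra component on the total categories; forgetting it
  is inverse to lifting the base component.\<close>

lemma restrict_eqI:
  "\<lbrakk>g \<in> extensional A; \<And>x. x \<in> A \<Longrightarrow> f x = g x\<rbrakk> \<Longrightarrow> restrict f A = g"
  by (rule extensionalityI[where A = A]) auto

context category
begin

lemma Dom_Obj [simp]: "f \<in> Arr C \<Longrightarrow> Dom C f \<in> Obj C"
  using Dom_closed by auto

lemma Cod_Obj [simp]: "f \<in> Arr C \<Longrightarrow> Cod C f \<in> Obj C"
  using Cod_closed by auto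

lemma Ident_Arr [simp]: "x \<in> Obj C \<Longrightarrow> Ident C x \<in> Arr C"
  and Dom_Ident [simp]: "x \<in> Obj C \<Longrightarrow> Dom C (Ident C x) = x"
  and Cod_Ident [simp]: "x \<in> Obj C \<Longrightarrow> Cod C (Ident C x) = x"
  using Ident_hom by (auto simp: hom_def)

lemma Comp_Arr [simp]: "\<lbrakk>f \<in> Arr C; g \<in> Arr C; Dom C g = Cod C f\<rbrakk> \<Longrightarrow> g \<cdot> f \<in> Arr C"
  and Dom_Comp [simp]: "\<lbrakk>f \<in> Arr C; g \<in> Arr C; Dom C g = Cod C f\<rbrakk> \<Longrightarrow> Dom C (g \<cdot> f) = Dom C f"
  and Cod_Comp [simp]: "\<lbrakk>f \<in> Arr C; g \<in> Arr C; Dom C g = Cod C f\<rbrakk> \<Longrightarrow> Cod C (g \<cdot> f) = Cod C g"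
  using Comp_hom[of f "Dom C f" "Cod C f" g "Cod C g"] by (auto simp: hom_def)

lemma Ident_Comp [simp]: "\<lbrakk>f \<in> Arr C; Cod C f = y\<rbrakk> \<Longrightarrow> Ident C y \<cdot> f = f"
  using Comp_Ident_left[of f "Dom C f" y] by (auto simp: hom_def)

lemma Comp_Ident [simp]: "\<lbrakk>f \<in> Arr C; Dom C f = x\<rbrakk> \<Longrightarrow> f \<cdot> Ident C x = f"
  using Comp_Ident_right[of f x "Cod C f"] by (auto simp: hom_def)

lemma assoc:
  "\<lbrakk>f \<in> Arr C; g \<in> Arr C; h \<in> Arr C; Dom C g = Cod C f; Dom C h = Cod C g\<rbrakk>
    \<Longrightarrow> (h \<cdot> g) \<cdot> f = h \<cdot> (g \<cdot> f)"
  using Comp_assoc[of f "Dom C f" "Cod C f" g "Cod C g" h "Cod C h"] by (auto simp: hom_def)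

end

lemma mk_cat_simps [simp]:
  "Obj (mk_cat Ob Ar d c i m) = Ob" "Arr (mk_cat Ob Ar d c i m) = Ar"
  "f \<in> Ar \<Longrightarrow> Dom (mk_cat Ob Ar d c i m) f = d f"
  "f \<in> Ar \<Longrightarrow> Cod (mk_cat Ob Ar d c i m) f = c f"
  "x \<in> Ob \<Longrightarrow> Ident (mk_cat Ob Ar d c i m) x = i x"
  "\<lbrakk>f \<in> Ar; g \<in> Ar; d g = c f\<rbrakk> \<Longrightarrow> Comp (mk_cat Ob Ar d c i m) g f = m g f"
  by (simp_all add: mk_cat_def)

text \<open>Since \<open>mk_cat\<close> is \<open>undefined\<close> off the carriers, the
  extensionality axioms hold by construction and only the equations on the carriers are
  left.\<close>

lemma category_mk_cat:
  assumes "\<And>f. f \<in> Ar \<Longrightarrow> d f \<in> Ob" "\<And>f. f \<in> Ar \<Longrightarrow> c f \<in> Ob"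
    and "\<And>x. x \<in> Ob \<Longrightarrow> i x \<in> Ar" "\<And>x. x \<in> Ob \<Longrightarrow> d (i x) = x" "\<And>x. x \<in> Ob \<Longrightarrow> c (i x) = x"
    and "\<And>f g. \<lbrakk>f \<in> Ar; g \<in> Ar; d g = c f\<rbrakk> \<Longrightarrow> m g f \<in> Ar"
    and "\<And>f g. \<lbrakk>f \<in> Ar; g \<in> Ar; d g = c f\<rbrakk> \<Longrightarrow> d (m g f) = d f"
    and "\<And>f g. \<lbrakk>f \<in> Ar; g \<in> Ar; d g = c f\<rbrakk> \<Longrightarrow> c (m g f) = c g"
    and "\<And>f. f \<in> Ar \<Longrightarrow> m (i (c f)) f = f" "\<And>f. f \<in> Ar \<Longrightarrow> m f (i (d f)) = f"
    and "\<And>f g h. \<lbrakk>f \<in> Ar; g \<in> Ar; h \<in> Ar; d g = c f; d h = c g\<rbrakk> \<Longrightarrow> m (m h g) f = m h (m g f)"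
  shows "category (mk_cat Ob Ar d c i m)"
  using assms by unfold_locales (auto simp: hom_def mk_cat_def)

lemma category_op_cat:
  assumes "category C"
  shows "category (op_cat C)"
proof -
  interpret category C by fact
  show ?thesis
    unfolding op_cat_def by (rule category_mk_cat) (auto simp: assoc)
qed

lemma op_cat_simps [simp]:
  "Obj (op_cat C) = Obj C" "Arr (op_cat C) = Arr C"
  "f \<in> Arr C \<Longrightarrow> Dom (op_cat C) f = Cod C f" "f \<in> Arr C \<Longrightarrow> Cod (op_cat C) f = Dom C f"
  "x \<in> Obj C \<Longrightarrow> Ident (op_cat C) x = Ident C x"
  "\<lbrakk>f \<in> Arr C; g \<in> Arr C; Cod C g = Dom C f\<rbrakk> \<Longrightarrow> Comp (op_cat C) g f = Comp C f g"
  by (simp_all add: op_cat_def)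

lemma category_prod_cat:
  assumes "category C" "category D"
  shows "category (prod_cat C D)"
proof -
  interpret C: category C by fact
  interpret D: category D by fact
  show ?thesis
    unfolding prod_cat_def by (rule category_mk_cat) (auto simp: C.assoc D.assoc)
qed

lemma prod_cat_simps [simp]:
  "Obj (prod_cat C D) = Obj C \<times> Obj D" "Arr (prod_cat C D) = Arr C \<times> Arr D"
  "\<lbrakk>f \<in> Arr C; g \<in> Arr D\<rbrakk> \<Longrightarrow> Dom (prod_cat C D) (f, g) = (Dom C f, Dom D g)"
  "\<lbrakk>f \<in> Arr C; g \<in> Arr D\<rbrakk> \<Longrightarrow> Cod (prod_cat C D) (f, g) = (Cod C f, Cod D g)"
  "\<lbrakk>x \<in> Obj C; y \<in> Obj D\<rbrakk> \<Longrightarrow> Ident (prod_cat C D) (x, y) = (Ident C x, Ident D y)"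
  "\<lbrakk>f \<in> Arr C; g \<in> Arr D; f' \<in> Arr C; g' \<in> Arr D; Dom C f' = Cod C f; Dom D g' = Cod D g\<rbrakk>
    \<Longrightarrow> Comp (prod_cat C D) (f', g') (f, g) = (Comp C f' f, Comp D g' g)"
  by (simp_all add: prod_cat_def)


section \<open>Isomorphisms\<close>

text \<open>A total choice of inverse lets inverses be composed and rewritten as terms. In a
  category an isomorphism has only one two-sided inverse, so the choice never shows there.\<close>

definition inverse_arr :: "('o, 'a) cat \<Rightarrow> 'a \<Rightarrow> 'a" where
  "inverse_arr C f = (SOME g. g \<in> hom C (Cod C f) (Dom C f) \<and>
     g \<cdot>\<^bsub>C\<^esub> f = Ident C (Dom C f) \<and> f \<cdot>\<^bsub>C\<^esub> g = Ident C (Cod C f))"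

lemma is_iso_Arr: "is_iso C f \<Longrightarrow> f \<in> Arr C"
  by (simp add: is_iso_def)

lemma
  assumes "is_iso C f"
  shows inverse_arr_Arr [simp]: "inverse_arr C f \<in> Arr C"
    and Dom_inverse_arr [simp]: "Dom C (inverse_arr C f) = Cod C f"
    and Cod_inverse_arr [simp]: "Cod C (inverse_arr C f) = Dom C f"
    and inverse_arr_Comp [simp]: "inverse_arr C f \<cdot>\<^bsub>C\<^esub> f = Ident C (Dom C f)"
    and Comp_inverse_arr [simp]: "f \<cdot>\<^bsub>C\<^esub> inverse_arr C f = Ident C (Cod C f)"
proof -
  have "\<exists>g. g \<in> hom C (Cod C f) (Dom C f) \<and>
     g \<cdot>\<^bsub>C\<^esub> f = Ident C (Dom C f) \<and> f \<cdot>\<^bsub>C\<^esub> g = Ident C (Cod C f)"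
    using assms unfolding is_iso_def by blast
  from someI_ex[OF this]
  have *: "inverse_arr C f \<in> hom C (Cod C f) (Dom C f) \<and>
     inverse_arr C f \<cdot>\<^bsub>C\<^esub> f = Ident C (Dom C f) \<and> f \<cdot>\<^bsub>C\<^esub> inverse_arr C f = Ident C (Cod C f)"
    unfolding inverse_arr_def .
  then show "inverse_arr C f \<in> Arr C" "Dom C (inverse_arr C f) = Cod C f"
    "Cod C (inverse_arr C f) = Dom C f" "inverse_arr C f \<cdot>\<^bsub>C\<^esub> f = Ident C (Dom C f)"
    "f \<cdot>\<^bsub>C\<^esub> inverse_arr C f = Ident C (Cod C f)"
    by (auto simp: hom_def)
qed

lemma is_isoI:
  assumes "f \<in> Arr C" "g \<in> Arr C" "Dom C g = Cod C f" "Cod C g = Dom C f"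
    and "g \<cdot>\<^bsub>C\<^esub> f = Ident C (Dom C f)" "f \<cdot>\<^bsub>C\<^esub> g = Ident C (Cod C f)"
  shows "is_iso C f"
  using assms unfolding is_iso_def hom_def by blast

lemma is_iso_inverse_arr [simp]: "is_iso C f \<Longrightarrow> is_iso C (inverse_arr C f)"
  by (rule is_isoI[where g = f]) (simp_all add: is_iso_Arr)

context category
begin

lemma inverse_arr_unique:
  assumes "f \<in> Arr C" "g \<in> Arr C" "Dom C g = Cod C f" "Cod C g = Dom C f"
    and "g \<cdot> f = Ident C (Dom C f)" "f \<cdot> g = Ident C (Cod C f)"
  shows "inverse_arr C f = g"
proof -
  have iso: "is_iso C f" using assms by (rule is_isoI)
  have "inverse_arr C f = inverse_arr C f \<cdot> (f \<cdot> g)"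
    using assms iso by simp
  also have "\<dots> = (inverse_arr C f \<cdot> f) \<cdot> g"
    by (rule assoc[symmetric]) (use assms iso in auto)
  finally show ?thesis
    using assms iso by simp
qed

lemma inverse_arr_Comp_cancel [simp]:
  "\<lbrakk>is_iso C f; g \<in> Arr C; Cod C g = Dom C f\<rbrakk> \<Longrightarrow> inverse_arr C f \<cdot> (f \<cdot> g) = g"
  by (simp add: is_iso_Arr assoc[symmetric])

lemma Comp_inverse_arr_cancel [simp]:
  "\<lbrakk>is_iso C f; g \<in> Arr C; Cod C g = Cod C f\<rbrakk> \<Longrightarrow> f \<cdot> (inverse_arr C f \<cdot> g) = g"
  by (simp add: is_iso_Arr assoc[symmetric])

lemma inverse_arr_inverse_arr [simp]: "is_iso C f \<Longrightarrow> inverse_arr C (inverse_arr C f) = f"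
  by (rule inverse_arr_unique) (simp_all add: is_iso_Arr)

lemma is_iso_Ident [simp]: "x \<in> Obj C \<Longrightarrow> is_iso C (Ident C x)"
  by (rule is_isoI[where g = "Ident C x"]) simp_all

lemma inverse_arr_Ident [simp]: "x \<in> Obj C \<Longrightarrow> inverse_arr C (Ident C x) = Ident C x"
  by (rule inverse_arr_unique) simp_all

lemma
  assumes "is_iso C f" "is_iso C g" "Dom C g = Cod C f"
  shows is_iso_Comp: "is_iso C (g \<cdot> f)"
    and inverse_arr_of_Comp: "inverse_arr C (g \<cdot> f) = inverse_arr C f \<cdot> inverse_arr C g"
proof -
  have a: "f \<in> Arr C" "g \<in> Arr C" using assms by (simp_all add: is_iso_Arr)
  have 1: "inverse_arr C f \<cdot> inverse_arr C g \<cdot> (g \<cdot> f) = Ident C (Dom C f)"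
    using a assms by (simp add: assoc)
  have 2: "g \<cdot> f \<cdot> (inverse_arr C f \<cdot> inverse_arr C g) = Ident C (Cod C g)"
    using a assms by (simp add: assoc)
  show "is_iso C (g \<cdot> f)"
    by (rule is_isoI[where g = "inverse_arr C f \<cdot> inverse_arr C g"]) (use a assms 1 2 in auto)
  show "inverse_arr C (g \<cdot> f) = inverse_arr C f \<cdot> inverse_arr C g"
    by (rule inverse_arr_unique) (use a assms 1 2 in auto)
qed

text \<open>Composing with the two inverses turns a square over a and b into one over their
  inverses. This is how naturality and compatibility pass between the two notions of map, whose
  comparison isomorphisms point in opposite directions.\<close>

lemma inverse_arr_square:
  assumes "is_iso C a" "is_iso C b" "f \<in> Arr C" "g \<in> Arr C"
    and "Dom C f = Dom C a" "Cod C f = Dom C b" "Dom C g = Cod C a" "Cod C g = Cod C b"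
  shows "b \<cdot> f = g \<cdot> a \<longleftrightarrow> f \<cdot> inverse_arr C a = inverse_arr C b \<cdot> g"
proof
  have ar: "a \<in> Arr C" "b \<in> Arr C" using assms by (simp_all add: is_iso_Arr)
  show "f \<cdot> inverse_arr C a = inverse_arr C b \<cdot> g" if eq: "b \<cdot> f = g \<cdot> a"
  proof -
    have "f \<cdot> inverse_arr C a = inverse_arr C b \<cdot> (b \<cdot> f) \<cdot> inverse_arr C a"
      using ar assms by (simp add: assoc)
    then show ?thesis using ar assms unfolding eq by (simp add: assoc)
  qed
  show "b \<cdot> f = g \<cdot> a" if eq: "f \<cdot> inverse_arr C a = inverse_arr C b \<cdot> g"
  proof -
    have "b \<cdot> f = b \<cdot> (f \<cdot> inverse_arr C a) \<cdot> a"
      using ar assms by (simp add: assoc)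
    then show ?thesis using ar assms unfolding eq by (simp add: assoc)
  qed
qed

end


section \<open>Functors\<close>

locale functor_between =
  fixes C :: "('o, 'a) cat" and D :: "('p, 'b) cat" and F :: "('o, 'a, 'p, 'b) ftor"
  assumes is_functor: "is_functor C D F"
begin

sublocale C: category C
  using is_functor by (simp add: is_functor_def)

sublocale D: category D
  using is_functor by (simp add: is_functor_def)

lemma onO_Obj [simp]: "x \<in> Obj C \<Longrightarrow> onO F x \<in> Obj D"
  and onA_Arr [simp]: "f \<in> Arr C \<Longrightarrow> onA F f \<in> Arr D"
  and Dom_onA [simp]: "f \<in> Arr C \<Longrightarrow> Dom D (onA F f) = onO F (Dom C f)"
  and Cod_onA [simp]: "f \<in> Arr C \<Longrightarrow> Cod D (onA F f) = onO F (Cod C f)"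
  and onA_Ident [simp]: "x \<in> Obj C \<Longrightarrow> onA F (Ident C x) = Ident D (onO F x)"
  and onA_Comp [simp]: "\<lbrakk>f \<in> Arr C; g \<in> Arr C; Dom C g = Cod C f\<rbrakk>
    \<Longrightarrow> onA F (g \<cdot>\<^bsub>C\<^esub> f) = onA F g \<cdot>\<^bsub>D\<^esub> onA F f"
  and onO_extensional: "onO F \<in> extensional (Obj C)"
  and onA_extensional: "onA F \<in> extensional (Arr C)"
  using is_functor by (auto simp: is_functor_def hom_def PiE_iff)

lemma onA_is_iso [simp]: "is_iso C f \<Longrightarrow> is_iso D (onA F f)"
  and onA_inverse_arr: "is_iso C f \<Longrightarrow> onA F (inverse_arr C f) = inverse_arr D (onA F f)"
proof -
  assume f: "is_iso C f"
  note [simp] = is_iso_Arr[OF f] f onA_Comp[symmetric]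
  show "is_iso D (onA F f)"
    by (rule is_isoI[where g = "onA F (inverse_arr C f)"]) (simp_all del: onA_Comp)
  show "onA F (inverse_arr C f) = inverse_arr D (onA F f)"
    by (rule sym, rule D.inverse_arr_unique) (simp_all del: onA_Comp)
qed

end

lemma is_functorI:
  assumes "category C" "category D"
    and "\<And>x. x \<in> Obj C \<Longrightarrow> onO F x \<in> Obj D"
    and "\<And>f. f \<in> Arr C \<Longrightarrow> onA F f \<in> Arr D"
    and "\<And>f. f \<in> Arr C \<Longrightarrow> Dom D (onA F f) = onO F (Dom C f)"
    and "\<And>f. f \<in> Arr C \<Longrightarrow> Cod D (onA F f) = onO F (Cod C f)"
    and "\<And>x. x \<in> Obj C \<Longrightarrow> onA F (Ident C x) = Ident D (onO F x)"
    and "\<And>f g. \<lbrakk>f \<in> Arr C; g \<in> Arr C; Dom C g = Cod C f\<rbrakk>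
      \<Longrightarrow> onA F (g \<cdot>\<^bsub>C\<^esub> f) = onA F g \<cdot>\<^bsub>D\<^esub> onA F f"
    and "onO F \<in> extensional (Obj C)" "onA F \<in> extensional (Arr C)"
  shows "is_functor C D F"
  using assms by (auto simp: is_functor_def hom_def PiE_iff)

lemma functor_between_iff: "functor_between C D F \<longleftrightarrow> is_functor C D F"
  by (simp add: functor_between_def)

lemma functor_eqI:
  fixes F G :: "('o, 'a, 'p, 'b) ftor"
  assumes "onO F \<in> extensional (Obj C)" "onO G \<in> extensional (Obj C)"
    and "onA F \<in> extensional (Arr C)" "onA G \<in> extensional (Arr C)"
    and "\<And>x. x \<in> Obj C \<Longrightarrow> onO F x = onO G x" "\<And>f. f \<in> Arr C \<Longrightarrow> onA F f = onA G f"
  shows "F = G"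
  by (rule ftor.equality) (use assms in \<open>auto intro: extensionalityI\<close>)

lemma id_functor_simps [simp]:
  "x \<in> Obj C \<Longrightarrow> onO (id_functor C) x = x" "f \<in> Arr C \<Longrightarrow> onA (id_functor C) f = f"
  by (simp_all add: id_functor_def)

lemma comp_functor_simps [simp]:
  "x \<in> Obj C \<Longrightarrow> onO (comp_functor C G F) x = onO G (onO F x)"
  "f \<in> Arr C \<Longrightarrow> onA (comp_functor C G F) f = onA G (onA F f)"
  by (simp_all add: comp_functor_def compose_def)

lemma comp_functor_extensional [simp]:
  "onO (comp_functor C G F) \<in> extensional (Obj C)" "onA (comp_functor C G F) \<in> extensional (Arr C)"
  by (simp_all add: comp_functor_def)

lemma id_functor_extensional [simp]:
  "onO (id_functor C) \<in> extensional (Obj C)" "onA (id_functor C) \<in> extensional (Arr C)"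
  by (simp_all add: id_functor_def)

lemma comp_functor_eqI:
  assumes "\<And>x. x \<in> Obj C \<Longrightarrow> onO G (onO F x) = onO G' (onO F' x)"
    and "\<And>f. f \<in> Arr C \<Longrightarrow> onA G (onA F f) = onA G' (onA F' f)"
  shows "comp_functor C G F = comp_functor C G' F'"
  by (rule functor_eqI[where C = C]) (use assms in auto)

lemma comp_functor_eqD:
  assumes "comp_functor C G F = comp_functor C G' F'"
  shows "x \<in> Obj C \<Longrightarrow> onO G (onO F x) = onO G' (onO F' x)"
    and "f \<in> Arr C \<Longrightarrow> onA G (onA F f) = onA G' (onA F' f)"
  using assms by (metis comp_functor_simps)+

lemma is_functor_id:
  assumes "category C"
  shows "is_functor C C (id_functor C)"
proof -
  interpret category C by fact
  show ?thesis by (rule is_functorI) (simp_all add: assms)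
qed

lemma is_functor_comp:
  assumes "is_functor C D F" "is_functor D E G"
  shows "is_functor C E (comp_functor C G F)"
proof -
  interpret F: functor_between C D F by standard fact
  interpret G: functor_between D E G by standard fact
  show ?thesis by (rule is_functorI) (simp_all add: F.C.category_axioms G.D.category_axioms)
qed

lemma comp_functor_assoc:
  assumes "is_functor C D F"
  shows "comp_functor C (comp_functor D H G) F = comp_functor C H (comp_functor C G F)"
proof -
  interpret F: functor_between C D F by standard fact
  show ?thesis by (rule functor_eqI[where C = C]) simp_all
qed

lemma comp_functor_id_left:
  assumes "is_functor C D F"
  shows "comp_functor C (id_functor D) F = F"
proof -
  interpret F: functor_between C D F by standard fact
  show ?thesis by (rule functor_eqI[where C = C]) (simp_all add: F.onO_extensional F.onA_extensional)
qed

lemma comp_functor_id_right: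
  assumes "is_functor C D F"
  shows "comp_functor C F (id_functor C) = F"
proof -
  interpret F: functor_between C D F by standard fact
  show ?thesis by (rule functor_eqI[where C = C]) (simp_all add: F.onO_extensional F.onA_extensional)
qed


section \<open>Natural transformations\<close>

locale natural_transformation =
  fixes C :: "('o, 'a) cat" and D :: "('p, 'b) cat" and F G :: "('o, 'a, 'p, 'b) ftor"
    and \<alpha> :: "'o \<Rightarrow> 'b"
  assumes nat_trans: "nat_trans C D F G \<alpha>"
begin

sublocale F: functor_between C D F
  using nat_trans by unfold_locales (simp add: nat_trans_def)

sublocale G: functor_between C D G
  using nat_trans by unfold_locales (simp add: nat_trans_def)

lemma component_Arr [simp]: "x \<in> Obj C \<Longrightarrow> \<alpha> x \<in> Arr D"
  and Dom_component [simp]: "x \<in> Obj C \<Longrightarrow> Dom D (\<alpha> x) = onO F x"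
  and Cod_component [simp]: "x \<in> Obj C \<Longrightarrow> Cod D (\<alpha> x) = onO G x"
  and naturality: "f \<in> Arr C \<Longrightarrow> \<alpha> (Cod C f) \<cdot>\<^bsub>D\<^esub> onA F f = onA G f \<cdot>\<^bsub>D\<^esub> \<alpha> (Dom C f)"
  and component_extensional: "\<alpha> \<in> extensional (Obj C)"
  using nat_trans by (auto simp: nat_trans_def hom_def)

end

lemma nat_transI:
  assumes "is_functor C D F" "is_functor C D G" "\<alpha> \<in> extensional (Obj C)"
    and "\<And>x. x \<in> Obj C \<Longrightarrow> \<alpha> x \<in> Arr D"
    and "\<And>x. x \<in> Obj C \<Longrightarrow> Dom D (\<alpha> x) = onO F x"
    and "\<And>x. x \<in> Obj C \<Longrightarrow> Cod D (\<alpha> x) = onO G x"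
    and "\<And>f. f \<in> Arr C \<Longrightarrow> \<alpha> (Cod C f) \<cdot>\<^bsub>D\<^esub> onA F f = onA G f \<cdot>\<^bsub>D\<^esub> \<alpha> (Dom C f)"
  shows "nat_trans C D F G \<alpha>"
  using assms by (auto simp: nat_trans_def hom_def)

lemma nat_iso_id:
  assumes "is_functor C D F"
  shows "nat_iso C D F F (\<lambda>x\<in>Obj C. Ident D (onO F x))"
proof -
  interpret F: functor_between C D F by standard fact
  show ?thesis
    unfolding nat_iso_def by (auto intro!: nat_transI simp: assms)
qed

lemmas nat_trans_id = nat_iso_id[THEN nat_iso_def[THEN iffD1], THEN conjunct1]

lemma nat_trans_vcomp:
  assumes "nat_trans C D F G \<alpha>" "nat_trans C D G H \<beta>"
  shows "nat_trans C D F H (\<lambda>x\<in>Obj C. \<beta> x \<cdot>\<^bsub>D\<^esub> \<alpha> x)"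
proof -
  interpret a: natural_transformation C D F G \<alpha> by standard fact
  interpret b: natural_transformation C D G H \<beta> by standard fact
  note F = a.F.is_functor and H = b.G.is_functor
  show ?thesis
  proof (rule nat_transI[OF F H])
    fix f assume f: "f \<in> Arr C"
    have "\<beta> (Cod C f) \<cdot>\<^bsub>D\<^esub> \<alpha> (Cod C f) \<cdot>\<^bsub>D\<^esub> onA F f = \<beta> (Cod C f) \<cdot>\<^bsub>D\<^esub> onA G f \<cdot>\<^bsub>D\<^esub> \<alpha> (Dom C f)"
      using f by (simp add: a.naturality a.F.D.assoc)
    also have "\<dots> = onA H f \<cdot>\<^bsub>D\<^esub> (\<beta> (Dom C f) \<cdot>\<^bsub>D\<^esub> \<alpha> (Dom C f))"
      using f by (simp add: b.naturality a.F.D.assoc)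
    finally show "(\<lambda>x\<in>Obj C. \<beta> x \<cdot>\<^bsub>D\<^esub> \<alpha> x) (Cod C f) \<cdot>\<^bsub>D\<^esub> onA F f =
      onA H f \<cdot>\<^bsub>D\<^esub> (\<lambda>x\<in>Obj C. \<beta> x \<cdot>\<^bsub>D\<^esub> \<alpha> x) (Dom C f)"
      using f by simp
  qed auto
qed

lemma nat_iso_vcomp:
  assumes "nat_iso C D F G \<alpha>" "nat_iso C D G H \<beta>"
  shows "nat_iso C D F H (\<lambda>x\<in>Obj C. \<beta> x \<cdot>\<^bsub>D\<^esub> \<alpha> x)"
proof -
  interpret a: natural_transformation C D F G \<alpha> using assms by unfold_locales (simp add: nat_iso_def)
  interpret b: natural_transformation C D G H \<beta> using assms by unfold_locales (simp add: nat_iso_def)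
  show ?thesis
    using assms nat_trans_vcomp[of C D F G \<alpha> H \<beta>]
    by (auto simp: nat_iso_def intro!: a.F.D.is_iso_Comp)
qed

lemma nat_trans_whisker_right:
  assumes "nat_trans D E G G' \<beta>" "is_functor C D F"
  shows "nat_trans C E (comp_functor C G F) (comp_functor C G' F) (\<lambda>x\<in>Obj C. \<beta> (onO F x))"
proof -
  interpret b: natural_transformation D E G G' \<beta> by standard fact
  interpret F: functor_between C D F by standard fact
  show ?thesis
    by (intro nat_transI is_functor_comp[OF assms(2)])
      (auto simp: b.F.is_functor b.G.is_functor b.naturality
        simp flip: F.Cod_onA F.Dom_onA simp del: F.Cod_onA F.Dom_onA)
qed

lemma nat_iso_whisker_right:
  assumes "nat_iso D E G G' \<beta>" "is_functor C D F"
  shows "nat_iso C E (comp_functor C G F) (comp_functor C G' F) (\<lambda>x\<in>Obj C. \<beta> (onO F x))"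
proof -
  interpret F: functor_between C D F by standard fact
  show ?thesis
    using assms by (auto simp: nat_iso_def intro: nat_trans_whisker_right)
qed

lemma nat_trans_whisker_left:
  assumes "nat_trans C D F F' \<alpha>" "is_functor D E G"
  shows "nat_trans C E (comp_functor C G F) (comp_functor C G F') (\<lambda>x\<in>Obj C. onA G (\<alpha> x))"
proof -
  interpret a: natural_transformation C D F F' \<alpha> by standard fact
  interpret G: functor_between D E G by standard fact
  note [simp del] = G.onA_Comp
  show ?thesis
    by (intro nat_transI is_functor_comp[OF _ assms(2)])
      (auto simp: a.F.is_functor a.G.is_functor G.onA_Comp[symmetric] a.naturality)
qed

lemma nat_iso_whisker_left:
  assumes "nat_iso C D F F' \<alpha>" "is_functor D E G"
  shows "nat_iso C E (comp_functor C G F) (comp_functor C G F') (\<lambda>x\<in>Obj C. onA G (\<alpha> x))"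
proof -
  interpret G: functor_between D E G by standard fact
  show ?thesis
    using assms by (auto simp: nat_iso_def intro: nat_trans_whisker_left)
qed

text \<open>The composite of two whiskerings, G \<alpha> followed by \<beta> F'. Of the two equal
  formulas for horizontal composition, this is the one used for all 2-cells.\<close>

lemma nat_trans_hcomp:
  assumes "nat_trans C D F F' \<alpha>" "nat_trans D E G G' \<beta>"
  shows "nat_trans C E (comp_functor C G F) (comp_functor C G' F')
    (\<lambda>x\<in>Obj C. \<beta> (onO F' x) \<cdot>\<^bsub>E\<^esub> onA G (\<alpha> x))"
proof -
  have "is_functor C D F'" "is_functor D E G"
    using assms by (simp_all add: nat_trans_def)
  from nat_trans_vcomp[OF nat_trans_whisker_left[OF assms(1) this(2)]
      nat_trans_whisker_right[OF assms(2) this(1)]]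
  show ?thesis
    by (simp cong: restrict_cong)
qed


section \<open>Fully faithful and essentially surjective functors\<close>

text \<open>A quasi-inverse is built by choice: each z gets an object g z with an isomorphism e z
  from its image to z, and an arrow f goes to the preimage of its conjugate by e. The counit is e
  and the unit is the preimage of the inverse of e; all equations are tested after the faithful
  functor F.\<close>

lemma cat_equivalenceI:
  assumes F: "is_functor C D F"
    and ff: "\<And>x y. \<lbrakk>x \<in> Obj C; y \<in> Obj C\<rbrakk> \<Longrightarrow>
      bij_betw (onA F) (hom C x y) (hom D (onO F x) (onO F y))"
    and eso: "\<And>z. z \<in> Obj D \<Longrightarrow> \<exists>x\<in>Obj C. isomorphic D (onO F x) z"
  shows "cat_equivalence C D F"
proof -
  interpret F: functor_between C D F by standard fact
  have "\<exists>x e. x \<in> Obj C \<and> e \<in> hom D (onO F x) z \<and> is_iso D e" if "z \<in> Obj D" for z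
    using eso[OF that] unfolding isomorphic_def by blast
  then obtain g e where g: "z \<in> Obj D \<Longrightarrow> g z \<in> Obj C"
    and e: "z \<in> Obj D \<Longrightarrow> e z \<in> hom D (onO F (g z)) z" and iso: "z \<in> Obj D \<Longrightarrow> is_iso D (e z)" for z
    by metis
  \<comment> \<open>Preimages are taken inside a fixed hom-set, where \<open>onA F\<close> is
    injective; F may identify objects, so it need not be injective across hom-sets.\<close>
  define pre where "pre x y f = inv_into (hom C x y) (onA F) f" for x y f
  have pre: "pre x y f \<in> hom C x y" "onA F (pre x y f) = f"
    if "x \<in> Obj C" "y \<in> Obj C" "f \<in> hom D (onO F x) (onO F y)" for x y f
  proof -
    have "f \<in> onA F ` hom C x y"
      using ff that by (auto simp: bij_betw_def)
    then show "pre x y f \<in> hom C x y" "onA F (pre x y f) = f"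
      unfolding pre_def by (auto intro: inv_into_into f_inv_into_f)
  qed
  have faithful: "f = f'" if "f \<in> Arr C" "f' \<in> Arr C" "Dom C f' = Dom C f" "Cod C f' = Cod C f"
    "onA F f = onA F f'" for f f'
  proof -
    have "inj_on (onA F) (hom C (Dom C f) (Cod C f))"
      using ff that by (auto simp: bij_betw_def)
    then show ?thesis
      using that by (auto simp: hom_def inj_on_def)
  qed
  have e' [simp]: "e z \<in> Arr D" "Dom D (e z) = onO F (g z)" "Cod D (e z) = z" "is_iso D (e z)"
    if "z \<in> Obj D" for z
    using e iso that by (auto simp: hom_def)
  note [simp] = g
  \<comment> \<open>The conjugate of f by e. It runs between objects in the image of F and hence has
    a preimage.\<close>
  define t where "t f = inverse_arr D (e (Cod D f)) \<cdot>\<^bsub>D\<^esub> (f \<cdot>\<^bsub>D\<^esub> e (Dom D f))" for f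
  have t [simp]: "t f \<in> Arr D" "Dom D (t f) = onO F (g (Dom D f))" "Cod D (t f) = onO F (g (Cod D f))"
    if "f \<in> Arr D" for f
    using that by (simp_all add: t_def)
  have et: "e (Cod D f) \<cdot>\<^bsub>D\<^esub> t f = f \<cdot>\<^bsub>D\<^esub> e (Dom D f)" if "f \<in> Arr D" for f
    using that by (simp add: t_def F.D.assoc[symmetric])
  have t_Comp: "t (k \<cdot>\<^bsub>D\<^esub> f) = t k \<cdot>\<^bsub>D\<^esub> t f" if "f \<in> Arr D" "k \<in> Arr D" "Dom D k = Cod D f" for f k
  proof -
    have "t k \<cdot>\<^bsub>D\<^esub> t f = inverse_arr D (e (Cod D k)) \<cdot>\<^bsub>D\<^esub> (k \<cdot>\<^bsub>D\<^esub> (e (Cod D f) \<cdot>\<^bsub>D\<^esub> t f))"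
      using that by (simp add: t_def[of k] F.D.assoc)
    also have "\<dots> = t (k \<cdot>\<^bsub>D\<^esub> f)"
      using that by (simp add: et) (simp add: t_def F.D.assoc)
    finally show ?thesis ..
  qed
  define G where "G = \<lparr>onO = (\<lambda>z\<in>Obj D. g z), onA = (\<lambda>f\<in>Arr D. pre (g (Dom D f)) (g (Cod D f)) (t f))\<rparr>"
  have GO [simp]: "onO G z = g z" if "z \<in> Obj D" for z
    using that by (simp add: G_def)
  have GA [simp]: "onA G f \<in> Arr C" "Dom C (onA G f) = g (Dom D f)" "Cod C (onA G f) = g (Cod D f)"
    "onA F (onA G f) = t f" if "f \<in> Arr D" for f
    using that pre[of "g (Dom D f)" "g (Cod D f)" "t f"] by (auto simp: G_def hom_def)
  have G: "is_functor D C G"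
  proof (rule is_functorI)
    show "onA G (Ident D x) = Ident C (onO G x)" if "x \<in> Obj D" for x
      by (rule faithful) (use that in \<open>simp_all add: t_def\<close>)
    show "onA G (k \<cdot>\<^bsub>D\<^esub> f) = onA G k \<cdot>\<^bsub>C\<^esub> onA G f" if "f \<in> Arr D" "k \<in> Arr D" "Dom D k = Cod D f" for f k
      by (rule faithful) (use that in \<open>simp_all add: t_Comp\<close>)
    show "onO G \<in> extensional (Obj D)" "onA G \<in> extensional (Arr D)"
      by (simp_all add: G_def)
  qed (auto simp: F.C.category_axioms F.D.category_axioms)
  have eps: "nat_iso D D (comp_functor D F G) (id_functor D) (restrict e (Obj D))"
    unfolding nat_iso_def
    by (auto intro!: nat_transI is_functor_comp[OF G F] is_functor_id F.D.category_axioms simp: et)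
  define h where "h x = pre x (g (onO F x)) (inverse_arr D (e (onO F x)))" for x
  have h [simp]: "h x \<in> Arr C" "Dom C (h x) = x" "Cod C (h x) = g (onO F x)"
    "onA F (h x) = inverse_arr D (e (onO F x))" if "x \<in> Obj C" for x
    using that pre[of x "g (onO F x)" "inverse_arr D (e (onO F x))"] by (auto simp: h_def hom_def)
  have h_iso: "is_iso C (h x)" if "x \<in> Obj C" for x
  proof -
    \<comment> \<open>The preimage of e itself. It inverts \<open>h x\<close>, because both
      composites are sent to identities by the faithful F.\<close>
    define k where "k = pre (g (onO F x)) x (e (onO F x))"
    have k [simp]: "k \<in> Arr C" "Dom C k = g (onO F x)" "Cod C k = x" "onA F k = e (onO F x)"
      using that pre[of "g (onO F x)" x "e (onO F x)"] by (auto simp: k_def hom_def)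
    show ?thesis
      by (rule is_isoI[where g = k]) (use that in \<open>auto intro!: faithful\<close>)
  qed
  have eta: "nat_iso C C (id_functor C) (comp_functor C G F) (restrict h (Obj C))"
    unfolding nat_iso_def
  proof (intro conjI nat_transI is_functor_comp[OF F G] is_functor_id F.C.category_axioms)
    fix f assume f: "f \<in> Arr C"
    have "h (Cod C f) \<cdot>\<^bsub>C\<^esub> f = onA G (onA F f) \<cdot>\<^bsub>C\<^esub> h (Dom C f)"
      by (rule faithful) (use f in \<open>simp_all add: t_def F.D.assoc\<close>)
    then show "restrict h (Obj C) (Cod C f) \<cdot>\<^bsub>C\<^esub> onA (id_functor C) f =
         onA (comp_functor C G F) f \<cdot>\<^bsub>C\<^esub> restrict h (Obj C) (Dom C f)"
      using f by simp
  qed (auto simp: h_iso)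
  show ?thesis
    unfolding cat_equivalence_def using F G eta eps by blast
qed


section \<open>Transport of structure along fully faithful maps\<close>

text \<open>The source is raw data: its identities and composites are those dictated by the
  bijections \<open>to\<close> and \<open>fr\<close>, so each category law holds because it holds in
  D. The inverse \<open>fr\<close> takes both ends as arguments, as \<open>fo\<close> may identify
  objects. CwA's obtain their hom-categories and their 1-category from here, without a separate
  check of the laws.\<close>

lemma transport_category:
  assumes "category D"
    and fo: "\<And>x. x \<in> Ob \<Longrightarrow> fo x \<in> Obj D"
    and dc: "\<And>f. f \<in> Ar \<Longrightarrow> d f \<in> Ob" "\<And>f. f \<in> Ar \<Longrightarrow> c f \<in> Ob"
    and to: "\<And>f. f \<in> Ar \<Longrightarrow> to f \<in> hom D (fo (d f)) (fo (c f))"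
    and fr_hom: "\<And>x y u. \<lbrakk>x \<in> Ob; y \<in> Ob; u \<in> hom D (fo x) (fo y)\<rbrakk> \<Longrightarrow>
      fr x y u \<in> Ar \<and> d (fr x y u) = x \<and> c (fr x y u) = y \<and> to (fr x y u) = u"
    and fr_to: "\<And>f. f \<in> Ar \<Longrightarrow> fr (d f) (c f) (to f) = f"
    and i: "\<And>x. x \<in> Ob \<Longrightarrow> i x = fr x x (Ident D (fo x))"
    and m: "\<And>f g. \<lbrakk>f \<in> Ar; g \<in> Ar; d g = c f\<rbrakk> \<Longrightarrow> m g f = fr (d f) (c g) (to g \<cdot>\<^bsub>D\<^esub> to f)"
  shows "category (mk_cat Ob Ar d c i m)"
    and "is_functor (mk_cat Ob Ar d c i m) D \<lparr>onO = restrict fo Ob, onA = restrict to Ar\<rparr>"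
    and "\<lbrakk>x \<in> Ob; y \<in> Ob\<rbrakk> \<Longrightarrow>
      bij_betw (restrict to Ar) (hom (mk_cat Ob Ar d c i m) x y) (hom D (fo x) (fo y))"
proof -
  interpret D: category D by fact
  have to' [simp]: "to f \<in> Arr D" "Dom D (to f) = fo (d f)" "Cod D (to f) = fo (c f)" if "f \<in> Ar" for f
    using to[OF that] by (auto simp: hom_def)
  have fr [simp]: "fr x y u \<in> Ar" "d (fr x y u) = x" "c (fr x y u) = y" "to (fr x y u) = u"
    if "x \<in> Ob" "y \<in> Ob" "u \<in> Arr D" "Dom D u = fo x" "Cod D u = fo y" for x y u
  proof -
    have "u \<in> hom D (fo x) (fo y)" using that by (simp add: hom_def)
    from fr_hom[OF that(1,2) this]
    show "fr x y u \<in> Ar" "d (fr x y u) = x" "c (fr x y u) = y" "to (fr x y u) = u" by blast+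
  qed
  note [simp] = fo dc i m fr_to
  show C: "category (mk_cat Ob Ar d c i m)"
  proof (rule category_mk_cat)
    show "m (i (c f)) f = f" "m f (i (d f)) = f" if "f \<in> Ar" for f
      using that by simp_all
    show "m (m h g) f = m h (m g f)" if "f \<in> Ar" "g \<in> Ar" "h \<in> Ar" "d g = c f" "d h = c g" for f g h
      using that by (simp add: D.assoc)
  qed simp_all
  show "is_functor (mk_cat Ob Ar d c i m) D \<lparr>onO = restrict fo Ob, onA = restrict to Ar\<rparr>"
  proof (rule is_functorI[OF C \<open>category D\<close>], goal_cases)
    case (6 f g)
    then show ?case by (simp del: fr_to)
  qed simp_all
  show "bij_betw (restrict to Ar) (hom (mk_cat Ob Ar d c i m) x y) (hom D (fo x) (fo y))"
    if "x \<in> Ob" "y \<in> Ob"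
  proof (rule bij_betw_byWitness[where f' = "fr x y"])
    show "fr x y ` hom D (fo x) (fo y) \<subseteq> hom (mk_cat Ob Ar d c i m) x y"
      using that by (auto simp: hom_def)
  qed (use that in \<open>auto simp: hom_def\<close>)
qed

text \<open>Here K is raw data as well. Every axiom of a 2-category is an equation between 1-cells
  or between 2-cells, so it may be tested after the injective maps given by H, where it is an axiom
  of L.\<close>

lemma is_two_functor_transport:
  fixes K :: "('o, 'm, 'c) cat2" and L :: "('p, 'n, 'd) cat2"
  assumes L: "two_category L"
    and \<phi>: "\<And>x. x \<in> Obj2 K \<Longrightarrow> \<phi> x \<in> Obj2 L"
    and H: "\<And>x y. \<lbrakk>x \<in> Obj2 K; y \<in> Obj2 K\<rbrakk> \<Longrightarrow>
      is_functor (Hom2 K x y) (Hom2 L (\<phi> x) (\<phi> y)) (H x y)"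
    and inj_O: "\<And>x y. \<lbrakk>x \<in> Obj2 K; y \<in> Obj2 K\<rbrakk> \<Longrightarrow> inj_on (onO (H x y)) (Obj (Hom2 K x y))"
    and inj_A: "\<And>x y. \<lbrakk>x \<in> Obj2 K; y \<in> Obj2 K\<rbrakk> \<Longrightarrow> inj_on (onA (H x y)) (Arr (Hom2 K x y))"
    and Id: "\<And>x. x \<in> Obj2 K \<Longrightarrow> Ident2 K x \<in> Obj (Hom2 K x x)"
      "\<And>x. x \<in> Obj2 K \<Longrightarrow> onO (H x x) (Ident2 K x) = Ident2 L (\<phi> x)"
    and ext: "\<And>x y z. \<lbrakk>x \<in> Obj2 K; y \<in> Obj2 K; z \<in> Obj2 K\<rbrakk> \<Longrightarrow>
        onO (Comp2 K x y z) \<in> extensional (Obj (Hom2 K y z) \<times> Obj (Hom2 K x y))"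
      "\<And>x y z. \<lbrakk>x \<in> Obj2 K; y \<in> Obj2 K; z \<in> Obj2 K\<rbrakk> \<Longrightarrow>
        onA (Comp2 K x y z) \<in> extensional (Arr (Hom2 K y z) \<times> Arr (Hom2 K x y))"
    and CO: "\<And>x y z g f. \<lbrakk>x \<in> Obj2 K; y \<in> Obj2 K; z \<in> Obj2 K;
        g \<in> Obj (Hom2 K y z); f \<in> Obj (Hom2 K x y)\<rbrakk> \<Longrightarrow>
        onO (Comp2 K x y z) (g, f) \<in> Obj (Hom2 K x z) \<and>
        onO (H x z) (onO (Comp2 K x y z) (g, f)) =
          onO (Comp2 L (\<phi> x) (\<phi> y) (\<phi> z)) (onO (H y z) g, onO (H x y) f)"
    and CA: "\<And>x y z b a. \<lbrakk>x \<in> Obj2 K; y \<in> Obj2 K; z \<in> Obj2 K;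
        b \<in> Arr (Hom2 K y z); a \<in> Arr (Hom2 K x y)\<rbrakk> \<Longrightarrow>
        onA (Comp2 K x y z) (b, a) \<in> Arr (Hom2 K x z) \<and>
        onA (H x z) (onA (Comp2 K x y z) (b, a)) =
          onA (Comp2 L (\<phi> x) (\<phi> y) (\<phi> z)) (onA (H y z) b, onA (H x y) a)"
  shows "is_two_functor K L \<lparr>onObj2 = \<phi>, onHom2 = H\<rparr>"
proof -
  interpret L: two_category L by fact
  note fb = H[folded functor_between_iff]
  note [simp] = \<phi> Id CO[THEN conjunct1] CA[THEN conjunct1] CO[THEN conjunct2] CA[THEN conjunct2]
    functor_between.onO_Obj[OF fb] functor_between.onA_Arr[OF fb]
    functor_between.Dom_onA[OF fb] functor_between.Cod_onA[OF fb]
    functor_between.onA_Ident[OF fb] functor_between.onA_Comp[OF fb]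
  have catK: "category (Hom2 K x y)" if "x \<in> Obj2 K" "y \<in> Obj2 K" for x y
    using H[OF that] by (simp add: is_functor_def)
  note [simp] = category.Dom_Obj[OF catK] category.Cod_Obj[OF catK] category.Ident_Arr[OF catK]
    category.Dom_Ident[OF catK] category.Cod_Ident[OF catK]
    category.Comp_Arr[OF catK] category.Dom_Comp[OF catK] category.Cod_Comp[OF catK]
  note fc = L.Comp2_functor[folded functor_between_iff]
  have eqO: "f = g" if "onO (H x y) f = onO (H x y) g" "x \<in> Obj2 K" "y \<in> Obj2 K"
    "f \<in> Obj (Hom2 K x y)" "g \<in> Obj (Hom2 K x y)" for x y f g
    using inj_onD[OF inj_O[OF that(2,3)] that(1,4,5)] .
  have eqA: "f = g" if "onA (H x y) f = onA (H x y) g" "x \<in> Obj2 K" "y \<in> Obj2 K"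
    "f \<in> Arr (Hom2 K x y)" "g \<in> Arr (Hom2 K x y)" for x y f g
    using inj_onD[OF inj_A[OF that(2,3)] that(1,4,5)] .
  \<comment> \<open>The ends of a horizontal composite are not part of the assumptions on it; they
    too follow from injectivity of H on 1-cells.\<close>
  have Dom_CA [simp]: "Dom (Hom2 K x z) (onA (Comp2 K x y z) (b, a)) =
      onO (Comp2 K x y z) (Dom (Hom2 K y z) b, Dom (Hom2 K x y) a)"
    and Cod_CA [simp]: "Cod (Hom2 K x z) (onA (Comp2 K x y z) (b, a)) =
      onO (Comp2 K x y z) (Cod (Hom2 K y z) b, Cod (Hom2 K x y) a)"
    if "x \<in> Obj2 K" "y \<in> Obj2 K" "z \<in> Obj2 K" "b \<in> Arr (Hom2 K y z)" "a \<in> Arr (Hom2 K x y)"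
    for x y z b a
  proof -
    have "onO (H x z) (Dom (Hom2 K x z) (onA (Comp2 K x y z) (b, a))) =
        Dom (Hom2 L (\<phi> x) (\<phi> z)) (onA (H x z) (onA (Comp2 K x y z) (b, a)))"
      by (rule functor_between.Dom_onA[OF fb, symmetric]) (use that in simp_all)
    \<comment> \<open>The image must first become a composite in L. The rule for sources under H is
      withheld meanwhile, for it would rewrite the term back to the previous side.\<close>
    also have "\<dots> = onO (H x z) (onO (Comp2 K x y z) (Dom (Hom2 K y z) b, Dom (Hom2 K x y) a))"
      using that
      by (simp add: functor_between.Dom_onA[OF fc] del: functor_between.Dom_onA[OF fb])
        simp
    finally show "Dom (Hom2 K x z) (onA (Comp2 K x y z) (b, a)) =
      onO (Comp2 K x y z) (Dom (Hom2 K y z) b, Dom (Hom2 K x y) a)"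
      by (rule eqO) (use that in simp_all)
    have "onO (H x z) (Cod (Hom2 K x z) (onA (Comp2 K x y z) (b, a))) =
        Cod (Hom2 L (\<phi> x) (\<phi> z)) (onA (H x z) (onA (Comp2 K x y z) (b, a)))"
      by (rule functor_between.Cod_onA[OF fb, symmetric]) (use that in simp_all)
    also have "\<dots> = onO (H x z) (onO (Comp2 K x y z) (Cod (Hom2 K y z) b, Cod (Hom2 K x y) a))"
      using that
      by (simp add: functor_between.Cod_onA[OF fc] del: functor_between.Cod_onA[OF fb])
        simp
    finally show "Cod (Hom2 K x z) (onA (Comp2 K x y z) (b, a)) =
      onO (Comp2 K x y z) (Cod (Hom2 K y z) b, Cod (Hom2 K x y) a)"
      by (rule eqO) (use that in simp_all)
  qed
  have comp: "is_functor (prod_cat (Hom2 K y z) (Hom2 K x y)) (Hom2 K x z) (Comp2 K x y z)"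
    if xyz: "x \<in> Obj2 K" "y \<in> Obj2 K" "z \<in> Obj2 K" for x y z
  proof (rule is_functorI)
    note fc' = fc[OF \<phi> \<phi> \<phi>, OF xyz]
    show "onA (Comp2 K x y z) (Ident (prod_cat (Hom2 K y z) (Hom2 K x y)) p) =
      Ident (Hom2 K x z) (onO (Comp2 K x y z) p)"
      if p: "p \<in> Obj (prod_cat (Hom2 K y z) (Hom2 K x y))" for p
    proof -
      obtain g f where p': "p = (g, f)" "g \<in> Obj (Hom2 K y z)" "f \<in> Obj (Hom2 K x y)"
        using p by auto
      show ?thesis
        unfolding p'
        by (rule eqA[of x z]) (use p' xyz functor_between.onA_Ident[OF fc',
            of "(onO (H y z) g, onO (H x y) f)"] in simp_all)
    qed
    show "onA (Comp2 K x y z) (Comp (prod_cat (Hom2 K y z) (Hom2 K x y)) q p) =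
      Comp (Hom2 K x z) (onA (Comp2 K x y z) q) (onA (Comp2 K x y z) p)"
      if "p \<in> Arr (prod_cat (Hom2 K y z) (Hom2 K x y))" "q \<in> Arr (prod_cat (Hom2 K y z) (Hom2 K x y))"
        "Dom (prod_cat (Hom2 K y z) (Hom2 K x y)) q = Cod (prod_cat (Hom2 K y z) (Hom2 K x y)) p" for p q
    proof -
      obtain b a b' a' where p': "p = (b, a)" "q = (b', a')"
        by (metis surj_pair)
      with that have *: "b \<in> Arr (Hom2 K y z)" "a \<in> Arr (Hom2 K x y)"
        "b' \<in> Arr (Hom2 K y z)" "a' \<in> Arr (Hom2 K x y)"
        "Dom (Hom2 K y z) b' = Cod (Hom2 K y z) b" "Dom (Hom2 K x y) a' = Cod (Hom2 K x y) a"
        by simp_all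
      show ?thesis
        unfolding p'
        by (rule eqA[of x z]) (use * xyz functor_between.onA_Comp[OF fc',
            of "(onA (H y z) b, onA (H x y) a)" "(onA (H y z) b', onA (H x y) a')"] in simp_all)
    qed
  qed (use xyz in \<open>auto simp: catK category_prod_cat ext\<close>)
  have K: "two_category K"
  proof (rule two_category.intro, goal_cases)
    case 1 then show ?case using catK by simp
  next
    case 2 then show ?case by simp
  next
    case 3 then show ?case using comp by simp
  next
    case (4 x y f) then show ?case by (intro eqO[of x y]) (simp_all add: L.unit_left_1)
  next
    case (5 x y f) then show ?case by (intro eqO[of x y]) (simp_all add: L.unit_right_1)
  next
    case (6 w x y z) then show ?case by (intro eqO[of w z]) (simp_all add: L.assoc_1)
  next
    case (7 x y f) then show ?case by (intro eqA[of x y]) (simp_all add: L.unit_left_2)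
  next
    case (8 x y f) then show ?case by (intro eqA[of x y]) (simp_all add: L.unit_right_2)
  next
    case (9 w x y z) then show ?case by (intro eqA[of w z]) (simp_all add: L.assoc_2)
  qed
  show "is_two_functor K L \<lparr>onObj2 = \<phi>, onHom2 = H\<rparr>"
    by (simp add: is_two_functor_def K L H)
qed


section \<open>The arrow category\<close>

lemma square_cases: obtains f h k g where "s = (f, (h, k), g)"
  by (metis surj_pair)

lemma arrow_cat_Obj [simp]: "Obj (arrow_cat C) = Arr C"
  by (simp add: arrow_cat_def)

lemma square_sides [simp]: "top_side (f, (h, k), g) = h" "bot_side (f, (h, k), g) = k"
  by (simp_all add: top_side_def bot_side_def)

lemma arrow_cat_Arr:
  "(f, (h, k), g) \<in> Arr (arrow_cat C) \<longleftrightarrow> f \<in> Arr C \<and> g \<in> Arr C \<and> h \<in> Arr C \<and> k \<in> Arr C \<and>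
     Dom C h = Dom C f \<and> Cod C h = Dom C g \<and> Dom C k = Cod C f \<and> Cod C k = Cod C g \<and>
     g \<cdot>\<^bsub>C\<^esub> h = k \<cdot>\<^bsub>C\<^esub> f"
  by (auto simp: arrow_cat_def hom_def)

lemma arrow_cat_Dom_Cod [simp]:
  assumes "s \<in> Arr (arrow_cat C)"
  shows "Dom (arrow_cat C) s = fst s" "Cod (arrow_cat C) s = snd (snd s)"
  using assms by (auto simp: arrow_cat_def split_beta)

lemma arrow_cat_ArrD [simp]:
  assumes "s \<in> Arr (arrow_cat C)"
  shows "fst s \<in> Arr C" "snd (snd s) \<in> Arr C" "top_side s \<in> Arr C" "bot_side s \<in> Arr C"
    "Dom C (top_side s) = Dom C (fst s)" "Cod C (top_side s) = Dom C (snd (snd s))"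
    "Dom C (bot_side s) = Cod C (fst s)" "Cod C (bot_side s) = Cod C (snd (snd s))"
  using assms by (cases s rule: square_cases; simp add: arrow_cat_Arr)+

lemma arrow_cat_commutes:
  "s \<in> Arr (arrow_cat C) \<Longrightarrow> snd (snd s) \<cdot>\<^bsub>C\<^esub> top_side s = bot_side s \<cdot>\<^bsub>C\<^esub> fst s"
  by (cases s rule: square_cases) (simp add: arrow_cat_Arr)

lemma square_eq_iff:
  "s = s' \<longleftrightarrow> fst s = fst s' \<and> top_side s = top_side s' \<and> bot_side s = bot_side s' \<and>
     snd (snd s) = snd (snd s')"
  by (cases s rule: square_cases; cases s' rule: square_cases) auto

lemma arrow_cat_Ident [simp]:
  "f \<in> Arr C \<Longrightarrow> Ident (arrow_cat C) f = (f, (Ident C (Dom C f), Ident C (Cod C f)), f)"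
  by (simp add: arrow_cat_def)

lemma arrow_cat_Comp [simp]:
  assumes "s \<in> Arr (arrow_cat C)" "s' \<in> Arr (arrow_cat C)" "fst s' = snd (snd s)"
  shows "s' \<cdot>\<^bsub>arrow_cat C\<^esub> s =
    (fst s, (top_side s' \<cdot>\<^bsub>C\<^esub> top_side s, bot_side s' \<cdot>\<^bsub>C\<^esub> bot_side s), snd (snd s'))"
  using assms by (cases s rule: square_cases; cases s' rule: square_cases) (simp add: arrow_cat_def)

lemma category_arrow_cat:
  assumes "category C"
  shows "category (arrow_cat C)"
proof -
  interpret category C by fact
  show ?thesis
    unfolding arrow_cat_def
  proof (rule category_mk_cat, goal_cases)
    case (6 s s')
    then show ?case
      by (auto simp: hom_def) (metis assoc)
  qed (auto simp: hom_def assoc)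
qed

context category
begin

interpretation arr: category "arrow_cat C"
  by (rule category_arrow_cat) (rule category_axioms)

text \<open>The inverse is taken side by side. That the inverted sides again form a commutative
  square is \<open>inverse_arr_square\<close>, applied with the sides exchanged.\<close>

lemma is_iso_square:
  assumes "s \<in> Arr (arrow_cat C)" "is_iso C (top_side s)" "is_iso C (bot_side s)"
  shows "is_iso (arrow_cat C) s"
    and "inverse_arr (arrow_cat C) s =
      (snd (snd s), (inverse_arr C (top_side s), inverse_arr C (bot_side s)), fst s)"
proof -
  let ?t = "(snd (snd s), (inverse_arr C (top_side s), inverse_arr C (bot_side s)), fst s)"
  have "fst s \<cdot> inverse_arr C (top_side s) = inverse_arr C (bot_side s) \<cdot> snd (snd s)"
    using inverse_arr_square[of "top_side s" "bot_side s" "fst s" "snd (snd s)"] assms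
      arrow_cat_commutes[OF assms(1)] by simp
  then have t: "?t \<in> Arr (arrow_cat C)"
    using assms by (simp add: arrow_cat_Arr)
  show "is_iso (arrow_cat C) s"
    by (rule is_isoI[where g = ?t]) (use assms t in \<open>auto simp: arrow_cat_Comp arrow_cat_Ident\<close>)
  show "inverse_arr (arrow_cat C) s = ?t"
    by (rule arr.inverse_arr_unique) (use assms t in \<open>auto simp: arrow_cat_Comp arrow_cat_Ident\<close>)
qed

lemma is_iso_squareD:
  assumes "is_iso (arrow_cat C) s"
  shows "is_iso C (top_side s)" "is_iso C (bot_side s)"
proof -
  define t where "t = inverse_arr (arrow_cat C) s"
  note s = is_iso_Arr[OF assms]
  have t: "t \<in> Arr (arrow_cat C)" "fst t = snd (snd s)" "snd (snd t) = fst s"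
    "t \<cdot>\<^bsub>arrow_cat C\<^esub> s = Ident (arrow_cat C) (fst s)"
    "s \<cdot>\<^bsub>arrow_cat C\<^esub> t = Ident (arrow_cat C) (snd (snd s))"
    using assms s unfolding t_def
    by (metis inverse_arr_Arr Dom_inverse_arr Cod_inverse_arr inverse_arr_Comp Comp_inverse_arr
        arrow_cat_Dom_Cod)+
  show "is_iso C (top_side s)"
    by (rule is_isoI[where g = "top_side t"])
      (use s t in \<open>auto simp: arrow_cat_Comp arrow_cat_Ident\<close>)
  show "is_iso C (bot_side s)"
    by (rule is_isoI[where g = "bot_side t"])
      (use s t in \<open>auto simp: arrow_cat_Comp arrow_cat_Ident\<close>)
qed

end

lemma arrow_functor_simps [simp]:
  "f \<in> Arr C \<Longrightarrow> onO (arrow_functor C F) f = onA F f"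
  "s \<in> Arr (arrow_cat C) \<Longrightarrow> onA (arrow_functor C F) s =
     (onA F (fst s), (onA F (top_side s), onA F (bot_side s)), onA F (snd (snd s)))"
  by (auto simp: arrow_functor_def top_side_def bot_side_def split_beta)

lemma arrow_functor_extensional [simp]:
  "onO (arrow_functor C F) \<in> extensional (Arr C)"
  "onA (arrow_functor C F) \<in> extensional (Arr (arrow_cat C))"
  by (simp_all add: arrow_functor_def)

lemma is_functor_arrow_functor:
  assumes "is_functor C D F"
  shows "is_functor (arrow_cat C) (arrow_cat D) (arrow_functor C F)"
proof -
  interpret F: functor_between C D F by standard fact
  interpret arr: category "arrow_cat C"
    by (rule category_arrow_cat) (rule F.C.category_axioms)
  have im: "onA (arrow_functor C F) s \<in> Arr (arrow_cat D)" if "s \<in> Arr (arrow_cat C)" for s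
    using that arrow_cat_commutes[OF that] by (simp add: arrow_cat_Arr flip: F.onA_Comp)
  show ?thesis
  proof (rule is_functorI)
    show "onA (arrow_functor C F) (Ident (arrow_cat C) x) =
        Ident (arrow_cat D) (onO (arrow_functor C F) x)"
      if "x \<in> Obj (arrow_cat C)" for x
      using that arr.Ident_Arr[of x] by (simp add: arrow_cat_Ident)
    show "onA (arrow_functor C F) (t \<cdot>\<^bsub>arrow_cat C\<^esub> s) =
        onA (arrow_functor C F) t \<cdot>\<^bsub>arrow_cat D\<^esub> onA (arrow_functor C F) s"
      if "s \<in> Arr (arrow_cat C)" "t \<in> Arr (arrow_cat C)"
        "Dom (arrow_cat C) t = Cod (arrow_cat C) s" for s t
      using that im[of s] im[of t] arr.Comp_Arr[OF that]
      by (simp add: arrow_cat_Comp)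
  qed (use im in \<open>simp_all add: category_arrow_cat F.C.category_axioms F.D.category_axioms\<close>)
qed

lemma arrow_functor_comp:
  assumes "is_functor C D F"
  shows "arrow_functor C (comp_functor C G F) =
    comp_functor (arrow_cat C) (arrow_functor D G) (arrow_functor C F)"
proof -
  interpret F: functor_between "arrow_cat C" "arrow_cat D" "arrow_functor C F"
    by standard (rule is_functor_arrow_functor[OF assms])
  interpret F': functor_between C D F by standard fact
  show ?thesis
  proof (rule functor_eqI[where C = "arrow_cat C"])
    show "onA (arrow_functor C (comp_functor C G F)) s =
      onA (comp_functor (arrow_cat C) (arrow_functor D G) (arrow_functor C F)) s"
      if "s \<in> Arr (arrow_cat C)" for s
      using that F.onA_Arr[OF that] by simp
  qed (use comp_functor_extensional(1)[of "arrow_cat C"] in simp_all)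
qed

lemma arrow_functor_id:
  "arrow_functor C (id_functor C) = id_functor (arrow_cat C)"
  by (rule functor_eqI[where C = "arrow_cat C"])
    (use id_functor_extensional(1)[of "arrow_cat C"] in \<open>auto simp: square_eq_iff\<close>)


section \<open>The 2-category of comprehension categories\<close>

locale compcat =
  fixes X :: "('o, 'a, 'p, 'b) compcat"
  assumes is_compcat: "is_compcat X"
begin

sublocale Proj: functor_between "Tot X" "Base X" "Proj X"
  using is_compcat by unfold_locales (simp add: is_compcat_def is_fibration_def)

sublocale Compr: functor_between "Tot X" "arrow_cat (Base X)" "Compr X"
  using is_compcat by unfold_locales (simp add: is_compcat_def)

lemma Compr_Arr [simp]: "A \<in> Obj (Tot X) \<Longrightarrow> onO (Compr X) A \<in> Arr (Base X)"
  using Compr.onO_Obj by simp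

lemma Compr_square [simp]:
  assumes "u \<in> Arr (Tot X)"
  shows "fst (onA (Compr X) u) = onO (Compr X) (Dom (Tot X) u)"
    and "snd (snd (onA (Compr X) u)) = onO (Compr X) (Cod (Tot X) u)"
  using assms Compr.Dom_onA Compr.Cod_onA Compr.onA_Arr by (metis arrow_cat_Dom_Cod)+

text \<open>The strict equation between the codomain functor after comprehension and the projection,
  read on objects and on arrows. From now on only domains and top sides of comprehension squares
  carry new information.\<close>

lemma Cod_Compr [simp]: "A \<in> Obj (Tot X) \<Longrightarrow> Cod (Base X) (onO (Compr X) A) = onO (Proj X) A"
  and bot_side_Compr [simp]: "u \<in> Arr (Tot X) \<Longrightarrow> bot_side (onA (Compr X) u) = onA (Proj X) u"
proof -
  have eq: "comp_functor (Tot X) (cod_functor (Base X)) (Compr X) = Proj X"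
    using is_compcat by (simp add: is_compcat_def)
  show "A \<in> Obj (Tot X) \<Longrightarrow> Cod (Base X) (onO (Compr X) A) = onO (Proj X) A"
    using arg_cong[OF eq, of "\<lambda>F. onO F A"] by (simp add: cod_functor_def)
  show "u \<in> Arr (Tot X) \<Longrightarrow> bot_side (onA (Compr X) u) = onA (Proj X) u"
    using arg_cong[OF eq, of "\<lambda>F. onA F u"] by (simp add: cod_functor_def)
qed

end

section \<open>Pseudo maps of comprehension categories, their identities and composites\<close>

locale cc_morphism = X: compcat X + Y: compcat Y
  for X :: "('o, 'a, 'p, 'b) compcat" and Y :: "('o, 'a, 'p, 'b) compcat" +
  fixes P :: "('o, 'a, 'p, 'b) cc_map"
  assumes pseudo_map: "cc_pseudo_map X Y P"
begin

sublocale F: functor_between "Base X" "Base Y" "ccF P"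
  using pseudo_map by unfold_locales (simp add: cc_pseudo_map_def)

sublocale T: functor_between "Tot X" "Tot Y" "ccT P"
  using pseudo_map by unfold_locales (simp add: cc_pseudo_map_def)

sublocale Iso: natural_transformation "Tot X" "arrow_cat (Base Y)"
  "comp_functor (Tot X) (Compr Y) (ccT P)"
  "comp_functor (Tot X) (arrow_functor (Base X) (ccF P)) (Compr X)" "ccIso P"
  using pseudo_map by unfold_locales (simp add: cc_pseudo_map_def nat_iso_def)

lemma Proj_T [simp]:
  "A \<in> Obj (Tot X) \<Longrightarrow> onO (Proj Y) (onO (ccT P) A) = onO (ccF P) (onO (Proj X) A)"
  "u \<in> Arr (Tot X) \<Longrightarrow> onA (Proj Y) (onA (ccT P) u) = onA (ccF P) (onA (Proj X) u)"
  using pseudo_map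
    comp_functor_eqD[of "Tot X" "Proj Y" "ccT P" "ccF P" "Proj X"]
  by (simp_all add: cc_pseudo_map_def)

lemma cartesian_T:
  "is_cartesian (Tot X) (Base X) (Proj X) u \<Longrightarrow>
   is_cartesian (Tot Y) (Base Y) (Proj Y) (onA (ccT P) u)"
  using pseudo_map by (simp add: cc_pseudo_map_def)

lemma Iso_square [simp]:
  assumes "A \<in> Obj (Tot X)"
  shows "ccIso P A \<in> Arr (arrow_cat (Base Y))"
    and "fst (ccIso P A) = onO (Compr Y) (onO (ccT P) A)"
    and "snd (snd (ccIso P A)) = onA (ccF P) (onO (Compr X) A)"
    and "bot_side (ccIso P A) = Ident (Base Y) (onO (ccF P) (onO (Proj X) A))"
    and "is_iso (arrow_cat (Base Y)) (ccIso P A)"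
    and "is_iso (Base Y) (top_side (ccIso P A))"
proof -
  show *: "ccIso P A \<in> Arr (arrow_cat (Base Y))"
    using assms by (rule Iso.component_Arr)
  show "fst (ccIso P A) = onO (Compr Y) (onO (ccT P) A)"
    using assms Iso.Dom_component[OF assms] * by simp
  show "snd (snd (ccIso P A)) = onA (ccF P) (onO (Compr X) A)"
    using assms Iso.Cod_component[OF assms] * by simp
  show "bot_side (ccIso P A) = Ident (Base Y) (onO (ccF P) (onO (Proj X) A))"
    using assms pseudo_map by (simp add: cc_pseudo_map_def)
  show "is_iso (arrow_cat (Base Y)) (ccIso P A)"
    using assms pseudo_map by (simp add: cc_pseudo_map_def nat_iso_def)
  then show "is_iso (Base Y) (top_side (ccIso P A))"
    by (rule Y.Proj.D.is_iso_squareD)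
qed

text \<open>The naturality equation of squares read on top sides; on the bottom the comparison is an
  identity.\<close>

lemma Iso_naturality:
  assumes "u \<in> Arr (Tot X)"
  shows "top_side (ccIso P (Cod (Tot X) u)) \<cdot>\<^bsub>Base Y\<^esub> top_side (onA (Compr Y) (onA (ccT P) u)) =
    onA (ccF P) (top_side (onA (Compr X) u)) \<cdot>\<^bsub>Base Y\<^esub> top_side (ccIso P (Dom (Tot X) u))"
proof -
  have "onA (comp_functor (Tot X) (arrow_functor (Base X) (ccF P)) (Compr X)) u \<in> Arr (arrow_cat (Base Y))"
    using assms by (rule Iso.G.onA_Arr)
  with arg_cong[OF Iso.naturality[OF assms], of top_side] assms
  show ?thesis by (simp add: arrow_cat_Comp)
qed

end

lemma cc_morphismI:
  assumes "is_compcat X" "is_compcat Y" "cc_pseudo_map X Y P"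
  shows "cc_morphism X Y P"
  using assms by (simp add: cc_morphism_def cc_morphism_axioms_def compcat_def)

lemma cc_pseudo_map_cc_id:
  assumes "is_compcat X"
  shows "cc_pseudo_map X X (cc_id X)"
proof -
  interpret compcat X by standard fact
  note [simp] = comp_functor_id_left[OF Proj.is_functor] comp_functor_id_right[OF Proj.is_functor]
    comp_functor_id_left[OF Compr.is_functor] comp_functor_id_right[OF Compr.is_functor]
    arrow_functor_id
  show ?thesis
    using nat_iso_id[OF Compr.is_functor]
    by (auto simp: cc_pseudo_map_def cc_id_def is_functor_id Proj.C.category_axioms
        Proj.D.category_axioms is_cartesian_def arrow_cat_Ident)
qed

text \<open>The comparison of the composite is pasted from two whiskered ones: the comparison of Q
  taken at the image under P, followed by the comparison of P under the arrow functor of Q.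
  Associativity of functor composition and functoriality of the arrow category bring source and
  target into the required form.\<close>

lemma cc_pseudo_map_cc_comp:
  assumes "is_compcat X" "is_compcat Y" "is_compcat Z"
    and "cc_pseudo_map X Y P" "cc_pseudo_map Y Z Q"
  shows "cc_pseudo_map X Z (cc_comp X Y Z Q P)"
proof -
  interpret P: cc_morphism X Y P using assms by (simp add: cc_morphismI)
  interpret Q: cc_morphism Y Z Q using assms by (simp add: cc_morphismI)
  interpret FQ: functor_between "arrow_cat (Base Y)" "arrow_cat (Base Z)" "arrow_functor (Base Y) (ccF Q)"
    by standard (rule is_functor_arrow_functor[OF Q.F.is_functor])
  let ?FP = "arrow_functor (Base X) (ccF P)" and ?FQ = "arrow_functor (Base Y) (ccF Q)"
  have "nat_iso (Tot X) (arrow_cat (Base Z))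
      (comp_functor (Tot X) (comp_functor (Tot Y) (Compr Z) (ccT Q)) (ccT P))
      (comp_functor (Tot X) (comp_functor (Tot Y) ?FQ (Compr Y)) (ccT P))
      (\<lambda>A\<in>Obj (Tot X). ccIso Q (onO (ccT P) A))"
    by (rule nat_iso_whisker_right[OF _ P.T.is_functor]) (use assms in \<open>simp add: cc_pseudo_map_def\<close>)
  moreover have "nat_iso (Tot X) (arrow_cat (Base Z))
      (comp_functor (Tot X) ?FQ (comp_functor (Tot X) (Compr Y) (ccT P)))
      (comp_functor (Tot X) ?FQ (comp_functor (Tot X) ?FP (Compr X)))
      (\<lambda>A\<in>Obj (Tot X). onA ?FQ (ccIso P A))"
    by (rule nat_iso_whisker_left[OF _ FQ.is_functor]) (use assms in \<open>simp add: cc_pseudo_map_def\<close>)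
  ultimately have iso: "nat_iso (Tot X) (arrow_cat (Base Z))
      (comp_functor (Tot X) (Compr Z) (comp_functor (Tot X) (ccT Q) (ccT P)))
      (comp_functor (Tot X) (arrow_functor (Base X) (comp_functor (Base X) (ccF Q) (ccF P))) (Compr X))
      (\<lambda>A\<in>Obj (Tot X). onA ?FQ (ccIso P A) \<cdot>\<^bsub>arrow_cat (Base Z)\<^esub> ccIso Q (onO (ccT P) A))"
    by (auto simp: comp_functor_assoc[OF P.T.is_functor] arrow_functor_comp[OF P.F.is_functor]
        comp_functor_assoc[OF P.X.Compr.is_functor] dest: nat_iso_vcomp cong: restrict_cong)
  show ?thesis
    unfolding cc_pseudo_map_def
  proof (intro conjI allI impI ballI)
    show "is_functor (Base X) (Base Z) (ccF (cc_comp X Y Z Q P))"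
      by (simp add: cc_comp_def is_functor_comp[OF P.F.is_functor Q.F.is_functor])
    show "is_functor (Tot X) (Tot Z) (ccT (cc_comp X Y Z Q P))"
      by (simp add: cc_comp_def is_functor_comp[OF P.T.is_functor Q.T.is_functor])
    show "comp_functor (Tot X) (Proj Z) (ccT (cc_comp X Y Z Q P)) =
      comp_functor (Tot X) (ccF (cc_comp X Y Z Q P)) (Proj X)"
      by (rule comp_functor_eqI) (simp_all add: cc_comp_def)
    show "is_cartesian (Tot Z) (Base Z) (Proj Z) (onA (ccT (cc_comp X Y Z Q P)) u)"
      if "is_cartesian (Tot X) (Base X) (Proj X) u" for u
    proof -
      have "u \<in> Arr (Tot X)" using that by (simp add: is_cartesian_def)
      then show ?thesis using that by (simp add: cc_comp_def P.cartesian_T Q.cartesian_T)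
    qed
    show "nat_iso (Tot X) (arrow_cat (Base Z)) (comp_functor (Tot X) (Compr Z) (ccT (cc_comp X Y Z Q P)))
     (comp_functor (Tot X) (arrow_functor (Base X) (ccF (cc_comp X Y Z Q P))) (Compr X))
     (ccIso (cc_comp X Y Z Q P))"
      using iso by (simp add: cc_comp_def)
    show "bot_side (ccIso (cc_comp X Y Z Q P) A) =
        Ident (Base Z) (onO (ccF (cc_comp X Y Z Q P)) (onO (Proj X) A))"
      if "A \<in> Obj (Tot X)" for A
      using that FQ.onA_Arr[of "ccIso P A"] by (simp add: cc_comp_def arrow_cat_Comp)
  qed
qed

text \<open>In the explicit form of the comparison the bottom side, a composite of two identities,
  has collapsed to one.\<close>

lemma cc_comp_simps:
  assumes "is_compcat X" "is_compcat Y" "is_compcat Z"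
    and "cc_pseudo_map X Y P" "cc_pseudo_map Y Z Q"
  shows "ccF (cc_comp X Y Z Q P) = comp_functor (Base X) (ccF Q) (ccF P)"
    and "ccT (cc_comp X Y Z Q P) = comp_functor (Tot X) (ccT Q) (ccT P)"
    and "A \<in> Obj (Tot X) \<Longrightarrow> ccIso (cc_comp X Y Z Q P) A =
      (onO (Compr Z) (onO (ccT Q) (onO (ccT P) A)),
       (onA (ccF Q) (top_side (ccIso P A)) \<cdot>\<^bsub>Base Z\<^esub> top_side (ccIso Q (onO (ccT P) A)),
        Ident (Base Z) (onO (ccF Q) (onO (ccF P) (onO (Proj X) A)))),
       onA (ccF Q) (onA (ccF P) (onO (Compr X) A)))"
proof -
  interpret P: cc_morphism X Y P using assms by (simp add: cc_morphismI)
  interpret Q: cc_morphism Y Z Q using assms by (simp add: cc_morphismI)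
  interpret FQ: functor_between "arrow_cat (Base Y)" "arrow_cat (Base Z)" "arrow_functor (Base Y) (ccF Q)"
    by standard (rule is_functor_arrow_functor[OF Q.F.is_functor])
  show "ccF (cc_comp X Y Z Q P) = comp_functor (Base X) (ccF Q) (ccF P)"
    "ccT (cc_comp X Y Z Q P) = comp_functor (Tot X) (ccT Q) (ccT P)"
    by (simp_all add: cc_comp_def)
  show "ccIso (cc_comp X Y Z Q P) A =
      (onO (Compr Z) (onO (ccT Q) (onO (ccT P) A)),
       (onA (ccF Q) (top_side (ccIso P A)) \<cdot>\<^bsub>Base Z\<^esub> top_side (ccIso Q (onO (ccT P) A)),
        Ident (Base Z) (onO (ccF Q) (onO (ccF P) (onO (Proj X) A)))),
       onA (ccF Q) (onA (ccF P) (onO (Compr X) A)))"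
    if "A \<in> Obj (Tot X)"
    using that FQ.onA_Arr[of "ccIso P A"] by (simp add: cc_comp_def arrow_cat_Comp)
qed

lemma cc_comp_cc_id_left:
  assumes "is_compcat X" "is_compcat Y" "cc_pseudo_map X Y P"
  shows "cc_comp X Y Y (cc_id Y) P = P"
proof -
  interpret P: cc_morphism X Y P using assms by (simp add: cc_morphismI)
  note id = cc_pseudo_map_cc_id[OF assms(2)]
  show ?thesis
  proof (rule cc_map.equality)
    show "ccIso (cc_comp X Y Y (cc_id Y) P) = ccIso P"
    proof (rule extensionalityI[where A = "Obj (Tot X)"])
      show "ccIso (cc_comp X Y Y (cc_id Y) P) A = ccIso P A" if "A \<in> Obj (Tot X)" for A
        using that cc_comp_simps(3)[OF assms(1,2,2,3) id that]
        by (simp add: square_eq_iff arrow_cat_Ident cc_id_def)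
    qed (simp_all add: cc_comp_def P.Iso.component_extensional)
  qed (simp_all add: cc_comp_def cc_id_def comp_functor_id_left[OF P.F.is_functor]
      comp_functor_id_left[OF P.T.is_functor])
qed

lemma cc_comp_cc_id_right:
  assumes "is_compcat X" "is_compcat Y" "cc_pseudo_map X Y P"
  shows "cc_comp X X Y P (cc_id X) = P"
proof -
  interpret P: cc_morphism X Y P using assms by (simp add: cc_morphismI)
  note id = cc_pseudo_map_cc_id[OF assms(1)]
  show ?thesis
  proof (rule cc_map.equality)
    show "ccIso (cc_comp X X Y P (cc_id X)) = ccIso P"
    proof (rule extensionalityI[where A = "Obj (Tot X)"])
      show "ccIso (cc_comp X X Y P (cc_id X)) A = ccIso P A" if "A \<in> Obj (Tot X)" for A
        using that cc_comp_simps(3)[OF assms(1,1,2) id assms(3) that]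
        by (simp add: square_eq_iff arrow_cat_Ident cc_id_def)
    qed (simp_all add: cc_comp_def P.Iso.component_extensional)
  qed (simp_all add: cc_comp_def cc_id_def comp_functor_id_right[OF P.F.is_functor]
      comp_functor_id_right[OF P.T.is_functor])
qed

lemma cc_comp_assoc:
  assumes "is_compcat W" "is_compcat X" "is_compcat Y" "is_compcat Z"
    and "cc_pseudo_map W X P" "cc_pseudo_map X Y Q" "cc_pseudo_map Y Z R"
  shows "cc_comp W X Z (cc_comp X Y Z R Q) P = cc_comp W Y Z R (cc_comp W X Y Q P)"
proof -
  interpret P: cc_morphism W X P using assms by (simp add: cc_morphismI)
  interpret Q: cc_morphism X Y Q using assms by (simp add: cc_morphismI)
  interpret R: cc_morphism Y Z R using assms by (simp add: cc_morphismI)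
  note RQ = cc_pseudo_map_cc_comp[OF assms(2,3,4,6,7)] and QP = cc_pseudo_map_cc_comp[OF assms(1,2,3,5,6)]
  show ?thesis
  proof (rule cc_map.equality)
    show "ccIso (cc_comp W X Z (cc_comp X Y Z R Q) P) = ccIso (cc_comp W Y Z R (cc_comp W X Y Q P))"
    proof (rule extensionalityI[where A = "Obj (Tot W)"])
      fix A assume A: "A \<in> Obj (Tot W)"
      show "ccIso (cc_comp W X Z (cc_comp X Y Z R Q) P) A =
        ccIso (cc_comp W Y Z R (cc_comp W X Y Q P)) A"
        using A cc_comp_simps[OF assms(1,2,4,5) RQ] cc_comp_simps[OF assms(1,3,4) QP assms(7)]
          cc_comp_simps[OF assms(2,3,4,6,7)] cc_comp_simps[OF assms(1,2,3,5,6)]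
        by (simp add: R.Y.Proj.D.assoc)
    qed (simp_all add: cc_comp_def)
  qed (simp_all add: cc_comp_def comp_functor_assoc[OF P.F.is_functor] comp_functor_assoc[OF P.T.is_functor])
qed


subsection \<open>Strict maps\<close>

lemma cc_strict_mapD: "cc_strict_map X Y P \<Longrightarrow> cc_pseudo_map X Y P"
  by (simp add: cc_strict_map_def)

lemma cc_strict_map_cc_id:
  assumes "is_compcat X"
  shows "cc_strict_map X X (cc_id X)"
proof -
  interpret compcat X by standard fact
  show ?thesis
    unfolding cc_strict_map_def
    using cc_pseudo_map_cc_id[OF assms]
    by (auto simp: cc_id_def arrow_functor_id comp_functor_id_left[OF Compr.is_functor] comp_functor_id_right[OF Compr.is_functor]
        cong: restrict_cong)
qed

lemma cc_strict_map_cc_comp: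
  assumes "is_compcat X" "is_compcat Y" "is_compcat Z"
    and P: "cc_strict_map X Y P" and Q: "cc_strict_map Y Z Q"
  shows "cc_strict_map X Z (cc_comp X Y Z Q P)"
proof -
  have P': "cc_pseudo_map X Y P" and Q': "cc_pseudo_map Y Z Q"
    using P Q by (simp_all add: cc_strict_map_def)
  interpret P: cc_morphism X Y P using assms P' by (simp add: cc_morphismI)
  interpret Q: cc_morphism Y Z Q using assms Q' by (simp add: cc_morphismI)
  have *: "comp_functor (Tot X) (Compr Y) (ccT P) =
      comp_functor (Tot X) (arrow_functor (Base X) (ccF P)) (Compr X)"
    "comp_functor (Tot Y) (Compr Z) (ccT Q) =
      comp_functor (Tot Y) (arrow_functor (Base Y) (ccF Q)) (Compr Y)"
    using P Q by (simp_all add: cc_strict_map_def)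
  have eq: "comp_functor (Tot X) (Compr Z) (comp_functor (Tot X) (ccT Q) (ccT P)) =
    comp_functor (Tot X) (arrow_functor (Base X) (comp_functor (Base X) (ccF Q) (ccF P))) (Compr X)"
    by (metis * comp_functor_assoc[OF P.T.is_functor] comp_functor_assoc[OF P.X.Compr.is_functor]
        arrow_functor_comp[OF P.F.is_functor])
  have iso: "ccIso P A = Ident (arrow_cat (Base Y)) (onO (Compr Y) (onO (ccT P) A))"
    if "A \<in> Obj (Tot X)" for A
    using P that by (simp add: cc_strict_map_def)
  have iso': "ccIso Q B = Ident (arrow_cat (Base Z)) (onO (Compr Z) (onO (ccT Q) B))"
    if "B \<in> Obj (Tot Y)" for B
    using Q that by (simp add: cc_strict_map_def)
  have QC: "onA (ccF Q) (onO (Compr Y) B) = onO (Compr Z) (onO (ccT Q) B)" if "B \<in> Obj (Tot Y)" for B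
    using comp_functor_eqD(1)[OF *(2) that] that by simp
  have PC: "onA (ccF P) (onO (Compr X) A) = onO (Compr Y) (onO (ccT P) A)" if "A \<in> Obj (Tot X)" for A
    using comp_functor_eqD(1)[OF *(1) that] that by simp
  \<comment> \<open>Applying Q to the identity of an extended context gives the identity of its
    image; by strictness that image is the extended context of the image of B.\<close>
  have Dom_QC: "onO (ccF Q) (Dom (Base Y) (onO (Compr Y) B)) = Dom (Base Z) (onO (Compr Z) (onO (ccT Q) B))"
    if "B \<in> Obj (Tot Y)" for B
    using that by (simp flip: QC)
  show ?thesis
    unfolding cc_strict_map_def
  proof (intro conjI cc_pseudo_map_cc_comp[OF assms(1-3) P' Q'])
    show "ccIso (cc_comp X Y Z Q P) =
      (\<lambda>A\<in>Obj (Tot X). Ident (arrow_cat (Base Z)) (onO (Compr Z) (onO (ccT (cc_comp X Y Z Q P)) A)))"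
    proof (rule extensionalityI[where A = "Obj (Tot X)"])
      fix A assume "A \<in> Obj (Tot X)"
      then show "ccIso (cc_comp X Y Z Q P) A =
        (\<lambda>A\<in>Obj (Tot X). Ident (arrow_cat (Base Z)) (onO (Compr Z) (onO (ccT (cc_comp X Y Z Q P)) A))) A"
        using cc_comp_simps[OF assms(1-3) P' Q']
        by (simp add: arrow_cat_Ident iso iso' Dom_QC QC PC)
    qed (simp_all add: cc_comp_def)
  qed (simp add: cc_comp_def eq)
qed

theorem category_compcat_disc_str1:
  "category (compcat_disc_str1 :: (('o, 'a, 'p, 'b) compcat, _) cat)"
  unfolding compcat_disc_str1_def
proof (rule category_mk_cat, goal_cases)
  case (6 f g)
  then show ?case by (auto simp: is_discrete_compcat_def intro: cc_strict_map_cc_comp)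
qed (auto simp: is_discrete_compcat_def cc_strict_map_cc_id cc_comp_cc_id_left cc_comp_cc_id_right
    dest: cc_strict_mapD intro: cc_comp_assoc)


subsection \<open>Transformations\<close>

locale cc_transf = P: cc_morphism X Y P + Q: cc_morphism X Y Q
  for X :: "('o, 'a, 'p, 'b) compcat" and Y :: "('o, 'a, 'p, 'b) compcat" and P Q +
  fixes \<alpha> :: "'o \<Rightarrow> 'a" and \<alpha>' :: "'p \<Rightarrow> 'b"
  assumes transformation: "cc_transformation X Y P Q (\<alpha>, \<alpha>')"
begin

sublocale base: natural_transformation "Base X" "Base Y" "ccF P" "ccF Q" \<alpha>
  using transformation by unfold_locales (simp add: cc_transformation_def)

sublocale tot: natural_transformation "Tot X" "Tot Y" "ccT P" "ccT Q" \<alpha>'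
  using transformation by unfold_locales (simp add: cc_transformation_def)

lemma Proj_component [simp]:
  "A \<in> Obj (Tot X) \<Longrightarrow> onA (Proj Y) (\<alpha>' A) = \<alpha> (onO (Proj X) A)"
  using transformation by (simp add: cc_transformation_def)

lemma Iso_component:
  "A \<in> Obj (Tot X) \<Longrightarrow> top_side (ccIso Q A) \<cdot>\<^bsub>Base Y\<^esub> top_side (onA (Compr Y) (\<alpha>' A)) =
    \<alpha> (Dom (Base X) (onO (Compr X) A)) \<cdot>\<^bsub>Base Y\<^esub> top_side (ccIso P A)"
  using transformation by (simp add: cc_transformation_def)

end

lemma cc_transfI:
  assumes "is_compcat X" "is_compcat Y" "cc_pseudo_map X Y P" "cc_pseudo_map X Y Q"
    and "cc_transformation X Y P Q (\<alpha>, \<alpha>')"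
  shows "cc_transf X Y P Q \<alpha> \<alpha>'"
  using assms by (simp add: cc_transf_def cc_transf_axioms_def cc_morphismI)

lemma cc_transformation_id:
  assumes "is_compcat X" "is_compcat Y" "cc_pseudo_map X Y P"
  shows "cc_transformation X Y P P (\<lambda>x\<in>Obj (Base X). Ident (Base Y) (onO (ccF P) x),
                 \<lambda>A\<in>Obj (Tot X). Ident (Tot Y) (onO (ccT P) A))"
proof -
  interpret P: cc_morphism X Y P using assms by (simp add: cc_morphismI)
  show ?thesis
    by (simp add: cc_transformation_def nat_trans_id[OF P.F.is_functor] nat_trans_id[OF P.T.is_functor])
qed

text \<open>The two compatibility squares are pasted side by side, comprehension being functorial on
  the total components.\<close>

lemma cc_transformation_vcomp:
  assumes "is_compcat X" "is_compcat Y"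
    and "cc_pseudo_map X Y P" "cc_pseudo_map X Y Q" "cc_pseudo_map X Y R"
    and "cc_transformation X Y P Q (\<alpha>, \<alpha>')" "cc_transformation X Y Q R (\<beta>, \<beta>')"
  shows "cc_transformation X Y P R (\<lambda>x\<in>Obj (Base X). \<beta> x \<cdot>\<^bsub>Base Y\<^esub> \<alpha> x,
               \<lambda>A\<in>Obj (Tot X). \<beta>' A \<cdot>\<^bsub>Tot Y\<^esub> \<alpha>' A)"
proof -
  interpret a: cc_transf X Y P Q \<alpha> \<alpha>' using assms by (simp add: cc_transfI)
  interpret b: cc_transf X Y Q R \<beta> \<beta>' using assms by (simp add: cc_transfI)
  have "top_side (ccIso R A) \<cdot>\<^bsub>Base Y\<^esub>
      (top_side (onA (Compr Y) (\<beta>' A)) \<cdot>\<^bsub>Base Y\<^esub> top_side (onA (Compr Y) (\<alpha>' A))) =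
      \<beta> (Dom (Base X) (onO (Compr X) A)) \<cdot>\<^bsub>Base Y\<^esub> \<alpha> (Dom (Base X) (onO (Compr X) A)) \<cdot>\<^bsub>Base Y\<^esub>
        top_side (ccIso P A)" (is "?r \<cdot>\<^bsub>_\<^esub> (?b' \<cdot>\<^bsub>_\<^esub> ?a') = ?b \<cdot>\<^bsub>_\<^esub> ?a \<cdot>\<^bsub>_\<^esub> ?p")
    if A: "A \<in> Obj (Tot X)" for A
  proof -
    have "?r \<cdot>\<^bsub>Base Y\<^esub> (?b' \<cdot>\<^bsub>Base Y\<^esub> ?a') = (?r \<cdot>\<^bsub>Base Y\<^esub> ?b') \<cdot>\<^bsub>Base Y\<^esub> ?a'"
      using A by (simp add: a.P.Y.Proj.D.assoc)
    also have "\<dots> = ?b \<cdot>\<^bsub>Base Y\<^esub> (top_side (ccIso Q A) \<cdot>\<^bsub>Base Y\<^esub> ?a')"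
      using A unfolding b.Iso_component[OF A] by (simp add: a.P.Y.Proj.D.assoc)
    also have "\<dots> = ?b \<cdot>\<^bsub>Base Y\<^esub> ?a \<cdot>\<^bsub>Base Y\<^esub> ?p"
      using A unfolding a.Iso_component[OF A] by (simp add: a.P.Y.Proj.D.assoc)
    finally show ?thesis .
  qed
  then show ?thesis
    by (simp add: cc_transformation_def nat_trans_vcomp[OF a.base.nat_trans b.base.nat_trans]
        nat_trans_vcomp[OF a.tot.nat_trans b.tot.nat_trans])
qed

text \<open>Four squares are pasted: compatibility of \<beta> at the image of A under P', naturality
  of the comparison of Q at \<open>\<alpha>' A\<close>, naturality of \<beta> at the comparison of
  P', and the functor Q applied to compatibility of \<alpha>.\<close>

lemma cc_transformation_hcomp:
  assumes "is_compcat X" "is_compcat Y" "is_compcat Z"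
    and "cc_pseudo_map X Y P" "cc_pseudo_map X Y P'" "cc_pseudo_map Y Z Q" "cc_pseudo_map Y Z Q'"
    and "cc_transformation X Y P P' (\<alpha>, \<alpha>')" "cc_transformation Y Z Q Q' (\<beta>, \<beta>')"
  shows "cc_transformation X Z (cc_comp X Y Z Q P) (cc_comp X Y Z Q' P')
     (\<lambda>x\<in>Obj (Base X). \<beta> (onO (ccF P') x) \<cdot>\<^bsub>Base Z\<^esub> onA (ccF Q) (\<alpha> x),
       \<lambda>A\<in>Obj (Tot X). \<beta>' (onO (ccT P') A) \<cdot>\<^bsub>Tot Z\<^esub> onA (ccT Q) (\<alpha>' A))"
proof -
  interpret a: cc_transf X Y P P' \<alpha> \<alpha>' using assms by (simp add: cc_transfI)
  interpret b: cc_transf Y Z Q Q' \<beta> \<beta>' using assms by (simp add: cc_transfI)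
  note QP = cc_comp_simps[OF assms(1-3,4,6)] and QP' = cc_comp_simps[OF assms(1-3,5,7)]
  have "onA (ccF Q') (top_side (ccIso P' A)) \<cdot>\<^bsub>Base Z\<^esub> top_side (ccIso Q' (onO (ccT P') A)) \<cdot>\<^bsub>Base Z\<^esub>
      (top_side (onA (Compr Z) (\<beta>' (onO (ccT P') A))) \<cdot>\<^bsub>Base Z\<^esub>
        top_side (onA (Compr Z) (onA (ccT Q) (\<alpha>' A)))) =
      \<beta> (onO (ccF P') (Dom (Base X) (onO (Compr X) A))) \<cdot>\<^bsub>Base Z\<^esub>
        onA (ccF Q) (\<alpha> (Dom (Base X) (onO (Compr X) A))) \<cdot>\<^bsub>Base Z\<^esub>
        (onA (ccF Q) (top_side (ccIso P A)) \<cdot>\<^bsub>Base Z\<^esub> top_side (ccIso Q (onO (ccT P) A)))"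
    (is "?Q'p' \<cdot>\<^bsub>_\<^esub> ?q' \<cdot>\<^bsub>_\<^esub> (?\<chi>b \<cdot>\<^bsub>_\<^esub> ?\<chi>a) = ?b \<cdot>\<^bsub>_\<^esub> ?Qa \<cdot>\<^bsub>_\<^esub> (?Qp \<cdot>\<^bsub>_\<^esub> ?q)")
    if A: "A \<in> Obj (Tot X)" for A
  proof -
    note [simp] = A
    let ?B' = "onO (ccT P') A"
    have e1: "?q' \<cdot>\<^bsub>Base Z\<^esub> ?\<chi>b =
        \<beta> (Dom (Base Y) (onO (Compr Y) ?B')) \<cdot>\<^bsub>Base Z\<^esub> top_side (ccIso Q ?B')"
      by (rule b.Iso_component) simp
    have e2: "top_side (ccIso Q ?B') \<cdot>\<^bsub>Base Z\<^esub> ?\<chi>a =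
        onA (ccF Q) (top_side (onA (Compr Y) (\<alpha>' A))) \<cdot>\<^bsub>Base Z\<^esub> ?q"
      using b.P.Iso_naturality[of "\<alpha>' A"] by simp
    have e3: "?Q'p' \<cdot>\<^bsub>Base Z\<^esub> \<beta> (Dom (Base Y) (onO (Compr Y) ?B')) =
        ?b \<cdot>\<^bsub>Base Z\<^esub> onA (ccF Q) (top_side (ccIso P' A))"
      using b.base.naturality[of "top_side (ccIso P' A)"] by simp
    have e4: "onA (ccF Q) (top_side (ccIso P' A)) \<cdot>\<^bsub>Base Z\<^esub>
        onA (ccF Q) (top_side (onA (Compr Y) (\<alpha>' A))) = ?Qa \<cdot>\<^bsub>Base Z\<^esub> ?Qp"
      using arg_cong[OF a.Iso_component[OF A], of "onA (ccF Q)"] by simp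
    have "?Q'p' \<cdot>\<^bsub>Base Z\<^esub> ?q' \<cdot>\<^bsub>Base Z\<^esub> (?\<chi>b \<cdot>\<^bsub>Base Z\<^esub> ?\<chi>a) =
        ?Q'p' \<cdot>\<^bsub>Base Z\<^esub> ((?q' \<cdot>\<^bsub>Base Z\<^esub> ?\<chi>b) \<cdot>\<^bsub>Base Z\<^esub> ?\<chi>a)"
      by (simp add: b.P.Y.Proj.D.assoc)
    also have "\<dots> = (?Q'p' \<cdot>\<^bsub>Base Z\<^esub> \<beta> (Dom (Base Y) (onO (Compr Y) ?B'))) \<cdot>\<^bsub>Base Z\<^esub>
        (top_side (ccIso Q ?B') \<cdot>\<^bsub>Base Z\<^esub> ?\<chi>a)"
      unfolding e1 by (simp add: b.P.Y.Proj.D.assoc)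
    also have "\<dots> = ?b \<cdot>\<^bsub>Base Z\<^esub> ((onA (ccF Q) (top_side (ccIso P' A)) \<cdot>\<^bsub>Base Z\<^esub>
        onA (ccF Q) (top_side (onA (Compr Y) (\<alpha>' A)))) \<cdot>\<^bsub>Base Z\<^esub> ?q)"
      unfolding e2 e3 by (simp add: b.P.Y.Proj.D.assoc)
    also have "\<dots> = ?b \<cdot>\<^bsub>Base Z\<^esub> ?Qa \<cdot>\<^bsub>Base Z\<^esub> (?Qp \<cdot>\<^bsub>Base Z\<^esub> ?q)"
      unfolding e4 by (simp add: b.P.Y.Proj.D.assoc)
    finally show ?thesis .
  qed
  then show ?thesis
    by (simp add: cc_transformation_def nat_trans_hcomp[OF a.base.nat_trans b.base.nat_trans]
        nat_trans_hcomp[OF a.tot.nat_trans b.tot.nat_trans] QP QP')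
qed

lemma cc_hom_simps [simp]:
  "Obj (cc_hom X Y) = {P. cc_pseudo_map X Y P}"
  "(P, a, Q) \<in> Arr (cc_hom X Y) \<longleftrightarrow>
     cc_pseudo_map X Y P \<and> cc_pseudo_map X Y Q \<and> cc_transformation X Y P Q a"
  "s \<in> Arr (cc_hom X Y) \<Longrightarrow> Dom (cc_hom X Y) s = fst s"
  "s \<in> Arr (cc_hom X Y) \<Longrightarrow> Cod (cc_hom X Y) s = snd (snd s)"
  "cc_pseudo_map X Y P \<Longrightarrow> Ident (cc_hom X Y) P =
     (P, (\<lambda>x\<in>Obj (Base X). Ident (Base Y) (onO (ccF P) x),
          \<lambda>A\<in>Obj (Tot X). Ident (Tot Y) (onO (ccT P) A)), P)"
  "\<lbrakk>(P, (\<alpha>, \<alpha>'), Q) \<in> Arr (cc_hom X Y); (Q, (\<beta>, \<beta>'), R) \<in> Arr (cc_hom X Y)\<rbrakk> \<Longrightarrow>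
     (Q, (\<beta>, \<beta>'), R) \<cdot>\<^bsub>cc_hom X Y\<^esub> (P, (\<alpha>, \<alpha>'), Q) =
       (P, (\<lambda>x\<in>Obj (Base X). \<beta> x \<cdot>\<^bsub>Base Y\<^esub> \<alpha> x, \<lambda>A\<in>Obj (Tot X). \<beta>' A \<cdot>\<^bsub>Tot Y\<^esub> \<alpha>' A), R)"
  by (auto simp: cc_hom_def split_beta)

lemma cc_cell_cases:
  obtains P \<alpha> \<alpha>' Q where "s = (P, (\<alpha>, \<alpha>'), Q)"
  by (metis surj_pair)

lemma category_cc_hom:
  assumes X: "is_compcat X" and Y: "is_compcat Y"
  shows "category (cc_hom X Y)"
  unfolding cc_hom_def
proof (rule category_mk_cat, goal_cases)
  case (3 P)
  then show ?case by (simp add: cc_transformation_id X Y)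
next
  case (6 s t)
  then show ?case by (auto intro: cc_transformation_vcomp[OF X Y])
next
  case (9 s)
  obtain P \<alpha> \<alpha>' Q where s: "s = (P, (\<alpha>, \<alpha>'), Q)" by (rule cc_cell_cases)
  interpret cc_transf X Y P Q \<alpha> \<alpha>' using 9 s X Y by (simp add: cc_transfI)
  show ?case
    by (auto simp: s intro!: restrict_eqI base.component_extensional tot.component_extensional)
next
  case (10 s)
  obtain P \<alpha> \<alpha>' Q where s: "s = (P, (\<alpha>, \<alpha>'), Q)" by (rule cc_cell_cases)
  interpret cc_transf X Y P Q \<alpha> \<alpha>' using 10 s X Y by (simp add: cc_transfI)
  show ?case
    by (auto simp: s intro!: restrict_eqI base.component_extensional tot.component_extensional)
next
  case (11 s t u)
  obtain P \<alpha> \<alpha>' Q where s: "s = (P, (\<alpha>, \<alpha>'), Q)" by (rule cc_cell_cases)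
  obtain \<beta> \<beta>' R where t: "t = (Q, (\<beta>, \<beta>'), R)" using 11 s by (cases t rule: cc_cell_cases) auto
  obtain \<gamma> \<gamma>' S where u: "u = (R, (\<gamma>, \<gamma>'), S)" using 11 t by (cases u rule: cc_cell_cases) auto
  interpret a: cc_transf X Y P Q \<alpha> \<alpha>' using 11 s X Y by (simp add: cc_transfI)
  interpret b: cc_transf X Y Q R \<beta> \<beta>' using 11 t X Y by (simp add: cc_transfI)
  interpret c: cc_transf X Y R S \<gamma> \<gamma>' using 11 u X Y by (simp add: cc_transfI)
  show ?case
    by (auto simp: s t u a.P.Y.Proj.C.assoc a.P.Y.Proj.D.assoc intro!: restrict_ext)
qed auto

lemma cc_id_simps [simp]: "ccF (cc_id X) = id_functor (Base X)" "ccT (cc_id X) = id_functor (Tot X)"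
  by (simp_all add: cc_id_def)

lemma cc_hcomp_simps:
  "cc_hcomp X Y Z (Q, (\<beta>, \<beta>'), Q') (P, (\<alpha>, \<alpha>'), P') =
     (cc_comp X Y Z Q P,
      (\<lambda>x\<in>Obj (Base X). \<beta> (onO (ccF P') x) \<cdot>\<^bsub>Base Z\<^esub> onA (ccF Q) (\<alpha> x),
       \<lambda>A\<in>Obj (Tot X). \<beta>' (onO (ccT P') A) \<cdot>\<^bsub>Tot Z\<^esub> onA (ccT Q) (\<alpha>' A)),
      cc_comp X Y Z Q' P')"
  by (simp add: cc_hcomp_def)

lemma cc_hcomp_Arr:
  assumes X: "is_compcat X" and Y: "is_compcat Y" and Z: "is_compcat Z"
    and "t \<in> Arr (cc_hom Y Z)" "s \<in> Arr (cc_hom X Y)"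
  shows "cc_hcomp X Y Z t s \<in> Arr (cc_hom X Z)"
  using assms(4,5)
  by (cases s rule: cc_cell_cases; cases t rule: cc_cell_cases)
    (auto simp: cc_hcomp_simps cc_pseudo_map_cc_comp[OF X Y Z] intro: cc_transformation_hcomp[OF X Y Z])

text \<open>The middle-four interchange: beyond functoriality and associativity it rests on
  naturality of \<beta> at \<open>\<alpha>' x\<close>. Being stated for plain natural
  transformations, it serves the base components and the total components alike.\<close>

lemma interchange:
  assumes "nat_trans C D P P' \<alpha>" "nat_trans C D P' P'' \<alpha>'"
    and "nat_trans D E Q Q' \<beta>" "nat_trans D E Q' Q'' \<beta>'" and x: "x \<in> Obj C"
  shows "\<beta>' (onO P'' x) \<cdot>\<^bsub>E\<^esub> \<beta> (onO P'' x) \<cdot>\<^bsub>E\<^esub> onA Q (\<alpha>' x \<cdot>\<^bsub>D\<^esub> \<alpha> x) =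
    \<beta>' (onO P'' x) \<cdot>\<^bsub>E\<^esub> onA Q' (\<alpha>' x) \<cdot>\<^bsub>E\<^esub> (\<beta> (onO P' x) \<cdot>\<^bsub>E\<^esub> onA Q (\<alpha> x))"
proof -
  interpret a: natural_transformation C D P P' \<alpha> by standard fact
  interpret a': natural_transformation C D P' P'' \<alpha>' by standard fact
  interpret b: natural_transformation D E Q Q' \<beta> by standard fact
  interpret b': natural_transformation D E Q' Q'' \<beta>' by standard fact
  have "\<beta>' (onO P'' x) \<cdot>\<^bsub>E\<^esub> \<beta> (onO P'' x) \<cdot>\<^bsub>E\<^esub> onA Q (\<alpha>' x \<cdot>\<^bsub>D\<^esub> \<alpha> x) =
      \<beta>' (onO P'' x) \<cdot>\<^bsub>E\<^esub> ((\<beta> (onO P'' x) \<cdot>\<^bsub>E\<^esub> onA Q (\<alpha>' x)) \<cdot>\<^bsub>E\<^esub> onA Q (\<alpha> x))"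
    using x by (simp add: b.F.D.assoc)
  also have "\<beta> (onO P'' x) \<cdot>\<^bsub>E\<^esub> onA Q (\<alpha>' x) = onA Q' (\<alpha>' x) \<cdot>\<^bsub>E\<^esub> \<beta> (onO P' x)"
    using x b.naturality[of "\<alpha>' x"] by simp
  finally show ?thesis
    using x by (simp add: b.F.D.assoc)
qed

lemma cc_hcomp_functor:
  assumes X: "is_compcat X" and Y: "is_compcat Y" and Z: "is_compcat Z"
  shows "is_functor (prod_cat (cc_hom Y Z) (cc_hom X Y)) (cc_hom X Z)
    \<lparr>onO = (\<lambda>(Q, P) \<in> Obj (cc_hom Y Z) \<times> Obj (cc_hom X Y). cc_comp X Y Z Q P),
     onA = (\<lambda>(\<beta>, \<alpha>) \<in> Arr (cc_hom Y Z) \<times> Arr (cc_hom X Y). cc_hcomp X Y Z \<beta> \<alpha>)\<rparr>"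
proof (rule is_functorI, goal_cases)
  case 1
  show ?case using assms by (simp add: category_prod_cat category_cc_hom)
next
  case 2
  show ?case using assms by (simp add: category_cc_hom)
next
  case (3 p)
  then show ?case by (auto intro: cc_pseudo_map_cc_comp[OF X Y Z])
next
  case (4 s)
  then show ?case using cc_hcomp_Arr[OF X Y Z] by auto
next
  case (5 s)
  then show ?case using cc_hcomp_Arr[OF X Y Z, of "fst s" "snd s"]
    by (cases "fst s" rule: cc_cell_cases; cases "snd s" rule: cc_cell_cases)
      (auto simp: cc_hcomp_simps)
next
  case (6 s)
  then show ?case using cc_hcomp_Arr[OF X Y Z, of "fst s" "snd s"]
    by (cases "fst s" rule: cc_cell_cases; cases "snd s" rule: cc_cell_cases)
      (auto simp: cc_hcomp_simps)
next
  case (7 p)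
  then obtain Q P where p: "p = (Q, P)" "cc_pseudo_map Y Z Q" "cc_pseudo_map X Y P" by auto
  interpret P: cc_morphism X Y P using p X Y by (simp add: cc_morphismI)
  interpret Q: cc_morphism Y Z Q using p Y Z by (simp add: cc_morphismI)
  show ?case
    using p cc_transformation_id[OF X Y p(3)] cc_transformation_id[OF Y Z p(2)]
      cc_pseudo_map_cc_comp[OF X Y Z p(3,2)]
    by (auto simp: cc_hcomp_simps cc_comp_simps[OF X Y Z p(3,2)] intro!: restrict_ext)
next
  case (8 s t)
  obtain Q \<beta> \<beta>' Q' P \<alpha> \<alpha>' P' where s: "s = ((Q, (\<beta>, \<beta>'), Q'), (P, (\<alpha>, \<alpha>'), P'))"
    by (metis surj_pair)
  have s': "(Q, (\<beta>, \<beta>'), Q') \<in> Arr (cc_hom Y Z)" "(P, (\<alpha>, \<alpha>'), P') \<in> Arr (cc_hom X Y)"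
    using 8(1) unfolding s by (auto simp del: cc_hom_simps)
  obtain R \<gamma> \<gamma>' Q'' S \<delta> \<delta>' P'' where t0: "t = ((R, (\<gamma>, \<gamma>'), Q''), (S, (\<delta>, \<delta>'), P''))"
    by (metis surj_pair)
  have t0': "(R, (\<gamma>, \<gamma>'), Q'') \<in> Arr (cc_hom Y Z)" "(S, (\<delta>, \<delta>'), P'') \<in> Arr (cc_hom X Y)"
    using 8(2) unfolding t0 by (auto simp del: cc_hom_simps)
  have RS: "R = Q'" "S = P'"
    using 8(3) s' t0' unfolding s t0 by (auto simp del: cc_hom_simps(2))
  note t = t0[unfolded RS] and t' = t0'[unfolded RS]
  interpret a: cc_transf X Y P P' \<alpha> \<alpha>' using s' X Y by (simp add: cc_transfI)
  interpret a': cc_transf X Y P' P'' \<delta> \<delta>' using t' X Y by (simp add: cc_transfI)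
  interpret b: cc_transf Y Z Q Q' \<beta> \<beta>' using s' Z Y by (simp add: cc_transfI)
  interpret b': cc_transf Y Z Q' Q'' \<gamma> \<gamma>' using t' Z Y by (simp add: cc_transfI)
  \<comment> \<open>Horizontal composition is restricted to arrows, so the vertical composites must
    be known to be arrows before it unfolds.\<close>
  have v: "(P, (\<lambda>x\<in>Obj (Base X). \<delta> x \<cdot>\<^bsub>Base Y\<^esub> \<alpha> x, \<lambda>A\<in>Obj (Tot X). \<delta>' A \<cdot>\<^bsub>Tot Y\<^esub> \<alpha>' A), P'')
      \<in> Arr (cc_hom X Y)"
    "(Q, (\<lambda>x\<in>Obj (Base Y). \<gamma> x \<cdot>\<^bsub>Base Z\<^esub> \<beta> x, \<lambda>A\<in>Obj (Tot Y). \<gamma>' A \<cdot>\<^bsub>Tot Z\<^esub> \<beta>' A), Q'')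
      \<in> Arr (cc_hom Y Z)"
    using s' t' cc_transformation_vcomp[OF X Y] cc_transformation_vcomp[OF Y Z] by auto
  note h = cc_hcomp_Arr[OF X Y Z s', unfolded cc_hcomp_simps]
    cc_hcomp_Arr[OF X Y Z t', unfolded cc_hcomp_simps]
  note i = interchange[OF a.base.nat_trans a'.base.nat_trans b.base.nat_trans b'.base.nat_trans]
    interchange[OF a.tot.nat_trans a'.tot.nat_trans b.tot.nat_trans b'.tot.nat_trans]
  show ?case
    unfolding s t
    using s' t' v h
    by (auto simp: cc_hcomp_simps i simp del: cc_hom_simps(2) b.P.F.onA_Comp b.P.T.onA_Comp intro!: restrict_ext)
qed auto

theorem two_category_compcat_disc_ps:
  "two_category (compcat_disc_ps :: (('o, 'a, 'p, 'b) compcat, _, _) cat2)"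
proof (rule two_category.intro, goal_cases)
  case (1 X Y)
  then show ?case by (simp add: compcat_disc_ps_def is_discrete_compcat_def category_cc_hom)
next
  case (2 X)
  then show ?case by (simp add: compcat_disc_ps_def is_discrete_compcat_def cc_pseudo_map_cc_id)
next
  case (3 X Y Z)
  then show ?case using cc_hcomp_functor[of X Y Z]
    by (simp add: compcat_disc_ps_def is_discrete_compcat_def)
next
  case (4 X Y P)
  then show ?case
    by (simp add: compcat_disc_ps_def is_discrete_compcat_def cc_pseudo_map_cc_id cc_comp_cc_id_left)
next
  case (5 X Y P)
  then show ?case
    by (simp add: compcat_disc_ps_def is_discrete_compcat_def cc_pseudo_map_cc_id cc_comp_cc_id_right)
next
  case (6 W X Y Z P Q R)
  then show ?case
    by (simp add: compcat_disc_ps_def is_discrete_compcat_def cc_pseudo_map_cc_comp cc_comp_assoc)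
next
  case (7 X Y s)
  obtain P \<alpha> \<alpha>' Q where s: "s = (P, (\<alpha>, \<alpha>'), Q)" by (rule cc_cell_cases)
  have XY: "is_compcat X" "is_compcat Y" and s': "s \<in> Arr (cc_hom X Y)"
    using 7 by (simp_all add: compcat_disc_ps_def is_discrete_compcat_def)
  interpret cc_transf X Y P Q \<alpha> \<alpha>' using s' s XY by (simp add: cc_transfI)
  \<comment> \<open>The unit 2-cell has to be recognised as an arrow for the restricted composition
    to unfold on it.\<close>
  have "Ident (cc_hom Y Y) (cc_id Y) \<in> Arr (cc_hom Y Y)"
    using XY category.Ident_Arr[OF category_cc_hom, of Y Y "cc_id Y"]
    by (simp add: cc_pseudo_map_cc_id del: cc_hom_simps(2,5))
  then show ?case
    using s' XY unfolding s compcat_disc_ps_def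
    by (auto simp: cc_hcomp_simps cc_pseudo_map_cc_id cc_comp_cc_id_left
        intro!: restrict_eqI base.component_extensional tot.component_extensional)
next
  case (8 X Y s)
  obtain P \<alpha> \<alpha>' Q where s: "s = (P, (\<alpha>, \<alpha>'), Q)" by (rule cc_cell_cases)
  have XY: "is_compcat X" "is_compcat Y" and s': "s \<in> Arr (cc_hom X Y)"
    using 8 by (simp_all add: compcat_disc_ps_def is_discrete_compcat_def)
  interpret cc_transf X Y P Q \<alpha> \<alpha>' using s' s XY by (simp add: cc_transfI)
  have "Ident (cc_hom X X) (cc_id X) \<in> Arr (cc_hom X X)"
    using XY category.Ident_Arr[OF category_cc_hom, of X X "cc_id X"]
    by (simp add: cc_pseudo_map_cc_id del: cc_hom_simps(2,5))
  then show ?case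
    using s' XY unfolding s compcat_disc_ps_def
    by (auto simp: cc_hcomp_simps cc_pseudo_map_cc_id cc_comp_cc_id_right
        intro!: restrict_eqI base.component_extensional tot.component_extensional)
next
  case (9 W X Y Z r s t)
  obtain P \<alpha> \<alpha>' P' where r: "r = (P, (\<alpha>, \<alpha>'), P')" by (rule cc_cell_cases)
  obtain Q \<beta> \<beta>' Q' where s: "s = (Q, (\<beta>, \<beta>'), Q')" by (rule cc_cell_cases)
  obtain R \<gamma> \<gamma>' R' where t: "t = (R, (\<gamma>, \<gamma>'), R')" by (rule cc_cell_cases)
  have c: "is_compcat W" "is_compcat X" "is_compcat Y" "is_compcat Z"
    and r': "r \<in> Arr (cc_hom W X)" and s': "s \<in> Arr (cc_hom X Y)" and t': "t \<in> Arr (cc_hom Y Z)"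
    using 9 by (simp_all add: compcat_disc_ps_def is_discrete_compcat_def)
  interpret a: cc_transf W X P P' \<alpha> \<alpha>' using r r' c by (simp add: cc_transfI)
  interpret b: cc_transf X Y Q Q' \<beta> \<beta>' using s s' c by (simp add: cc_transfI)
  interpret g: cc_transf Y Z R R' \<gamma> \<gamma>' using t t' c by (simp add: cc_transfI)
  have "cc_comp W X Z (cc_comp X Y Z R Q) P = cc_comp W Y Z R (cc_comp W X Y Q P)"
    "cc_comp W X Z (cc_comp X Y Z R' Q') P' = cc_comp W Y Z R' (cc_comp W X Y Q' P')"
    using r r' s s' t t' c by (auto intro: cc_comp_assoc)
  moreover have "ccF (cc_comp W X Y Q' P') = comp_functor (Base W) (ccF Q') (ccF P')"
    "ccT (cc_comp W X Y Q' P') = comp_functor (Tot W) (ccT Q') (ccT P')"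
    "ccF (cc_comp X Y Z R Q) = comp_functor (Base X) (ccF R) (ccF Q)"
    "ccT (cc_comp X Y Z R Q) = comp_functor (Tot X) (ccT R) (ccT Q)"
    by (simp_all add: cc_comp_def)
  ultimately have "cc_hcomp W X Z (cc_hcomp X Y Z t s) r = cc_hcomp W Y Z t (cc_hcomp W X Y s r)"
    by (auto simp: r s t cc_hcomp_simps g.P.Y.Proj.C.assoc g.P.Y.Proj.D.assoc intro!: restrict_ext)
  then show ?case
    using r' s' t' c by (simp add: compcat_disc_ps_def cc_hcomp_Arr)
qed


section \<open>Categories with attributes\<close>

lemma set_cat_Obj [simp]: "Obj set_cat = UNIV"
  and set_cat_Arr: "(A, f, B) \<in> Arr set_cat \<longleftrightarrow> f \<in> A \<rightarrow>\<^sub>E B"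
  and set_cat_Dom_Cod [simp]: "m \<in> Arr set_cat \<Longrightarrow> Dom set_cat m = fst m"
    "m \<in> Arr set_cat \<Longrightarrow> Cod set_cat m = snd (snd m)"
  and set_cat_Ident: "Ident set_cat A = (A, (\<lambda>x\<in>A. x), A)"
  by (auto simp: set_cat_def split_beta)

lemma set_map_eta: "(fst m, set_app m, snd (snd m)) = m"
  by (simp add: set_app_def)

lemma set_app_simp [simp]: "set_app (A, f, B) = f"
  by (simp add: set_app_def)

lemma set_app_mem [simp]: "\<lbrakk>m \<in> Arr set_cat; x \<in> fst m\<rbrakk> \<Longrightarrow> set_app m x \<in> snd (snd m)"
  using set_cat_Arr[of "fst m" "set_app m" "snd (snd m)"] by (auto simp: set_map_eta)

lemma set_app_extensional: "m \<in> Arr set_cat \<Longrightarrow> set_app m \<in> extensional (fst m)"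
  using set_cat_Arr[of "fst m" "set_app m" "snd (snd m)"] by (auto simp: set_map_eta PiE_iff)

lemma set_cat_Comp:
  assumes "m \<in> Arr set_cat" "n \<in> Arr set_cat" "fst n = snd (snd m)"
  shows "n \<cdot>\<^bsub>set_cat\<^esub> m = (fst m, compose (fst m) (set_app n) (set_app m), snd (snd n))"
  using assms by (auto simp: set_cat_def set_app_def split_beta)

lemma category_set_cat: "category (set_cat :: ('t set, 't set_map) cat)"
proof -
  have "compose A (\<lambda>x\<in>B. x) f = f" "compose A f (\<lambda>x\<in>A. x) = f" if "f \<in> A \<rightarrow>\<^sub>E B" for A B :: "'t set" and f
    using that by (auto simp: compose_def PiE_iff intro!: restrict_eqI)
  moreover have "compose A (compose B h g) f = compose A h (compose A g f)" if "f \<in> A \<rightarrow>\<^sub>E B"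
    for A B :: "'t set" and f g h :: "'t \<Rightarrow> 't"
    using that by (auto simp: compose_def intro!: restrict_ext)
  ultimately show ?thesis
    unfolding set_cat_def
    by (intro category_mk_cat) (auto simp: PiE_iff compose_eq compose_extensional)
qed

lemma set_map_eqI:
  assumes "m \<in> Arr set_cat" "n \<in> Arr set_cat" "fst m = fst n" "snd (snd m) = snd (snd n)"
    and "\<And>x. x \<in> fst m \<Longrightarrow> set_app m x = set_app n x"
  shows "m = n"
proof -
  have "set_app m = set_app n"
    using assms set_app_extensional[of m] set_app_extensional[of n]
    by (intro extensionalityI[of _ "fst m"]) auto
  then show ?thesis
    using assms(3,4) set_map_eta by metis
qed

lemma set_app_Comp [simp]:
  assumes "m \<in> Arr set_cat" "n \<in> Arr set_cat" "fst n = snd (snd m)" "x \<in> fst m"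
  shows "set_app (n \<cdot>\<^bsub>set_cat\<^esub> m) x = set_app n (set_app m x)"
  using assms by (simp add: set_cat_Comp compose_def)

lemma set_app_Ident [simp]: "x \<in> A \<Longrightarrow> set_app (Ident set_cat A) x = x"
  by (simp add: set_cat_Ident)

lemma elements_cat_Obj: "e \<in> Obj (elements_cat C T) \<longleftrightarrow> fst e \<in> Obj C \<and> snd e \<in> onO T (fst e)"
  and elements_cat_Arr: "a \<in> Arr (elements_cat C T) \<longleftrightarrow> fst a \<in> Arr C \<and> snd a \<in> onO T (Cod C (fst a))"
  and elements_cat_Dom: "a \<in> Arr (elements_cat C T) \<Longrightarrow>
    Dom (elements_cat C T) a = (Dom C (fst a), set_app (onA T (fst a)) (snd a))"
  and elements_cat_Cod: "a \<in> Arr (elements_cat C T) \<Longrightarrow>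
    Cod (elements_cat C T) a = (Cod C (fst a), snd a)"
  and elements_cat_Ident: "e \<in> Obj (elements_cat C T) \<Longrightarrow>
    Ident (elements_cat C T) e = (Ident C (fst e), snd e)"
  by (auto simp: elements_cat_def split_beta)

lemma elements_cat_Comp: "\<lbrakk>a \<in> Arr (elements_cat C T); b \<in> Arr (elements_cat C T);
    Dom (elements_cat C T) b = Cod (elements_cat C T) a\<rbrakk> \<Longrightarrow>
    b \<cdot>\<^bsub>elements_cat C T\<^esub> a = (fst b \<cdot>\<^bsub>C\<^esub> fst a, snd b)"
  by (auto simp: elements_cat_def split_beta)

lemma presheaf_onA:
  assumes T: "is_functor (op_cat C) set_cat T" and f: "f \<in> Arr C"
  shows "onA T f \<in> Arr set_cat" "fst (onA T f) = onO T (Cod C f)" "snd (snd (onA T f)) = onO T (Dom C f)"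
proof -
  interpret T: functor_between "op_cat C" set_cat T by standard fact
  show *: "onA T f \<in> Arr set_cat" using T.onA_Arr f by simp
  show "fst (onA T f) = onO T (Cod C f)" "snd (snd (onA T f)) = onO T (Dom C f)"
    using T.Dom_onA[of f] T.Cod_onA[of f] f * by simp_all
qed

lemma presheaf_subst [simp]:
  assumes T: "is_functor (op_cat C) set_cat T"
  shows "\<lbrakk>f \<in> Arr C; A \<in> onO T (Cod C f)\<rbrakk> \<Longrightarrow> set_app (onA T f) A \<in> onO T (Dom C f)"
    and "\<lbrakk>x \<in> Obj C; A \<in> onO T x\<rbrakk> \<Longrightarrow> set_app (onA T (Ident C x)) A = A"
    and "\<lbrakk>f \<in> Arr C; g \<in> Arr C; Dom C g = Cod C f; A \<in> onO T (Cod C g)\<rbrakk> \<Longrightarrow>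
      set_app (onA T (g \<cdot>\<^bsub>C\<^esub> f)) A = set_app (onA T f) (set_app (onA T g) A)"
proof -
  interpret T: functor_between "op_cat C" set_cat T by standard fact
  show "set_app (onA T f) A \<in> onO T (Dom C f)" if "f \<in> Arr C" "A \<in> onO T (Cod C f)"
    using presheaf_onA[OF T that(1)] that set_app_mem[of "onA T f" A] by simp
  show "set_app (onA T (Ident C x)) A = A" if "x \<in> Obj C" "A \<in> onO T x"
    using that T.onA_Ident[of x] by simp
  show "set_app (onA T (g \<cdot>\<^bsub>C\<^esub> f)) A = set_app (onA T f) (set_app (onA T g) A)"
    if "f \<in> Arr C" "g \<in> Arr C" "Dom C g = Cod C f" "A \<in> onO T (Cod C g)"
    using that T.onA_Comp[of g f] presheaf_onA[OF T that(1)] presheaf_onA[OF T that(2)] by simp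
qed

lemma category_elements_cat:
  assumes C: "category C" and T: "is_functor (op_cat C) set_cat T"
  shows "category (elements_cat C T)"
proof -
  interpret category C by fact
  show ?thesis
    unfolding elements_cat_def
    by (rule category_mk_cat) (auto simp: presheaf_subst[OF T] assoc)
qed

lemma elements_proj_simps [simp]:
  "e \<in> Obj (elements_cat C T) \<Longrightarrow> onO (elements_proj C T) e = fst e"
  "a \<in> Arr (elements_cat C T) \<Longrightarrow> onA (elements_proj C T) a = fst a"
  by (simp_all add: elements_proj_def split_beta)

lemma elements_proj_extensional [simp]:
  "onO (elements_proj C T) \<in> extensional (Obj (elements_cat C T))"
  "onA (elements_proj C T) \<in> extensional (Arr (elements_cat C T))"
  by (simp_all add: elements_proj_def)

lemma is_functor_elements_proj:
  assumes C: "category C" and T: "is_functor (op_cat C) set_cat T"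
  shows "is_functor (elements_cat C T) C (elements_proj C T)"
proof -
  interpret category C by fact
  interpret E: category "elements_cat C T" using C T by (rule category_elements_cat)
  have "fst (Dom (elements_cat C T) a) = Dom C (fst a)" "fst (Cod (elements_cat C T) a) = Cod C (fst a)"
    if "a \<in> Arr (elements_cat C T)" for a
    using that by (simp_all add: elements_cat_Dom elements_cat_Cod)
  moreover have "fst e \<in> Obj C" if "e \<in> Obj (elements_cat C T)" for e
    using that by (simp add: elements_cat_Obj)
  moreover have "fst a \<in> Arr C" if "a \<in> Arr (elements_cat C T)" for a
    using that by (simp add: elements_cat_Arr)
  moreover have "fst (Ident (elements_cat C T) e) = Ident C (fst e)" if "e \<in> Obj (elements_cat C T)" for e
    using that by (simp add: elements_cat_Ident)
  moreover have "fst (b \<cdot>\<^bsub>elements_cat C T\<^esub> a) = fst b \<cdot>\<^bsub>C\<^esub> fst a"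
    if "a \<in> Arr (elements_cat C T)" "b \<in> Arr (elements_cat C T)"
      "Dom (elements_cat C T) b = Cod (elements_cat C T) a" for a b
    using that by (simp add: elements_cat_Comp)
  ultimately show ?thesis
    by (intro is_functorI) (simp_all add: C E.category_axioms)
qed

locale cwa =
  fixes X :: "('o, 'a, 't) cwa"
  assumes is_cwa: "is_cwa X"
begin

sublocale Ctx: category "Ctx X"
  using is_cwa by (simp add: is_cwa_def)

lemma Ty_functor: "is_functor (op_cat (Ctx X)) set_cat (Ty X)"
  using is_cwa by (simp add: is_cwa_def)

sublocale Ext: functor_between "Elts X" "Ctx X" "Ext X"
  using is_cwa by unfold_locales (simp add: is_cwa_def)

sublocale Pr: natural_transformation "Elts X" "Ctx X" "Ext X" "elements_proj (Ctx X) (Ty X)" "Pr X"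
  using is_cwa by unfold_locales (simp add: is_cwa_def)

lemma Pr_simps [simp]:
  assumes "e \<in> Obj (Elts X)"
  shows "Pr X e \<in> Arr (Ctx X)" "Dom (Ctx X) (Pr X e) = onO (Ext X) e" "Cod (Ctx X) (Pr X e) = fst e"
  using assms Pr.component_Arr Pr.Dom_component Pr.Cod_component by simp_all

lemma Pr_naturality:
  "a \<in> Arr (Elts X) \<Longrightarrow>
    Pr X (Cod (Elts X) a) \<cdot>\<^bsub>Ctx X\<^esub> onA (Ext X) a = fst a \<cdot>\<^bsub>Ctx X\<^esub> Pr X (Dom (Elts X) a)"
  using Pr.naturality[of a] by simp

lemma Elts_fst [simp]:
  "e \<in> Obj (Elts X) \<Longrightarrow> fst e \<in> Obj (Ctx X)"
  "a \<in> Arr (Elts X) \<Longrightarrow> fst a \<in> Arr (Ctx X)"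
  "a \<in> Arr (Elts X) \<Longrightarrow> Dom (Ctx X) (fst a) = fst (Dom (Elts X) a)"
  "a \<in> Arr (Elts X) \<Longrightarrow> Cod (Ctx X) (fst a) = fst (Cod (Elts X) a)"
  by (simp_all add: elements_cat_Obj elements_cat_Arr elements_cat_Dom elements_cat_Cod)

end

lemma elements_functor_simps:
  "e \<in> Obj (Elts X) \<Longrightarrow>
    onO (elements_functor X P) e = (onO (mapF P) (fst e), set_app (mapTy P (fst e)) (snd e))"
  "a \<in> Arr (Elts X) \<Longrightarrow> onA (elements_functor X P) a =
    (onA (mapF P) (fst a), set_app (mapTy P (Cod (Ctx X) (fst a))) (snd a))"
  by (simp_all add: elements_functor_def split_beta)

lemma elements_functor_extensional [simp]:
  "onO (elements_functor X P) \<in> extensional (Obj (Elts X))"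
  "onA (elements_functor X P) \<in> extensional (Arr (Elts X))"
  by (simp_all add: elements_functor_def)

section \<open>Maps of categories with attributes and the functors they induce between categories of
  elements\<close>

locale cwa_premorphism = X: cwa X + Y: cwa Y
  for X :: "('o, 'a, 't) cwa" and Y :: "('o, 'a, 't) cwa" +
  fixes P :: "('o, 'a, 't, 'z) cwa_map_scheme"
  assumes premap: "cwa_premap X Y P"
begin

sublocale F: functor_between "Ctx X" "Ctx Y" "mapF P"
  using premap by unfold_locales (simp add: cwa_premap_def)

lemma nat_trans_mapTy: "nat_trans (op_cat (Ctx X)) set_cat (Ty X)
    (comp_functor (op_cat (Ctx X)) (Ty Y) (mapF P)) (mapTy P)"
  using premap by (simp add: cwa_premap_def)

lemma mapTy_extensional: "mapTy P \<in> extensional (Obj (Ctx X))"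
  using nat_trans_mapTy by (simp add: nat_trans_def)

lemma mapTy_simps [simp]:
  assumes "x \<in> Obj (Ctx X)"
  shows "mapTy P x \<in> Arr set_cat" "fst (mapTy P x) = onO (Ty X) x"
    "snd (snd (mapTy P x)) = onO (Ty Y) (onO (mapF P) x)"
proof -
  interpret T: natural_transformation "op_cat (Ctx X)" set_cat "Ty X"
    "comp_functor (op_cat (Ctx X)) (Ty Y) (mapF P)" "mapTy P"
    by standard (rule nat_trans_mapTy)
  show *: "mapTy P x \<in> Arr set_cat" using assms T.component_Arr by simp
  show "fst (mapTy P x) = onO (Ty X) x" "snd (snd (mapTy P x)) = onO (Ty Y) (onO (mapF P) x)"
    using assms T.Dom_component[of x] T.Cod_component[of x] * by simp_all
qed

lemma mapTy_mem [simp]: "\<lbrakk>x \<in> Obj (Ctx X); A \<in> onO (Ty X) x\<rbrakk> \<Longrightarrow>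
    set_app (mapTy P x) A \<in> onO (Ty Y) (onO (mapF P) x)"
  using set_app_mem[of "mapTy P x" A] by simp

lemma mapTy_subst:
  assumes "f \<in> Arr (Ctx X)" "A \<in> onO (Ty X) (Cod (Ctx X) f)"
  shows "set_app (mapTy P (Dom (Ctx X) f)) (set_app (onA (Ty X) f) A) =
    set_app (onA (Ty Y) (onA (mapF P) f)) (set_app (mapTy P (Cod (Ctx X) f)) A)"
proof -
  interpret T: natural_transformation "op_cat (Ctx X)" set_cat "Ty X"
    "comp_functor (op_cat (Ctx X)) (Ty Y) (mapF P)" "mapTy P"
    by standard (rule nat_trans_mapTy)
  show ?thesis
    using arg_cong[OF T.naturality[of f], of "\<lambda>m. set_app m A"] assms
      presheaf_onA[OF X.Ty_functor, of f] presheaf_onA[OF Y.Ty_functor, of "onA (mapF P) f"]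
    by simp
qed

text \<open>The one clause with content concerns domains: the domain of an arrow carries a reindexed
  type, so its preservation is \<open>mapTy_subst\<close>, the naturality of the action on
  types.\<close>

lemma is_functor_elements_functor: "is_functor (Elts X) (Elts Y) (elements_functor X P)"
proof -
  note [simp] = elements_functor_simps
  let ?el = "elements_functor X P"
  have O: "onO ?el e \<in> Obj (Elts Y)" if "e \<in> Obj (Elts X)" for e
    using that by (simp add: elements_cat_Obj[of _ "Ctx X"] elements_cat_Obj[of _ "Ctx Y"])
  have A: "onA ?el a \<in> Arr (Elts Y)" if "a \<in> Arr (Elts X)" for a
    using that mapTy_mem[of "Cod (Ctx X) (fst a)" "snd a"]
    by (simp add: elements_cat_Arr[of _ "Ctx X"] elements_cat_Arr[of _ "Ctx Y"] del: X.Elts_fst)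
  have D: "Dom (Elts Y) (onA ?el a) = onO ?el (Dom (Elts X) a)"
    and C: "Cod (Elts Y) (onA ?el a) = onO ?el (Cod (Elts X) a)" if a: "a \<in> Arr (Elts X)" for a
  proof -
    have a': "fst a \<in> Arr (Ctx X)" "snd a \<in> onO (Ty X) (Cod (Ctx X) (fst a))"
      using a by (simp_all add: elements_cat_Arr del: X.Elts_fst)
    show "Dom (Elts Y) (onA ?el a) = onO ?el (Dom (Elts X) a)"
      using a' A[OF a] X.Ext.C.Dom_Obj[OF a] mapTy_subst[OF a']
      by (simp add: elements_cat_Dom a del: X.Elts_fst)
    show "Cod (Elts Y) (onA ?el a) = onO ?el (Cod (Elts X) a)"
      using a' A[OF a] X.Ext.C.Cod_Obj[OF a]
      by (simp add: elements_cat_Cod a del: X.Elts_fst)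
  qed
  show ?thesis
  proof (rule is_functorI, goal_cases)
    case (7 e)
    then show ?case
      using X.Ext.C.Ident_Arr[OF 7] O[OF 7]
      by (simp add: elements_cat_Ident)
  next
    case (8 a b)
    then have "Dom (Elts Y) (onA ?el b) = Cod (Elts Y) (onA ?el a)" "fst (Dom (Elts X) b) = fst (Cod (Elts X) a)"
      by (simp_all only: C D)
    with X.Ext.C.Comp_Arr[OF 8] 8 A show ?case
      by (simp add: elements_cat_Comp)
  qed (simp_all add: X.Ext.C.category_axioms Y.Ext.C.category_axioms O A C D
      del: elements_functor_simps)
qed

end

text \<open>The converse of the previous construction. A functor H over F between categories of
  elements acts on types through its second component, and preserving the domain of the arrow
  \<open>(f, A)\<close> is precisely naturality at f, because that domain carries the reindexed
  type. This is how a functor of total categories becomes an action on types.\<close>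

lemma
  assumes X: "is_cwa X" and Y: "is_cwa Y"
    and F: "is_functor (Ctx X) (Ctx Y) (mapF P)" and H: "is_functor (Elts X) (Elts Y) H"
    and HO: "\<And>e. e \<in> Obj (Elts X) \<Longrightarrow> fst (onO H e) = onO (mapF P) (fst e)"
    and HA: "\<And>a. a \<in> Arr (Elts X) \<Longrightarrow> fst (onA H a) = onA (mapF P) (fst a)"
    and mapTy: "mapTy P = (\<lambda>x\<in>Obj (Ctx X).
      (onO (Ty X) x, (\<lambda>A\<in>onO (Ty X) x. snd (onO H (x, A))), onO (Ty Y) (onO (mapF P) x)))"
  shows cwa_premap_of_functor: "cwa_premap X Y P"
    and elements_functor_of_functor: "elements_functor X P = H"
proof -
  interpret X: cwa X by standard fact
  interpret Y: cwa Y by standard fact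
  interpret F: functor_between "Ctx X" "Ctx Y" "mapF P" by standard fact
  interpret H: functor_between "Elts X" "Elts Y" H by standard fact
  have HO_eq: "onO H e = (onO (mapF P) (fst e), snd (onO H e))" if "e \<in> Obj (Elts X)" for e
    using HO[OF that] by (metis prod.collapse)
  \<comment> \<open>An arrow of a category of elements carries the type of its codomain, so on
    arrows the second component of H is fixed by the action on objects.\<close>
  have snd_HA: "snd (onA H a) = snd (onO H (Cod (Elts X) a))" if "a \<in> Arr (Elts X)" for a
    using H.Cod_onA[OF that] elements_cat_Cod[of "onA H a"] H.onA_Arr[OF that] by (metis snd_conv)
  have mem: "snd (onO H (x, A)) \<in> onO (Ty Y) (onO (mapF P) x)"
    if "x \<in> Obj (Ctx X)" "A \<in> onO (Ty X) x" for x A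
    using H.onO_Obj[of "(x, A)"] HO[of "(x, A)"] that by (simp add: elements_cat_Obj)
  have arr: "mapTy P x \<in> Arr set_cat" if "x \<in> Obj (Ctx X)" for x
    using that mem by (simp add: mapTy set_cat_Arr)
  note XT = presheaf_onA[OF X.Ty_functor] and YT = presheaf_onA[OF Y.Ty_functor]
  interpret TX: functor_between "op_cat (Ctx X)" set_cat "Ty X" by standard (rule X.Ty_functor)
  interpret TY: functor_between "op_cat (Ctx Y)" set_cat "Ty Y" by standard (rule Y.Ty_functor)
  have F_op: "is_functor (op_cat (Ctx X)) (op_cat (Ctx Y)) (mapF P)"
    by (rule is_functorI) (simp_all add: TX.C.category_axioms TY.C.category_axioms
        F.onO_extensional F.onA_extensional)
  show "cwa_premap X Y P"
    unfolding cwa_premap_def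
  proof (intro conjI F nat_transI X.Ty_functor is_functor_comp[OF F_op Y.Ty_functor])
    fix f assume "f \<in> Arr (op_cat (Ctx X))"
    then have f: "f \<in> Arr (Ctx X)" by simp
    let ?m = "mapTy P (Dom (Ctx X) f) \<cdot>\<^bsub>set_cat\<^esub> onA (Ty X) f"
      and ?n = "onA (Ty Y) (onA (mapF P) f) \<cdot>\<^bsub>set_cat\<^esub> mapTy P (Cod (Ctx X) f)"
    note [simp] = f XT[OF f] YT[of "onA (mapF P) f"] arr
    have [simp]: "fst (mapTy P x) = onO (Ty X) x" "snd (snd (mapTy P x)) = onO (Ty Y) (onO (mapF P) x)"
      and app: "A \<in> onO (Ty X) x \<Longrightarrow> set_app (mapTy P x) A = snd (onO H (x, A))"
      if "x \<in> Obj (Ctx X)" for x A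
      using that by (simp_all add: mapTy)
    have sub: "set_app (onA (Ty X) f) A \<in> onO (Ty X) (Dom (Ctx X) f)"
      if "A \<in> onO (Ty X) (Cod (Ctx X) f)" for A
      using presheaf_subst(1)[OF X.Ty_functor f that] .
    have "?m = ?n"
    proof (rule set_map_eqI)
      fix A assume "A \<in> fst ?m"
      then have A: "A \<in> onO (Ty X) (Cod (Ctx X) f)" by (simp add: set_cat_Comp)
      have fA: "(f, A) \<in> Arr (Elts X)" using A by (simp add: elements_cat_Arr)
      \<comment> \<open>Comparing the second components of these two domains gives naturality at
        f.\<close>
      have "Dom (Elts Y) (onA H (f, A)) = onO H (Dom (Elts X) (f, A))"
        using fA by simp
      then have "set_app (onA (Ty Y) (onA (mapF P) f)) (snd (onO H (Cod (Ctx X) f, A))) =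
          snd (onO H (Dom (Ctx X) f, set_app (onA (Ty X) f) A))"
        using snd_HA[OF fA] HA[OF fA] H.onA_Arr[OF fA] elements_cat_Dom[OF fA] elements_cat_Cod[OF fA]
        by (simp add: elements_cat_Dom) (metis snd_conv)
      then show "set_app ?m A = set_app ?n A"
        using A sub[OF A] by (simp add: app)
    qed ((rule TX.D.Comp_Arr; simp) | simp add: set_cat_Comp)+
    then show "mapTy P (Cod (op_cat (Ctx X)) f) \<cdot>\<^bsub>set_cat\<^esub> onA (Ty X) f =
         onA (comp_functor (op_cat (Ctx X)) (Ty Y) (mapF P)) f \<cdot>\<^bsub>set_cat\<^esub> mapTy P (Dom (op_cat (Ctx X)) f)"
      by simp
  qed (use arr in \<open>simp_all add: mapTy\<close>)
  note [simp] = elements_functor_simps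
  show "elements_functor X P = H"
  proof (rule functor_eqI[where C = "Elts X"])
    show "onO (elements_functor X P) e = onO H e" if "e \<in> Obj (Elts X)" for e
      using that HO_eq[OF that] by (simp add: mapTy elements_cat_Obj[of e])
    show "onA (elements_functor X P) a = onA H a" if "a \<in> Arr (Elts X)" for a
      using that HA[OF that] snd_HA[OF that] elements_cat_Arr[of a "Ctx X" "Ty X"]
      by (simp add: mapTy prod_eq_iff elements_cat_Cod del: X.Elts_fst)
  qed (simp_all add: H.onO_extensional H.onA_extensional)
qed


locale cwa_morphism = cwa_premorphism X Y P
  for X :: "('o, 'a, 't) cwa" and Y :: "('o, 'a, 't) cwa" and P :: "('o, 'a, 't) cwa_pmap" +
  assumes pseudo_map: "cwa_pseudo_map X Y P"
begin

sublocale el: functor_between "Elts X" "Elts Y" "elements_functor X P"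
  by standard (rule is_functor_elements_functor)

sublocale Iso: natural_transformation "Elts X" "Ctx Y"
  "comp_functor (Elts X) (mapF P) (Ext X)" "comp_functor (Elts X) (Ext Y) (elements_functor X P)"
  "mapIso P"
  using pseudo_map by unfold_locales (simp add: cwa_pseudo_map_def nat_iso_def)

lemma el_simps [simp]:
  "e \<in> Obj (Elts X) \<Longrightarrow> fst (onO (elements_functor X P) e) = onO (mapF P) (fst e)"
  "e \<in> Obj (Elts X) \<Longrightarrow> snd (onO (elements_functor X P) e) = set_app (mapTy P (fst e)) (snd e)"
  "a \<in> Arr (Elts X) \<Longrightarrow> fst (onA (elements_functor X P) a) = onA (mapF P) (fst a)"
  by (simp_all add: elements_functor_simps)

lemma Iso_simps [simp]:
  assumes "e \<in> Obj (Elts X)"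
  shows "mapIso P e \<in> Arr (Ctx Y)" "Dom (Ctx Y) (mapIso P e) = onO (mapF P) (onO (Ext X) e)"
    "Cod (Ctx Y) (mapIso P e) = onO (Ext Y) (onO (elements_functor X P) e)"
    "is_iso (Ctx Y) (mapIso P e)"
  using assms Iso.component_Arr Iso.Dom_component Iso.Cod_component pseudo_map
  by (simp_all add: cwa_pseudo_map_def nat_iso_def)

lemma Iso_naturality: "a \<in> Arr (Elts X) \<Longrightarrow>
    mapIso P (Cod (Elts X) a) \<cdot>\<^bsub>Ctx Y\<^esub> onA (mapF P) (onA (Ext X) a) =
    onA (Ext Y) (onA (elements_functor X P) a) \<cdot>\<^bsub>Ctx Y\<^esub> mapIso P (Dom (Elts X) a)"
  using Iso.naturality[of a] by simp

lemma Pr_Iso: "e \<in> Obj (Elts X) \<Longrightarrow>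
    Pr Y (onO (elements_functor X P) e) \<cdot>\<^bsub>Ctx Y\<^esub> mapIso P e = onA (mapF P) (Pr X e)"
  using pseudo_map by (simp add: cwa_pseudo_map_def)

end

lemma cwa_premorphismI:
  assumes "is_cwa X" "is_cwa Y" "cwa_premap X Y P"
  shows "cwa_premorphism X Y P"
  using assms by (simp add: cwa_premorphism_def cwa_premorphism_axioms_def cwa_def)

lemma cwa_morphismI:
  assumes "is_cwa X" "is_cwa Y" "cwa_pseudo_map X Y P"
  shows "cwa_morphism X Y P"
  using assms by (simp add: cwa_morphism_def cwa_morphism_axioms_def cwa_premorphismI cwa_pseudo_map_def)


section \<open>Discrete fibrations\<close>

locale discrete_fibration =
  fixes T :: "('p, 'b) cat" and C :: "('o, 'a) cat" and p :: "('p, 'b, 'o, 'a) ftor"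
  assumes discrete_fibration: "is_discrete_fibration T C p"
begin

sublocale functor_between T C p
  using discrete_fibration by unfold_locales (simp add: is_discrete_fibration_def)

definition lift :: "'a \<Rightarrow> 'p \<Rightarrow> 'b" where
  "lift f A = (THE u. u \<in> Arr T \<and> Cod T u = A \<and> onA p u = f)"

lemma ex1_lift:
  "\<lbrakk>A \<in> Obj T; f \<in> Arr C; Cod C f = onO p A\<rbrakk> \<Longrightarrow> \<exists>!u. u \<in> Arr T \<and> Cod T u = A \<and> onA p u = f"
  using discrete_fibration by (simp add: is_discrete_fibration_def)

lemma
  assumes "A \<in> Obj T" "f \<in> Arr C" "Cod C f = onO p A"
  shows lift_Arr [simp]: "lift f A \<in> Arr T" and Cod_lift [simp]: "Cod T (lift f A) = A"
    and onA_lift [simp]: "onA p (lift f A) = f"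
  using theI'[OF ex1_lift[OF assms]] unfolding lift_def by blast+

text \<open>The uniqueness half of discreteness, in the form in which equations in T are proved:
  compare codomains and images under p.\<close>

lemma lift_unique:
  assumes "s \<in> Arr T" "t \<in> Arr T" "Cod T s = Cod T t" "onA p s = onA p t"
  shows "s = t"
proof -
  have "\<exists>!z. z \<in> Arr T \<and> Cod T z = Cod T t \<and> onA p z = onA p t"
    by (rule ex1_lift) (use assms in simp_all)
  with assms show ?thesis by blast
qed

text \<open>The factorisation of v through u is the lift of w at the domain of u: its composite with
  u and v itself are lifts of the same arrow to the same object, hence equal. So in the discrete
  case the conditions on cartesian arrows apply to all arrows.\<close>

lemma is_cartesian:
  assumes u: "u \<in> Arr T"
  shows "is_cartesian T C p u"
  unfolding is_cartesian_def
proof (intro conjI ballI impI u)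
  fix v w assume v: "v \<in> Arr T" and "w \<in> hom C (onO p (Dom T v)) (onO p (Dom T u))"
    and vw: "Cod T v = Cod T u \<and> onA p v = onA p u \<cdot>\<^bsub>C\<^esub> w"
  then have w: "w \<in> Arr C" "Dom C w = onO p (Dom T v)" "Cod C w = onO p (Dom T u)"
    by (simp_all add: hom_def)
  let ?z = "lift w (Dom T u)"
  have z: "?z \<in> Arr T" "Cod T ?z = Dom T u" "onA p ?z = w"
    using u w by simp_all
  have uz: "u \<cdot>\<^bsub>T\<^esub> ?z = v"
    by (rule lift_unique) (use u v w vw z in simp_all)
  show "\<exists>!z. z \<in> hom T (Dom T v) (Dom T u) \<and> onA p z = w \<and> u \<cdot>\<^bsub>T\<^esub> z = v"
  proof (rule ex1I[of _ ?z])
    \<comment> \<open>A lift is specified only by its codomain; its domain is found from the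
      composite with u.\<close>
    have "Dom T ?z = Dom T v"
      using u z by (simp flip: uz)
    then show "?z \<in> hom T (Dom T v) (Dom T u) \<and> onA p ?z = w \<and> u \<cdot>\<^bsub>T\<^esub> ?z = v"
      using z uz by (simp add: hom_def)
    show "t = ?z" if "t \<in> hom T (Dom T v) (Dom T u) \<and> onA p t = w \<and> u \<cdot>\<^bsub>T\<^esub> t = v" for t
      by (rule lift_unique) (use that z in \<open>simp_all add: hom_def\<close>)
  qed
qed

lemma is_fibration: "is_fibration T C p"
  unfolding is_fibration_def
proof (intro conjI ballI impI is_functor)
  fix A f assume "A \<in> Obj T" "f \<in> Arr C" "Cod C f = onO p A"
  then show "\<exists>u. is_cartesian T C p u \<and> Cod T u = A \<and> onA p u = f"
    by (intro exI[of _ "lift f A"]) (simp add: is_cartesian)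
qed

end

section \<open>Presentations of discrete comprehension categories\<close>

text \<open>The two structures are independent fields and the total category has types of its own,
  so one CwA can be presented both by codes and by the fibres of a given comprehension category.
  Both directions of the isomorphism are stored, so that no inverse functor has to be
  constructed.\<close>

record ('o, 'a, 't, 'p, 'b) pres =
  attr :: "('o, 'a, 't) cwa"
  cc :: "('o, 'a, 'p, 'b) compcat"
  enc :: "('o \<times> 't, 'a \<times> 't, 'p, 'b) ftor"
  dec :: "('p, 'b, 'o \<times> 't, 'a \<times> 't) ftor"

abbreviation "ctx p \<equiv> Ctx (attr p)"
abbreviation "elts p \<equiv> Elts (attr p)"
abbreviation "tot p \<equiv> Tot (cc p)"

text \<open>Projection and comprehension are computed through \<open>dec\<close>, which moves
  questions about the total category into the category of elements. Bottom sides are absent because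
  in a comprehension category they are the projections of arrows.\<close>

locale presentation =
  fixes p :: "('o, 'a, 't, 'p, 'b) pres"
  assumes is_cwa: "is_cwa (attr p)" and discrete: "is_discrete_compcat (cc p)"
    and Base: "Base (cc p) = ctx p"
    and enc: "is_functor (elts p) (tot p) (enc p)"
    and dec: "is_functor (tot p) (elts p) (dec p)"
    and dec_enc_O [simp]: "e \<in> Obj (elts p) \<Longrightarrow> onO (dec p) (onO (enc p) e) = e"
    and dec_enc_A [simp]: "a \<in> Arr (elts p) \<Longrightarrow> onA (dec p) (onA (enc p) a) = a"
    and enc_dec_O [simp]: "A \<in> Obj (tot p) \<Longrightarrow> onO (enc p) (onO (dec p) A) = A"
    and enc_dec_A [simp]: "u \<in> Arr (tot p) \<Longrightarrow> onA (enc p) (onA (dec p) u) = u"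
    and Proj_O [simp]: "A \<in> Obj (tot p) \<Longrightarrow> onO (Proj (cc p)) A = fst (onO (dec p) A)"
    and Proj_A [simp]: "u \<in> Arr (tot p) \<Longrightarrow> onA (Proj (cc p)) u = fst (onA (dec p) u)"
    and Compr_O [simp]: "A \<in> Obj (tot p) \<Longrightarrow> onO (Compr (cc p)) A = Pr (attr p) (onO (dec p) A)"
    and Compr_A [simp]: "u \<in> Arr (tot p) \<Longrightarrow>
      top_side (onA (Compr (cc p)) u) = onA (Ext (attr p)) (onA (dec p) u)"
begin

sublocale X: cwa "attr p"
  by standard (rule is_cwa)

lemma is_compcat: "is_compcat (cc p)"
  using discrete by (simp add: is_discrete_compcat_def)

sublocale Y: compcat "cc p"
  rewrites "Base (cc p) = ctx p"
  by unfold_locales (simp_all add: is_compcat Base)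

sublocale enc: functor_between "elts p" "tot p" "enc p"
  by standard (rule enc)

sublocale dec: functor_between "tot p" "elts p" "dec p"
  by standard (rule dec)

lemma cartesian:
  assumes "u \<in> Arr (tot p)"
  shows "is_cartesian (tot p) (ctx p) (Proj (cc p)) u"
proof -
  interpret discrete_fibration "tot p" "ctx p" "Proj (cc p)"
    using discrete by unfold_locales (simp add: is_discrete_compcat_def Base)
  show ?thesis using assms by (rule is_cartesian)
qed

end

text \<open>The total functor is the induced functor on elements conjugated by the presentations.
  The comparison at A runs from the projection of the image of A to the image of the projection of
  A, which puts the inverse of \<open>mapIso\<close> on top and an identity at the bottom.\<close>

definition to_cc ::
  "('o, 'a, 't, 'p, 'b) pres \<Rightarrow> ('o, 'a, 't, 'p, 'b) pres \<Rightarrow> ('o, 'a, 't) cwa_pmap \<Rightarrow> ('o, 'a, 'p, 'b) cc_map" where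
  "to_cc p q P =
     \<lparr>ccF = mapF P,
      ccT = comp_functor (tot p) (enc q)
        (comp_functor (tot p) (elements_functor (attr p) P) (dec p)),
      ccIso = (\<lambda>A\<in>Obj (tot p).
        (Pr (attr q) (onO (elements_functor (attr p) P) (onO (dec p) A)),
         (inverse_arr (ctx q) (mapIso P (onO (dec p) A)),
          Ident (ctx q) (onO (mapF P) (fst (onO (dec p) A)))),
         onA (mapF P) (Pr (attr p) (onO (dec p) A))))\<rparr>"

text \<open>Of the conjugated functor on elements only the second component is new; the first is
  \<open>ccF Q\<close>, by strict compatibility with the projections.\<close>

definition from_cc ::
  "('o, 'a, 't, 'p, 'b) pres \<Rightarrow> ('o, 'a, 't, 'p, 'b) pres \<Rightarrow> ('o, 'a, 'p, 'b) cc_map \<Rightarrow> ('o, 'a, 't) cwa_pmap" where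
  "from_cc p q Q =
     \<lparr>mapF = ccF Q,
      mapTy = (\<lambda>x\<in>Obj (ctx p). (onO (Ty (attr p)) x,
        (\<lambda>A\<in>onO (Ty (attr p)) x. snd (onO (dec q) (onO (ccT Q) (onO (enc p) (x, A))))),
        onO (Ty (attr q)) (onO (ccF Q) x))),
      mapIso = (\<lambda>e\<in>Obj (elts p).
        inverse_arr (ctx q) (top_side (ccIso Q (onO (enc p) e))))\<rparr>"

text \<open>Preservation of cartesian arrows is automatic in a discrete target. Commutativity of the
  comparison squares comes from compatibility of \<open>mapIso\<close> with projections, and their
  naturality from that of \<open>mapIso\<close>.\<close>

lemma cc_pseudo_map_to_cc:
  assumes "presentation p" "presentation q" "cwa_pseudo_map (attr p) (attr q) P"
  shows "cc_pseudo_map (cc p) (cc q) (to_cc p q P)"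
proof -
  interpret p: presentation p by fact
  interpret q: presentation q by fact
  interpret P: cwa_morphism "attr p" "attr q" P
    using assms p.is_cwa q.is_cwa by (simp add: cwa_morphismI)
  interpret arr: functor_between "arrow_cat (ctx p)" "arrow_cat (ctx q)" "arrow_functor (ctx p) (mapF P)"
    by standard (rule is_functor_arrow_functor[OF P.F.is_functor])
  let ?T = "to_cc p q P"
  have T: "is_functor (tot p) (tot q) (ccT ?T)"
    by (simp add: to_cc_def is_functor_comp[OF is_functor_comp[OF p.dec.is_functor P.el.is_functor] q.enc.is_functor])
  interpret T: functor_between "tot p" "tot q" "ccT ?T" by standard (rule T)
  have TO [simp]: "onO (dec q) (onO (ccT ?T) A) = onO (elements_functor (attr p) P) (onO (dec p) A)"
    if "A \<in> Obj (tot p)" for A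
    using that by (simp add: to_cc_def)
  have TA [simp]: "onA (dec q) (onA (ccT ?T) u) = onA (elements_functor (attr p) P) (onA (dec p) u)"
    if "u \<in> Arr (tot p)" for u
    using that by (simp add: to_cc_def)
  have F [simp]: "ccF ?T = mapF P" by (simp add: to_cc_def)
  have iso [simp]: "ccIso ?T A = (Pr (attr q) (onO (elements_functor (attr p) P) (onO (dec p) A)),
         (inverse_arr (ctx q) (mapIso P (onO (dec p) A)),
          Ident (ctx q) (onO (mapF P) (fst (onO (dec p) A)))),
         onA (mapF P) (Pr (attr p) (onO (dec p) A)))" if "A \<in> Obj (tot p)" for A
    using that by (simp add: to_cc_def)
  \<comment> \<open>Compatibility with projections, composed with the inverse of
    \<open>mapIso\<close>, is commutativity of the comparison square.\<close>
  have iso_Arr: "ccIso ?T A \<in> Arr (arrow_cat (ctx q))" if "A \<in> Obj (tot p)" for A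
    using that P.Pr_Iso[of "onO (dec p) A", symmetric]
    by (simp add: arrow_cat_Arr q.X.Ctx.assoc)
  show ?thesis
    unfolding cc_pseudo_map_def p.Base q.Base nat_iso_def
  proof (intro conjI allI impI ballI nat_transI T is_functor_comp[OF T q.Y.Compr.is_functor]
      is_functor_comp[OF p.Y.Compr.is_functor arr.is_functor])
    show "comp_functor (tot p) (Proj (cc q)) (ccT ?T) = comp_functor (tot p) (ccF ?T) (Proj (cc p))"
      by (rule comp_functor_eqI) simp_all
    show "is_cartesian (tot q) (ctx q) (Proj (cc q)) (onA (ccT ?T) u)"
      if "is_cartesian (tot p) (ctx p) (Proj (cc p)) u" for u
      using that by (intro q.cartesian) (simp add: is_cartesian_def)
    show "ccIso ?T \<in> extensional (Obj (tot p))"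
      by (simp add: to_cc_def)
    fix A assume A: "A \<in> Obj (tot p)"
    show "ccIso ?T A \<in> Arr (arrow_cat (ctx q))" by (rule iso_Arr[OF A])
    then show "Dom (arrow_cat (ctx q)) (ccIso ?T A) =
          onO (comp_functor (tot p) (Compr (cc q)) (ccT ?T)) A"
      "Cod (arrow_cat (ctx q)) (ccIso ?T A) =
          onO (comp_functor (tot p) (arrow_functor (ctx p) (ccF ?T)) (Compr (cc p))) A"
      using A by simp_all
    show "is_iso (arrow_cat (ctx q)) (ccIso ?T A)"
      by (rule q.X.Ctx.is_iso_square(1)[OF iso_Arr[OF A]]) (use A in simp_all)
    show "bot_side (ccIso ?T A) = Ident (ctx q) (onO (ccF ?T) (onO (Proj (cc p)) A))"
      using A by simp
  next
    fix u assume u: "u \<in> Arr (tot p)"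
    note m = iso_Arr[OF p.Y.Proj.C.Dom_Obj[OF u]] iso_Arr[OF p.Y.Proj.C.Cod_Obj[OF u]]
    let ?a = "onA (dec p) u"
    \<comment> \<open>Naturality of \<open>mapIso\<close> in inverted form: the top side of the
      naturality equation between squares.\<close>
    have "onA (mapF P) (onA (Ext (attr p)) ?a) \<cdot>\<^bsub>ctx q\<^esub>
        inverse_arr (ctx q) (mapIso P (Dom (elts p) ?a)) =
      inverse_arr (ctx q) (mapIso P (Cod (elts p) ?a)) \<cdot>\<^bsub>ctx q\<^esub>
        onA (Ext (attr q)) (onA (elements_functor (attr p) P) ?a)"
      by (rule q.X.Ctx.inverse_arr_square[THEN iffD1, OF _ _ _ _ _ _ _ _ P.Iso_naturality])
        (use u in \<open>simp_all\<close>)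
    moreover have "onA (arrow_functor (ctx p) (mapF P)) (onA (Compr (cc p)) u) \<in> Arr (arrow_cat (ctx q))"
      using u by (simp del: arrow_functor_simps)
    moreover have "onA (Compr (cc q)) (onA (ccT ?T) u) \<in> Arr (arrow_cat (ctx q))"
      using u by simp
    ultimately show "ccIso ?T (Cod (tot p) u) \<cdot>\<^bsub>arrow_cat (ctx q)\<^esub>
         onA (comp_functor (tot p) (Compr (cc q)) (ccT ?T)) u =
         onA (comp_functor (tot p) (arrow_functor (ctx p) (ccF ?T)) (Compr (cc p))) u
         \<cdot>\<^bsub>arrow_cat (ctx q)\<^esub> ccIso ?T (Dom (tot p) u)"
      using u m by simp
  qed (use is_functor_comp[OF p.Y.Compr.is_functor arr.is_functor] in \<open>simp_all add: P.F.is_functor\<close>)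
qed

text \<open>The functor on elements induced by \<open>from_cc\<close> is the conjugate of
  \<open>ccT Q\<close>, since a functor over the base functor is recovered from its action on types.
  All conditions on a pseudo map of CwA's can then be read off from the comprehension side.\<close>

lemma
  assumes "presentation p" "presentation q" and Q: "cc_pseudo_map (cc p) (cc q) Q"
  shows cwa_pseudo_map_from_cc: "cwa_pseudo_map (attr p) (attr q) (from_cc p q Q)"
    and elements_functor_from_cc: "elements_functor (attr p) (from_cc p q Q) =
      comp_functor (elts p) (dec q) (comp_functor (elts p) (ccT Q) (enc p))"
proof -
  interpret p: presentation p by fact
  interpret q: presentation q by fact
  interpret Q: cc_morphism "cc p" "cc q" Q
    rewrites "Base (cc p) = ctx p" and "Base (cc q) = ctx q"
    using p.is_compcat q.is_compcat Q by (auto simp: cc_morphismI p.Base q.Base)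
  let ?P = "from_cc p q Q" and ?H = "comp_functor (elts p) (dec q) (comp_functor (elts p) (ccT Q) (enc p))"
  have H: "is_functor (elts p) (elts q) ?H"
    by (intro is_functor_comp[OF is_functor_comp[OF p.enc.is_functor Q.T.is_functor] q.dec.is_functor])
  interpret H: functor_between "elts p" "elts q" ?H by standard (rule H)
  have F [simp]: "mapF ?P = ccF Q" by (simp add: from_cc_def)
  have HO: "fst (onO ?H e) = onO (ccF Q) (fst e)" if "e \<in> Obj (elts p)" for e
    using that Q.Proj_T(1)[of "onO (enc p) e"] by simp
  have HA: "fst (onA ?H a) = onA (ccF Q) (fst a)" if "a \<in> Arr (elts p)" for a
    using that Q.Proj_T(2)[of "onA (enc p) a"] by simp
  have mapTy: "mapTy ?P = (\<lambda>x\<in>Obj (ctx p).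
      (onO (Ty (attr p)) x, (\<lambda>A\<in>onO (Ty (attr p)) x. snd (onO ?H (x, A))),
       onO (Ty (attr q)) (onO (mapF ?P) x)))"
    by (auto simp: from_cc_def elements_cat_Obj intro!: restrict_ext)
  have FP: "is_functor (ctx p) (ctx q) (mapF ?P)"
    by (simp add: Q.F.is_functor)
  note * = p.is_cwa q.is_cwa FP H HO[folded F] HA[folded F] mapTy
  have pre: "cwa_premap (attr p) (attr q) ?P"
    by (rule cwa_premap_of_functor[OF *])
  show el: "elements_functor (attr p) ?P = ?H"
    by (rule elements_functor_of_functor[OF *])
  have iso [simp]: "mapIso ?P e = inverse_arr (ctx q) (top_side (ccIso Q (onO (enc p) e)))"
    if "e \<in> Obj (elts p)" for e
    using that by (simp add: from_cc_def)
  have top [simp]: "top_side (ccIso Q (onO (enc p) e)) \<in> Arr (ctx q)"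
    "Dom (ctx q) (top_side (ccIso Q (onO (enc p) e))) = onO (Ext (attr q)) (onO ?H e)"
    "Cod (ctx q) (top_side (ccIso Q (onO (enc p) e))) = onO (ccF Q) (onO (Ext (attr p)) e)"
    if "e \<in> Obj (elts p)" for e
    using that Q.Iso_square[of "onO (enc p) e"] by simp_all
  show "cwa_pseudo_map (attr p) (attr q) ?P"
    unfolding cwa_pseudo_map_def nat_iso_def el
  proof (intro conjI pre nat_transI ballI is_functor_comp[OF p.X.Ext.is_functor FP]
      is_functor_comp[OF H q.X.Ext.is_functor])
    show "mapIso ?P \<in> extensional (Obj (elts p))"
      by (simp add: from_cc_def)
    fix e assume e: "e \<in> Obj (elts p)"
    show "is_iso (ctx q) (mapIso ?P e)" "mapIso ?P e \<in> Arr (ctx q)"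
      "Dom (ctx q) (mapIso ?P e) = onO (comp_functor (elts p) (mapF ?P) (Ext (attr p))) e"
      "Cod (ctx q) (mapIso ?P e) = onO (comp_functor (elts p) (Ext (attr q)) ?H) e"
      using e by simp_all
    let ?t = "top_side (ccIso Q (onO (enc p) e))"
    \<comment> \<open>Commutativity of the comparison square, whose bottom side is an
      identity.\<close>
    have eq: "onA (ccF Q) (Pr (attr p) e) \<cdot>\<^bsub>ctx q\<^esub> ?t = Pr (attr q) (onO ?H e)"
      using e arrow_cat_commutes[OF Q.Iso_square(1)[of "onO (enc p) e"]] HO[OF e] by simp
    show "Pr (attr q) (onO ?H e) \<cdot>\<^bsub>ctx q\<^esub> mapIso ?P e = onA (mapF ?P) (Pr (attr p) e)"
      unfolding eq[symmetric] using e by (simp add: q.X.Ctx.assoc)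
  next
    fix a assume a: "a \<in> Arr (elts p)"
    show "mapIso ?P (Cod (elts p) a) \<cdot>\<^bsub>ctx q\<^esub>
         onA (comp_functor (elts p) (mapF ?P) (Ext (attr p))) a =
         onA (comp_functor (elts p) (Ext (attr q)) ?H) a \<cdot>\<^bsub>ctx q\<^esub>
         mapIso ?P (Dom (elts p) a)"
    proof -
      let ?t = "\<lambda>e. top_side (ccIso Q (onO (enc p) e))"
      have "?t (Cod (elts p) a) \<cdot>\<^bsub>ctx q\<^esub> onA (Ext (attr q)) (onA ?H a) =
          onA (ccF Q) (onA (Ext (attr p)) a) \<cdot>\<^bsub>ctx q\<^esub> ?t (Dom (elts p) a)"
        using a Q.Iso_naturality[of "onA (enc p) a"] by simp
      from q.X.Ctx.inverse_arr_square[THEN iffD1, OF _ _ _ _ _ _ _ _ this]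
      show ?thesis using a by simp
    qed
  qed
qed

text \<open>The conjugations cancel, and the comparison is inverted twice.\<close>

lemma from_cc_to_cc:
  assumes "presentation p" "presentation q" and P: "cwa_pseudo_map (attr p) (attr q) P"
  shows "from_cc p q (to_cc p q P) = P"
proof -
  interpret p: presentation p by fact
  interpret q: presentation q by fact
  interpret P: cwa_morphism "attr p" "attr q" P
    using assms p.is_cwa q.is_cwa by (simp add: cwa_morphismI)
  have [simp]: "ccF (to_cc p q P) = mapF P" by (simp add: to_cc_def)
  have "mapTy (from_cc p q (to_cc p q P)) x = mapTy P x" if x: "x \<in> Obj (ctx p)" for x
  proof (rule set_map_eqI)
    have T: "snd (onO (dec q) (onO (ccT (to_cc p q P)) (onO (enc p) (x, A)))) = set_app (mapTy P x) A"
      if "A \<in> onO (Ty (attr p)) x" for A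
    proof -
      have "(x, A) \<in> Obj (elts p)" using x that by (simp add: elements_cat_Obj)
      then show ?thesis by (simp add: to_cc_def)
    qed
    show "mapTy (from_cc p q (to_cc p q P)) x \<in> Arr set_cat"
      using x by (auto simp: from_cc_def set_cat_Arr T)
    show "set_app (mapTy (from_cc p q (to_cc p q P)) x) A = set_app (mapTy P x) A"
      if "A \<in> fst (mapTy (from_cc p q (to_cc p q P)) x)" for A
      using that x by (simp add: from_cc_def T)
  qed (use x in \<open>simp_all add: from_cc_def\<close>)
  then have "mapTy (from_cc p q (to_cc p q P)) = mapTy P"
    by (intro extensionalityI[of _ "Obj (ctx p)"] P.mapTy_extensional) (simp_all add: from_cc_def)
  moreover have "mapIso (from_cc p q (to_cc p q P)) = mapIso P"
    by (intro extensionalityI[of _ "Obj (elts p)"] P.Iso.component_extensional)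
      (simp_all add: from_cc_def to_cc_def)
  ultimately show ?thesis
    by (intro cwa_pmap.equality) (simp_all, simp add: from_cc_def to_cc_def)
qed

lemma to_cc_from_cc:
  assumes "presentation p" "presentation q" and Q: "cc_pseudo_map (cc p) (cc q) Q"
  shows "to_cc p q (from_cc p q Q) = Q"
proof -
  interpret p: presentation p by fact
  interpret q: presentation q by fact
  interpret Q: cc_morphism "cc p" "cc q" Q
    rewrites "Base (cc p) = ctx p" and "Base (cc q) = ctx q"
    using p.is_compcat q.is_compcat Q by (auto simp: cc_morphismI p.Base q.Base)
  note el = elements_functor_from_cc[OF assms]
  show ?thesis
  proof (rule cc_map.equality)
    show "ccF (to_cc p q (from_cc p q Q)) = ccF Q"
      by (simp add: to_cc_def from_cc_def)
    show "ccT (to_cc p q (from_cc p q Q)) = ccT Q"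
      unfolding to_cc_def el
      by (rule functor_eqI[where C = "tot p"]) (simp_all add: Q.T.onO_extensional Q.T.onA_extensional)
    show "ccIso (to_cc p q (from_cc p q Q)) = ccIso Q"
    proof (rule extensionalityI[where A = "Obj (tot p)"])
      show "ccIso (to_cc p q (from_cc p q Q)) A = ccIso Q A" if "A \<in> Obj (tot p)" for A
        unfolding to_cc_def el
        using that by (simp add: square_eq_iff[of _ "ccIso Q A"] from_cc_def)
    qed (simp_all add: to_cc_def Q.Iso.component_extensional)
  qed simp
qed


text \<open>The formula defining composition of pseudo maps of CwA's is composition of comprehension
  categories read back through the correspondence. This one computation yields both that such
  composites are pseudo maps and that \<open>to_cc\<close> preserves them.\<close>

lemma from_cc_cc_comp:
  assumes pqr: "presentation p" "presentation q" "presentation r"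
    and P: "cwa_pseudo_map (attr p) (attr q) P" and Q: "cwa_pseudo_map (attr q) (attr r) Q"
  shows "from_cc p r (cc_comp (cc p) (cc q) (cc r) (to_cc q r Q) (to_cc p q P)) =
    cwa_comp (attr p) (attr r) Q P"
proof -
  interpret p: presentation p by fact
  interpret q: presentation q by fact
  interpret r: presentation r by fact
  interpret P: cwa_morphism "attr p" "attr q" P
    using P p.is_cwa q.is_cwa by (simp add: cwa_morphismI)
  interpret Q: cwa_morphism "attr q" "attr r" Q
    using Q q.is_cwa r.is_cwa by (simp add: cwa_morphismI)
  note simps = cc_comp_simps[OF p.is_compcat q.is_compcat r.is_compcat
      cc_pseudo_map_to_cc[OF pqr(1,2) P] cc_pseudo_map_to_cc[OF pqr(2,3) Q], unfolded p.Base q.Base r.Base]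
  let ?R = "cc_comp (cc p) (cc q) (cc r) (to_cc q r Q) (to_cc p q P)"
  have F [simp]: "ccF (to_cc p q P) = mapF P" "ccF (to_cc q r Q) = mapF Q"
    by (simp_all add: to_cc_def)
  show ?thesis
  proof (rule cwa_pmap.equality)
    show "mapF (from_cc p r ?R) = mapF (cwa_comp (attr p) (attr r) Q P)"
      by (simp add: from_cc_def cwa_comp_def simps)
    show "mapTy (from_cc p r ?R) = mapTy (cwa_comp (attr p) (attr r) Q P)"
    proof (rule extensionalityI[where A = "Obj (ctx p)"])
      fix x assume x: "x \<in> Obj (ctx p)"
      have "snd (onO (dec r) (onO (ccT ?R) (onO (enc p) (x, A)))) =
          set_app (mapTy Q (onO (mapF P) x)) (set_app (mapTy P x) A)"
        if "A \<in> onO (Ty (attr p)) x" for A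
      proof -
        have e: "(x, A) \<in> Obj (elts p)" using x that by (simp add: elements_cat_Obj)
        then show ?thesis
          by (simp add: simps(2)) (simp add: to_cc_def)
      qed
      then show "mapTy (from_cc p r ?R) x = mapTy (cwa_comp (attr p) (attr r) Q P) x"
        using x by (auto simp: from_cc_def cwa_comp_def set_cat_Comp simps(1) compose_def intro!: restrict_ext)
    qed (simp_all add: from_cc_def cwa_comp_def)
    show "mapIso (from_cc p r ?R) = mapIso (cwa_comp (attr p) (attr r) Q P)"
    proof (rule extensionalityI[where A = "Obj (elts p)"])
      fix e assume e: "e \<in> Obj (elts p)"
      let ?e' = "onO (elements_functor (attr p) P) e"
      \<comment> \<open>Inverting this composite reverses the order of the factors and passes
        through the functor Q, leaving the comparison of \<open>cwa_comp\<close>.\<close>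
      have "top_side (ccIso ?R (onO (enc p) e)) =
          onA (mapF Q) (inverse_arr (ctx q) (mapIso P e)) \<cdot>\<^bsub>ctx r\<^esub>
          inverse_arr (ctx r) (mapIso Q ?e')"
        using e by (simp add: simps(3)) (simp add: to_cc_def)
      then show "mapIso (from_cc p r ?R) e = mapIso (cwa_comp (attr p) (attr r) Q P) e"
        using e by (simp add: from_cc_def cwa_comp_def r.X.Ctx.inverse_arr_of_Comp Q.F.onA_inverse_arr)
    qed (simp_all add: from_cc_def cwa_comp_def)
  qed simp
qed

lemma from_cc_cc_id:
  assumes "presentation p"
  shows "from_cc p p (cc_id (cc p)) = cwa_id (attr p)"
proof -
  interpret p: presentation p by fact
  show ?thesis
  proof (rule cwa_pmap.equality)
    show "mapF (from_cc p p (cc_id (cc p))) = mapF (cwa_id (attr p))"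
      by (simp add: from_cc_def cwa_id_def p.Base)
    show "mapTy (from_cc p p (cc_id (cc p))) = mapTy (cwa_id (attr p))"
      by (auto simp: from_cc_def cwa_id_def p.Base set_cat_Ident elements_cat_Obj intro!: restrict_ext)
    show "mapIso (from_cc p p (cc_id (cc p))) = mapIso (cwa_id (attr p))"
      by (auto simp: from_cc_def cwa_id_def cc_id_def p.Base intro!: restrict_ext)
  qed simp
qed

lemma
  assumes "presentation p"
  shows cwa_pseudo_map_cwa_id: "cwa_pseudo_map (attr p) (attr p) (cwa_id (attr p))"
    and to_cc_cwa_id: "to_cc p p (cwa_id (attr p)) = cc_id (cc p)"
proof -
  interpret presentation p by fact
  note id = cc_pseudo_map_cc_id[OF is_compcat]
  show "cwa_pseudo_map (attr p) (attr p) (cwa_id (attr p))"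
    using cwa_pseudo_map_from_cc[OF assms assms id] by (simp add: from_cc_cc_id[OF assms])
  show "to_cc p p (cwa_id (attr p)) = cc_id (cc p)"
    using to_cc_from_cc[OF assms assms id] by (simp add: from_cc_cc_id[OF assms])
qed

text \<open>Both claims are formal: \<open>from_cc\<close> produces pseudo maps,
  \<open>to_cc\<close> undoes it, and the composite is a value of \<open>from_cc\<close>.\<close>

lemma
  assumes pqr: "presentation p" "presentation q" "presentation r"
    and P: "cwa_pseudo_map (attr p) (attr q) P" and Q: "cwa_pseudo_map (attr q) (attr r) Q"
  shows cwa_pseudo_map_cwa_comp: "cwa_pseudo_map (attr p) (attr r) (cwa_comp (attr p) (attr r) Q P)"
    and to_cc_cwa_comp: "to_cc p r (cwa_comp (attr p) (attr r) Q P) =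
      cc_comp (cc p) (cc q) (cc r) (to_cc q r Q) (to_cc p q P)"
proof -
  note R = cc_pseudo_map_cc_comp[OF pqr[THEN presentation.is_compcat]
      cc_pseudo_map_to_cc[OF pqr(1,2) P] cc_pseudo_map_to_cc[OF pqr(2,3) Q]]
  show "cwa_pseudo_map (attr p) (attr r) (cwa_comp (attr p) (attr r) Q P)"
    using cwa_pseudo_map_from_cc[OF pqr(1,3) R] by (simp add: from_cc_cc_comp[OF assms])
  show "to_cc p r (cwa_comp (attr p) (attr r) Q P) =
      cc_comp (cc p) (cc q) (cc r) (to_cc q r Q) (to_cc p q P)"
    using to_cc_from_cc[OF pqr(1,3) R] by (simp add: from_cc_cc_comp[OF assms])
qed

text \<open>
  By symmetry, the identity induces mutually inverse maps between any two presentations of the same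
  category with attributes; this gives essential surjectivity on objects.
\<close>

lemma to_cc_cwa_id_inverse:
  assumes pq: "presentation p" "presentation q" and eq: "attr p = attr q"
  shows "cc_comp (cc p) (cc q) (cc p) (to_cc q p (cwa_id (attr p))) (to_cc p q (cwa_id (attr p))) =
    cc_id (cc p)"
proof -
  interpret presentation p by fact
  note id = cc_pseudo_map_cc_id[OF is_compcat]
  note i = cwa_pseudo_map_cwa_id[OF pq(1)] and t = to_cc_cwa_id[OF pq(1)]
  \<comment> \<open>The unit law for CwA's is imported from the comprehension side, where
    \<open>cwa_id\<close> becomes \<open>cc_id\<close>.\<close>
  have "cwa_comp (attr p) (attr p) (cwa_id (attr p)) (cwa_id (attr p)) = cwa_id (attr p)"
    using from_cc_cc_comp[OF pq(1,1,1) i i]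
    by (simp add: t cc_comp_cc_id_left[OF is_compcat is_compcat id] from_cc_cc_id[OF pq(1)])
  then show ?thesis
    using to_cc_cwa_comp[OF pq(1,2,1), folded eq, OF i i] t by simp
qed


subsection \<open>Transformations\<close>

text \<open>The pair is the unique arrow of the category of elements over the component of \<alpha>
  that ends in the image of A under Q; \<open>enc\<close> moves it to the total category.\<close>

definition total_part ::
  "('o, 'a, 't, 'p, 'b) pres \<Rightarrow> ('o, 'a, 't, 'p, 'b) pres \<Rightarrow> ('o, 'a, 't) cwa_pmap \<Rightarrow> ('o \<Rightarrow> 'a) \<Rightarrow> 'p \<Rightarrow> 'b" where
  "total_part p q Q \<alpha> = (\<lambda>A\<in>Obj (tot p). onA (enc q)
     (\<alpha> (fst (onO (dec p) A)), snd (onO (elements_functor (attr p) Q) (onO (dec p) A))))"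

lemma cwa_transformation_iff:
  "cwa_transformation X Y P Q \<alpha> \<longleftrightarrow>
     nat_trans (Ctx X) (Ctx Y) (mapF P) (mapF Q) \<alpha> \<and>
     (\<forall>e\<in>Obj (Elts X).
        set_app (onA (Ty Y) (\<alpha> (fst e))) (snd (onO (elements_functor X Q) e)) =
          snd (onO (elements_functor X P) e) \<and>
        mapIso Q e \<cdot>\<^bsub>Ctx Y\<^esub> \<alpha> (onO (Ext X) e) =
        onA (Ext Y) (\<alpha> (fst e), snd (onO (elements_functor X Q) e)) \<cdot>\<^bsub>Ctx Y\<^esub> mapIso P e)"
  by (auto simp: cwa_transformation_def elements_functor_simps split_beta)

text \<open>The condition on types says precisely that the lift of \<alpha> ending in the image
  under Q starts in the image under P. The lifts are natural because arrows of a category of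
  elements are determined by base part and codomain, and the condition on comparisons is the
  required one with both isomorphisms inverted.\<close>

lemma cc_transformation_to_cc:
  assumes pq: "presentation p" "presentation q"
    and P: "cwa_pseudo_map (attr p) (attr q) P" and Q: "cwa_pseudo_map (attr p) (attr q) Q"
    and \<alpha>: "cwa_transformation (attr p) (attr q) P Q \<alpha>"
  shows "cc_transformation (cc p) (cc q) (to_cc p q P) (to_cc p q Q) (\<alpha>, total_part p q Q \<alpha>)"
proof -
  interpret p: presentation p by fact
  interpret q: presentation q by fact
  interpret P: cwa_morphism "attr p" "attr q" P
    using P p.is_cwa q.is_cwa by (simp add: cwa_morphismI)
  interpret Q: cwa_morphism "attr p" "attr q" Q
    using Q p.is_cwa q.is_cwa by (simp add: cwa_morphismI)
  interpret \<alpha>: natural_transformation "ctx p" "ctx q" "mapF P" "mapF Q" \<alpha>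
    using \<alpha> by unfold_locales (simp add: cwa_transformation_iff)
  have compat: "set_app (onA (Ty (attr q)) (\<alpha> (fst e))) (snd (onO (elements_functor (attr p) Q) e)) =
      snd (onO (elements_functor (attr p) P) e)"
    "mapIso Q e \<cdot>\<^bsub>ctx q\<^esub> \<alpha> (onO (Ext (attr p)) e) =
      onA (Ext (attr q)) (\<alpha> (fst e), snd (onO (elements_functor (attr p) Q) e)) \<cdot>\<^bsub>ctx q\<^esub> mapIso P e"
    if "e \<in> Obj (elts p)" for e
    using \<alpha> that unfolding cwa_transformation_iff by blast+
  define \<beta> where "\<beta> = (\<lambda>e\<in>Obj (elts p). (\<alpha> (fst e), snd (onO (elements_functor (attr p) Q) e)))"
  have \<beta>: "\<beta> e = (\<alpha> (fst e), snd (onO (elements_functor (attr p) Q) e))" "\<beta> e \<in> Arr (elts q)"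
    "Dom (elts q) (\<beta> e) = onO (elements_functor (attr p) P) e"
    "Cod (elts q) (\<beta> e) = onO (elements_functor (attr p) Q) e"
    if e: "e \<in> Obj (elts p)" for e
  proof -
    show eq: "\<beta> e = (\<alpha> (fst e), snd (onO (elements_functor (attr p) Q) e))"
      using e by (simp add: \<beta>_def)
    show arr: "\<beta> e \<in> Arr (elts q)"
      using e Q.el.onO_Obj[OF e] by (simp add: eq elements_cat_Arr elements_cat_Obj[of _ "ctx q"])
    show "Dom (elts q) (\<beta> e) = onO (elements_functor (attr p) P) e"
      "Cod (elts q) (\<beta> e) = onO (elements_functor (attr p) Q) e"
      unfolding elements_cat_Dom[OF arr] elements_cat_Cod[OF arr]
      using e compat(1)[OF e] by (simp_all add: eq prod_eq_iff)
  qed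
  have "nat_trans (elts p) (elts q) (elements_functor (attr p) P) (elements_functor (attr p) Q) \<beta>"
  proof (rule nat_transI)
    fix a assume a: "a \<in> Arr (elts p)"
    \<comment> \<open>The two composites of the naturality square carry the type of their common
      codomain; their base parts agree by naturality of \<alpha>.\<close>
    have "snd (onA (elements_functor (attr p) Q) a) = snd (onO (elements_functor (attr p) Q) (Cod (elts p) a))"
      using Q.el.Cod_onA[OF a] elements_cat_Cod[OF Q.el.onA_Arr[OF a]] by (metis snd_conv)
    then show "\<beta> (Cod (elts p) a) \<cdot>\<^bsub>elts q\<^esub> onA (elements_functor (attr p) P) a =
        onA (elements_functor (attr p) Q) a \<cdot>\<^bsub>elts q\<^esub> \<beta> (Dom (elts p) a)"
      using a \<alpha>.naturality[of "fst a"]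
      by (simp add: elements_cat_Comp \<beta>(2-4)) (simp add: \<beta>(1))
  qed (use \<beta>(2-4) in \<open>simp_all add: P.el.is_functor Q.el.is_functor, simp add: \<beta>_def\<close>)
  \<comment> \<open>Whiskering the lift with \<open>dec p\<close> and \<open>enc q\<close> gives
    \<open>total_part\<close>.\<close>
  from nat_trans_whisker_left[OF nat_trans_whisker_right[OF this p.dec.is_functor] q.enc.is_functor]
  have "nat_trans (tot p) (tot q) (ccT (to_cc p q P)) (ccT (to_cc p q Q)) (total_part p q Q \<alpha>)"
    by (simp add: to_cc_def total_part_def \<beta>(1) cong: restrict_cong)
  moreover have t: "total_part p q Q \<alpha> A = onA (enc q) (\<beta> (onO (dec p) A))" if "A \<in> Obj (tot p)" for A
    using that by (simp add: total_part_def \<beta>(1))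
  moreover have "inverse_arr (ctx q) (mapIso Q e) \<cdot>\<^bsub>ctx q\<^esub> onA (Ext (attr q)) (\<beta> e) =
      \<alpha> (onO (Ext (attr p)) e) \<cdot>\<^bsub>ctx q\<^esub> inverse_arr (ctx q) (mapIso P e)"
    if e: "e \<in> Obj (elts p)" for e
    using compat(2)[OF e, folded \<beta>(1)[OF e]] \<beta>(2-4)[OF e] e
    by (subst (asm) q.X.Ctx.inverse_arr_square) simp_all
  ultimately show ?thesis
    using \<beta>(2-4)
    by (simp add: cc_transformation_def p.Base q.Base) (simp add: to_cc_def \<alpha>.nat_trans \<beta>(1))
qed

text \<open>Decoded, the total component at A has base part \<alpha> and ends in the image under Q,
  which leaves a single possibility. Its domain then yields the condition on types, so \<alpha>
  alone determines the whole transformation.\<close>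

lemma
  assumes pq: "presentation p" "presentation q"
    and P: "cc_pseudo_map (cc p) (cc q) P" and Q: "cc_pseudo_map (cc p) (cc q) Q"
    and \<alpha>: "cc_transformation (cc p) (cc q) P Q (\<alpha>, \<alpha>')"
  shows cwa_transformation_from_cc:
      "cwa_transformation (attr p) (attr q) (from_cc p q P) (from_cc p q Q) \<alpha>"
    and total_part_from_cc: "total_part p q (from_cc p q Q) \<alpha> = \<alpha>'"
proof -
  interpret p: presentation p by fact
  interpret q: presentation q by fact
  interpret \<alpha>: cc_transf "cc p" "cc q" P Q \<alpha> \<alpha>'
    rewrites "Base (cc p) = ctx p" and "Base (cc q) = ctx q"
    using p.is_compcat q.is_compcat assms by (auto simp: cc_transfI p.Base q.Base)
  note elP = elements_functor_from_cc[OF pq P] and elQ = elements_functor_from_cc[OF pq Q]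
  let ?HP = "comp_functor (elts p) (dec q) (comp_functor (elts p) (ccT P) (enc p))"
  let ?HQ = "comp_functor (elts p) (dec q) (comp_functor (elts p) (ccT Q) (enc p))"
  have \<beta>: "onA (dec q) (\<alpha>' (onO (enc p) e)) = (\<alpha> (fst e), snd (onO ?HQ e))"
    "set_app (onA (Ty (attr q)) (\<alpha> (fst e))) (snd (onO ?HQ e)) = snd (onO ?HP e)"
    if e: "e \<in> Obj (elts p)" for e
  proof -
    let ?b = "onA (dec q) (\<alpha>' (onO (enc p) e))"
    have b: "?b \<in> Arr (elts q)" using e by simp
    have fst: "fst ?b = \<alpha> (fst e)" using e \<alpha>.Proj_component[of "onO (enc p) e"] by simp
    have "Cod (elts q) ?b = onO ?HQ e" "Dom (elts q) ?b = onO ?HP e"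
      using e by simp_all
    then have snd: "snd ?b = snd (onO ?HQ e)"
      and dom: "set_app (onA (Ty (attr q)) (fst ?b)) (snd ?b) = snd (onO ?HP e)"
      using elements_cat_Cod[OF b] elements_cat_Dom[OF b] by (metis snd_conv)+
    show "?b = (\<alpha> (fst e), snd (onO ?HQ e))"
      using fst snd by (simp add: prod_eq_iff)
    show "set_app (onA (Ty (attr q)) (\<alpha> (fst e))) (snd (onO ?HQ e)) = snd (onO ?HP e)"
      using dom by (simp only: fst snd)
  qed
  show "cwa_transformation (attr p) (attr q) (from_cc p q P) (from_cc p q Q) \<alpha>"
    unfolding cwa_transformation_iff elP elQ
  proof (intro conjI ballI)
    show "nat_trans (ctx p) (ctx q) (mapF (from_cc p q P)) (mapF (from_cc p q Q)) \<alpha>"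
      using \<alpha>.base.nat_trans by (simp add: from_cc_def)
    fix e assume e: "e \<in> Obj (elts p)"
    show "set_app (onA (Ty (attr q)) (\<alpha> (fst e))) (snd (onO ?HQ e)) = snd (onO ?HP e)"
      by (rule \<beta>(2)[OF e])
    let ?a = "onO (enc p) e"
    have a: "?a \<in> Obj (tot p)" using e by simp
    have b: "onA (dec q) (\<alpha>' ?a) \<in> Arr (elts q)" using e by simp
    have "onA (Ext (attr q)) (onA (dec q) (\<alpha>' ?a)) \<cdot>\<^bsub>ctx q\<^esub>
        inverse_arr (ctx q) (top_side (ccIso P ?a)) =
      inverse_arr (ctx q) (top_side (ccIso Q ?a)) \<cdot>\<^bsub>ctx q\<^esub> \<alpha> (onO (Ext (attr p)) e)"
      by (rule q.X.Ctx.inverse_arr_square[THEN iffD1])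
        (use \<alpha>.Iso_component[OF a] e \<alpha>.P.Iso_square[OF a] \<alpha>.Q.Iso_square[OF a] in simp_all)
    then show "mapIso (from_cc p q Q) e \<cdot>\<^bsub>ctx q\<^esub> \<alpha> (onO (Ext (attr p)) e) =
      onA (Ext (attr q)) (\<alpha> (fst e), snd (onO ?HQ e)) \<cdot>\<^bsub>ctx q\<^esub> mapIso (from_cc p q P) e"
      unfolding \<beta>(1)[OF e, symmetric] using e by (simp add: from_cc_def)
  qed
  show "total_part p q (from_cc p q Q) \<alpha> = \<alpha>'"
    unfolding total_part_def elQ
  proof (rule restrict_eqI[OF \<alpha>.tot.component_extensional])
    fix A assume A: "A \<in> Obj (tot p)"
    then show "onA (enc q) (\<alpha> (fst (onO (dec p) A)), snd (onO ?HQ (onO (dec p) A))) = \<alpha>' A"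
      using \<beta>(1)[of "onO (dec p) A", symmetric] by simp
  qed
qed


subsection \<open>Strict maps\<close>

text \<open>Strict maps have no field for a comparison; completing them by identities brings them
  under the correspondence for pseudo maps. For a strict map the object chosen here, the image of
  the extended context, equals the extension of the image.\<close>

definition strict_pmap ::
  "('o, 'a, 't) cwa \<Rightarrow> ('o, 'a, 't) cwa \<Rightarrow> ('o, 'a, 't) cwa_map \<Rightarrow> ('o, 'a, 't) cwa_pmap" where
  "strict_pmap X Y P = \<lparr>mapF = mapF P, mapTy = mapTy P,
     mapIso = (\<lambda>e\<in>Obj (Elts X). Ident (Ctx Y) (onO (mapF P) (onO (Ext X) e)))\<rparr>"

definition strict_part :: "('o, 'a, 't) cwa_pmap \<Rightarrow> ('o, 'a, 't) cwa_map" where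
  "strict_part P = \<lparr>mapF = mapF P, mapTy = mapTy P\<rparr>"

lemma strict_part_strict_pmap [simp]: "strict_part (strict_pmap X Y P) = P"
  by (simp add: strict_part_def strict_pmap_def)

lemma cwa_premap_cong: "\<lbrakk>mapF P = mapF Q; mapTy P = mapTy Q\<rbrakk> \<Longrightarrow> cwa_premap X Y P \<longleftrightarrow> cwa_premap X Y Q"
  by (simp add: cwa_premap_def)

lemma elements_functor_cong: "\<lbrakk>mapF P = mapF Q; mapTy P = mapTy Q\<rbrakk> \<Longrightarrow>
    elements_functor X P = elements_functor X Q"
  by (simp add: elements_functor_def)

lemma elements_functor_strict [simp]:
  "elements_functor X (strict_pmap X' Y P) = elements_functor X P"
  "elements_functor X (strict_part Q) = elements_functor X Q"
  by (rule elements_functor_cong; simp add: strict_pmap_def strict_part_def)+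

lemma cwa_pseudo_map_strict_pmap:
  assumes X: "is_cwa X" and Y: "is_cwa Y" and P: "cwa_strict_map X Y P"
  shows "cwa_pseudo_map X Y (strict_pmap X Y P)"
proof -
  interpret P: cwa_premorphism X Y P
    using assms by (simp add: cwa_premorphismI cwa_strict_map_def)
  have eq: "comp_functor (Elts X) (Ext Y) (elements_functor X P) = comp_functor (Elts X) (mapF P) (Ext X)"
    and Pr: "onA (mapF P) (Pr X e) = Pr Y (onO (elements_functor X P) e)" if "e \<in> Obj (Elts X)" for e
    using P that by (simp_all add: cwa_strict_map_def)
  have F: "is_functor (Elts X) (Ctx Y) (comp_functor (Elts X) (mapF P) (Ext X))"
    by (rule is_functor_comp[OF P.X.Ext.is_functor P.F.is_functor])
  have "nat_iso (Elts X) (Ctx Y) (comp_functor (Elts X) (mapF P) (Ext X))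
     (comp_functor (Elts X) (Ext Y) (elements_functor X P)) (mapIso (strict_pmap X Y P))"
    using nat_iso_id[OF F] P by (simp add: cwa_strict_map_def strict_pmap_def cong: restrict_cong)
  moreover have "cwa_premap X Y (strict_pmap X Y P)"
    using P.premap by (subst cwa_premap_cong[of _ P]) (simp_all add: strict_pmap_def)
  moreover have "Pr Y (onO (elements_functor X P) e) \<cdot>\<^bsub>Ctx Y\<^esub> mapIso (strict_pmap X Y P) e =
      onA (mapF P) (Pr X e)" if "e \<in> Obj (Elts X)" for e
    using that by (simp add: strict_pmap_def flip: Pr)
  ultimately show ?thesis
    by (simp add: cwa_pseudo_map_def) (simp add: strict_pmap_def)
qed

lemma cc_strict_map_to_cc:
  assumes pq: "presentation p" "presentation q" and P: "cwa_strict_map (attr p) (attr q) P"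
  shows "cc_strict_map (cc p) (cc q) (to_cc p q (strict_pmap (attr p) (attr q) P))"
proof -
  interpret p: presentation p by fact
  interpret q: presentation q by fact
  let ?P = "strict_pmap (attr p) (attr q) P"
  let ?T = "to_cc p q ?P"
  have P': "cwa_pseudo_map (attr p) (attr q) ?P"
    by (rule cwa_pseudo_map_strict_pmap[OF p.is_cwa q.is_cwa P])
  interpret P: cwa_morphism "attr p" "attr q" ?P
    using P' p.is_cwa q.is_cwa by (simp add: cwa_morphismI)
  interpret T: cc_morphism "cc p" "cc q" ?T
    rewrites "Base (cc p) = ctx p" and "Base (cc q) = ctx q"
    using p.is_compcat q.is_compcat cc_pseudo_map_to_cc[OF pq P']
    by (auto simp: cc_morphismI p.Base q.Base)
  have mapF [simp]: "mapF ?P = mapF P" "ccF ?T = mapF P"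
    by (simp_all add: to_cc_def strict_pmap_def)
  have TO [simp]: "onO (dec q) (onO (ccT ?T) A) = onO (elements_functor (attr p) P) (onO (dec p) A)"
    if "A \<in> Obj (tot p)" for A
    using that P.el.onO_Obj by (simp add: to_cc_def)
  have TA [simp]: "onA (dec q) (onA (ccT ?T) u) = onA (elements_functor (attr p) P) (onA (dec p) u)"
    if "u \<in> Arr (tot p)" for u
    using that P.el.onA_Arr by (simp add: to_cc_def)
  have eq: "comp_functor (elts p) (mapF P) (Ext (attr p)) =
      comp_functor (elts p) (Ext (attr q)) (elements_functor (attr p) P)"
    using P by (simp add: cwa_strict_map_def)
  have Pr [simp]: "onA (mapF P) (Pr (attr p) e) = Pr (attr q) (onO (elements_functor (attr p) P) e)"
    if "e \<in> Obj (elts p)" for e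
    using P that by (simp add: cwa_strict_map_def)
  note Ext [simp] = comp_functor_eqD[OF eq]
  have el_fst [simp]: "fst (onO (elements_functor (attr p) P) e) = onO (mapF P) (fst e)"
    "onO (elements_functor (attr p) P) e \<in> Obj (elts q)"
    if "e \<in> Obj (elts p)" for e
    using that P.el_simps(1)[of e] P.el.onO_Obj[of e] by simp_all
  have el_A [simp]: "fst (onA (elements_functor (attr p) P) a) = onA (mapF P) (fst a)"
    if "a \<in> Arr (elts p)" for a
    using that P.el_simps(3)[of a] by simp
  show ?thesis
    unfolding cc_strict_map_def
  proof (intro conjI cc_pseudo_map_to_cc[OF pq P'])
    show "comp_functor (tot p) (Compr (cc q)) (ccT ?T) =
      comp_functor (tot p) (arrow_functor (Base (cc p)) (ccF ?T)) (Compr (cc p))"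
      by (rule comp_functor_eqI) (simp_all add: p.Base square_eq_iff)
    show "ccIso ?T = (\<lambda>A\<in>Obj (tot p). Ident (arrow_cat (Base (cc q))) (onO (Compr (cc q)) (onO (ccT ?T) A)))"
    proof (rule extensionalityI[where A = "Obj (tot p)"])
      show "ccIso ?T A = (\<lambda>A\<in>Obj (tot p).
        Ident (arrow_cat (Base (cc q))) (onO (Compr (cc q)) (onO (ccT ?T) A))) A"
        if A: "A \<in> Obj (tot p)" for A
      proof -
        have "ccIso ?T A = (Pr (attr q) (onO (elements_functor (attr p) P) (onO (dec p) A)),
         (inverse_arr (ctx q) (mapIso ?P (onO (dec p) A)),
          Ident (ctx q) (onO (mapF P) (fst (onO (dec p) A)))),
         onA (mapF P) (Pr (attr p) (onO (dec p) A)))"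
          using A by (simp add: to_cc_def)
        moreover have "mapIso ?P (onO (dec p) A) =
            Ident (ctx q) (onO (Ext (attr q)) (onO (elements_functor (attr p) P) (onO (dec p) A)))"
          using A by (simp add: strict_pmap_def)
        ultimately show ?thesis
          using A by (simp add: q.Base)
      qed
    qed (simp_all add: to_cc_def)
  qed
qed

text \<open>The comparison of a strict map consists of identities, and so does its inverse.
  Forgetting it with \<open>strict_part\<close> and restoring identities therefore gives back the
  same pseudo map.\<close>

lemma
  assumes pq: "presentation p" "presentation q" and Q: "cc_strict_map (cc p) (cc q) Q"
  shows cwa_strict_map_from_cc: "cwa_strict_map (attr p) (attr q) (strict_part (from_cc p q Q))"
    and strict_pmap_from_cc: "strict_pmap (attr p) (attr q) (strict_part (from_cc p q Q)) = from_cc p q Q"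
proof -
  interpret p: presentation p by fact
  interpret q: presentation q by fact
  have Q': "cc_pseudo_map (cc p) (cc q) Q" using Q by (rule cc_strict_mapD)
  interpret Q: cc_morphism "cc p" "cc q" Q
    rewrites "Base (cc p) = ctx p" and "Base (cc q) = ctx q"
    using p.is_compcat q.is_compcat Q' by (auto simp: cc_morphismI p.Base q.Base)
  interpret P: cwa_morphism "attr p" "attr q" "from_cc p q Q"
    using cwa_pseudo_map_from_cc[OF pq Q'] p.is_cwa q.is_cwa by (simp add: cwa_morphismI)
  have mapF [simp]: "mapF (from_cc p q Q) = ccF Q" by (simp add: from_cc_def)
  have el [simp]: "elements_functor (attr p) (from_cc p q Q) =
      comp_functor (elts p) (dec q) (comp_functor (elts p) (ccT Q) (enc p))"
    by (rule elements_functor_from_cc[OF pq Q'])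
  have eq: "comp_functor (tot p) (Compr (cc q)) (ccT Q) =
      comp_functor (tot p) (arrow_functor (ctx p) (ccF Q)) (Compr (cc p))"
    and iso: "ccIso Q = (\<lambda>A\<in>Obj (tot p). Ident (arrow_cat (ctx q)) (onO (Compr (cc q)) (onO (ccT Q) A)))"
    using Q by (simp_all add: cc_strict_map_def p.Base q.Base)
  have Pr: "onA (ccF Q) (Pr (attr p) e) = Pr (attr q) (onO (elements_functor (attr p) (from_cc p q Q)) e)"
    if "e \<in> Obj (elts p)" for e
    using comp_functor_eqD(1)[OF eq, of "onO (enc p) e"] that by simp
  \<comment> \<open>An extended context is the domain of its projection arrow, so this follows from
    preservation of projections.\<close>
  have Ext_O: "onO (ccF Q) (onO (Ext (attr p)) e) =
      onO (Ext (attr q)) (onO (elements_functor (attr p) (from_cc p q Q)) e)"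
    if "e \<in> Obj (elts p)" for e
    using arg_cong[OF Pr[OF that], of "Dom (ctx q)"] that by simp
  have Ext_A: "onA (ccF Q) (onA (Ext (attr p)) a) =
      onA (Ext (attr q)) (onA (elements_functor (attr p) (from_cc p q Q)) a)"
    if "a \<in> Arr (elts p)" for a
    using arg_cong[OF comp_functor_eqD(2)[OF eq, of "onA (enc p) a"], of top_side] that by simp
  have "cwa_premap (attr p) (attr q) (strict_part (from_cc p q Q))"
    using P.premap by (subst cwa_premap_cong[of _ "from_cc p q Q"]) (simp_all add: strict_part_def)
  moreover have "comp_functor (elts p) (ccF Q) (Ext (attr p)) = comp_functor (elts p) (Ext (attr q))
      (elements_functor (attr p) (from_cc p q Q))"
    using Ext_O Ext_A by (rule comp_functor_eqI)
  ultimately show "cwa_strict_map (attr p) (attr q) (strict_part (from_cc p q Q))"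
    using Pr by (simp add: cwa_strict_map_def del: el) (simp add: strict_part_def)
  have "mapIso (strict_pmap (attr p) (attr q) (strict_part (from_cc p q Q))) = mapIso (from_cc p q Q)"
  proof (rule extensionalityI[where A = "Obj (elts p)"])
    fix e assume e: "e \<in> Obj (elts p)"
    have "top_side (ccIso Q (onO (enc p) e)) =
        Ident (ctx q) (onO (Ext (attr q)) (onO (elements_functor (attr p) (from_cc p q Q)) e))"
      using e by (simp add: iso)
    moreover have "mapIso (from_cc p q Q) e =
        inverse_arr (ctx q) (top_side (ccIso Q (onO (enc p) e)))"
      using e by (simp add: from_cc_def)
    moreover have "mapIso (strict_pmap (attr p) (attr q) (strict_part (from_cc p q Q))) e =
        Ident (ctx q) (onO (ccF Q) (onO (Ext (attr p)) e))"
      using e by (simp add: strict_pmap_def strict_part_def)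
    ultimately show "mapIso (strict_pmap (attr p) (attr q) (strict_part (from_cc p q Q))) e = mapIso (from_cc p q Q) e"
      using e Ext_O[OF e] by simp
  qed (simp_all add: strict_pmap_def from_cc_def)
  then show "strict_pmap (attr p) (attr q) (strict_part (from_cc p q Q)) = from_cc p q Q"
    by (intro cwa_pmap.equality) (simp_all, simp_all add: strict_pmap_def strict_part_def)
qed

lemma strict_part_cwa_id: "strict_part (cwa_id X) = cwa_strict_id X"
  by (simp add: strict_part_def cwa_id_def cwa_strict_id_def)

lemma strict_part_cwa_comp:
  "strict_part (cwa_comp X Z (strict_pmap Y Z Q) (strict_pmap X Y P)) = cwa_strict_comp X Q P"
  by (simp add: strict_part_def cwa_comp_def cwa_strict_comp_def strict_pmap_def)


section \<open>Existence of presentations\<close>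

text \<open>Comprehension for the category of elements itself as total category, before its cells
  are renamed.\<close>

definition compr_functor :: "('o, 'a, 't) cwa \<Rightarrow> ('o \<times> 't, 'a \<times> 't, 'a, 'a square) ftor" where
  "compr_functor X = \<lparr>onO = restrict (Pr X) (Obj (Elts X)),
     onA = (\<lambda>a\<in>Arr (Elts X). (Pr X (Dom (Elts X) a), (onA (Ext X) a, fst a), Pr X (Cod (Elts X) a)))\<rparr>"

lemma is_functor_compr_functor:
  assumes "is_cwa X"
  shows "is_functor (Elts X) (arrow_cat (Ctx X)) (compr_functor X)"
proof -
  interpret cwa X by standard fact
  have arr: "onA (compr_functor X) a \<in> Arr (arrow_cat (Ctx X))" if "a \<in> Arr (Elts X)" for a
    using that Pr_naturality[of a] by (simp add: compr_functor_def arrow_cat_Arr)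
  show ?thesis
  proof (rule is_functorI, goal_cases)
    case (7 e)
    then have "fst (Ident (Elts X) e) = Ident (Ctx X) (fst e)" by (simp add: elements_cat_Ident)
    with 7 show ?case by (simp add: compr_functor_def)
  next
    case (8 a b)
    then show ?case
      using arr[of a] arr[of b] Ext.C.Comp_Arr[of a b] Pr.G.onA_Comp[of a b]
      by (simp add: compr_functor_def)
  qed (use arr in \<open>simp_all add: category_arrow_cat Ctx.category_axioms Ext.C.category_axioms,
      simp_all add: compr_functor_def\<close>)
qed

text \<open>Any category isomorphic to the category of elements serves as total category once
  projection and comprehension are transported along the isomorphism. The pullback condition is the
  one in the definition of a CwA.\<close>

lemma presentationI:
  assumes X: "is_cwa X" and en: "is_functor (Elts X) T en" and de: "is_functor T (Elts X) de"
    and de_en: "\<And>e. e \<in> Obj (Elts X) \<Longrightarrow> onO de (onO en e) = e"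
      "\<And>a. a \<in> Arr (Elts X) \<Longrightarrow> onA de (onA en a) = a"
    and en_de: "\<And>A. A \<in> Obj T \<Longrightarrow> onO en (onO de A) = A"
      "\<And>u. u \<in> Arr T \<Longrightarrow> onA en (onA de u) = u"
  shows "presentation
    \<lparr>attr = X,
     cc = \<lparr>Base = Ctx X, Tot = T, Proj = comp_functor T (elements_proj (Ctx X) (Ty X)) de,
       Compr = comp_functor T (compr_functor X) de\<rparr>,
     enc = en, dec = de\<rparr>" (is "presentation ?p")
proof -
  interpret X: cwa X by standard fact
  interpret en: functor_between "Elts X" T en by standard fact
  interpret de: functor_between T "Elts X" de by standard fact
  note [simp] = de_en en_de
  let ?Proj = "comp_functor T (elements_proj (Ctx X) (Ty X)) de" and ?Compr = "comp_functor T (compr_functor X) de"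
  have Proj: "is_functor T (Ctx X) ?Proj"
    by (rule is_functor_comp[OF de X.Pr.G.is_functor])
  have disc: "is_discrete_fibration T (Ctx X) ?Proj"
    unfolding is_discrete_fibration_def
  proof (intro conjI Proj ballI impI)
    fix A f assume A: "A \<in> Obj T" and f: "f \<in> Arr (Ctx X)" "Cod (Ctx X) f = onO ?Proj A"
    \<comment> \<open>The lift of f to A: an arrow of the category of elements consists of its base
      part and the type at its codomain, so no other pair is possible.\<close>
    let ?a = "(f, snd (onO de A))"
    have dA: "onO de A \<in> Obj (Elts X)" using A by simp
    have a: "?a \<in> Arr (Elts X)"
      using A f dA elements_cat_Obj[of "onO de A" "Ctx X" "Ty X"] by (simp add: elements_cat_Arr)
    have Cod_a: "Cod (Elts X) ?a = onO de A"
      using A f by (simp add: elements_cat_Cod[OF a] prod_eq_iff)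
    show "\<exists>!u. u \<in> Arr T \<and> Cod T u = A \<and> onA ?Proj u = f"
    proof (rule ex1I[of _ "onA en ?a"])
      show "onA en ?a \<in> Arr T \<and> Cod T (onA en ?a) = A \<and> onA ?Proj (onA en ?a) = f"
        using A a Cod_a by simp
      show "u = onA en ?a" if u: "u \<in> Arr T \<and> Cod T u = A \<and> onA ?Proj u = f" for u
      proof -
        have "fst (onA de u) = f" using u by auto
        moreover have "snd (onA de u) = snd (onO de A)"
          using u de.Cod_onA[of u] elements_cat_Cod[of "onA de u"] by (metis de.onA_Arr snd_conv)
        ultimately have "onA de u = ?a" by (simp add: prod_eq_iff)
        then show ?thesis using u en_de(2) by metis
      qed
    qed
  qed
  then have fib: "is_fibration T (Ctx X) ?Proj"
    by (intro discrete_fibration.is_fibration) (simp add: discrete_fibration_def)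
  have Compr: "is_functor T (arrow_cat (Ctx X)) ?Compr"
    by (rule is_functor_comp[OF de is_functor_compr_functor[OF X]])
  interpret C: functor_between "Elts X" "arrow_cat (Ctx X)" "compr_functor X"
    by standard (rule is_functor_compr_functor[OF X])
  have CO [simp]: "onO (compr_functor X) e = Pr X e" if "e \<in> Obj (Elts X)" for e
    using that by (simp add: compr_functor_def)
  have CA [simp]: "top_side (onA (compr_functor X) a) = onA (Ext X) a"
    "bot_side (onA (compr_functor X) a) = fst a" if "a \<in> Arr (Elts X)" for a
    using that by (simp_all add: compr_functor_def)
  have cod: "comp_functor T (cod_functor (Ctx X)) ?Compr = ?Proj"
    by (rule functor_eqI[where C = T]) (simp_all add: cod_functor_def C.onA_Arr)
  have pb: "is_pullback (Ctx X) (top_side (onA ?Compr u)) (onO ?Compr (Dom T u)) (onO ?Compr (Cod T u))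
      (bot_side (onA ?Compr u))" if "is_cartesian T (Ctx X) ?Proj u" for u
  proof -
    have u: "u \<in> Arr T" using that by (simp add: is_cartesian_def)
    then have "onA de u \<in> Arr (Elts X)" by simp
    then have "is_pullback (Ctx X) (onA (Ext X) (onA de u)) (Pr X (Dom (Elts X) (onA de u)))
       (Pr X (Cod (Elts X) (onA de u))) (onA (elements_proj (Ctx X) (Ty X)) (onA de u))"
      using X unfolding is_cwa_def by blast
    then show ?thesis using u by simp
  qed
  show ?thesis
    by unfold_locales
      (use Compr fib disc cod pb in \<open>simp_all add: X en de is_discrete_compcat_def is_compcat_def\<close>)
qed


text \<open>A copy of C with its cells renamed, used to bring the category of elements from pairs to
  the required carrier. It is applied with j and k injective, which makes \<open>inv\<close> a true
  inverse on the images.\<close>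

definition image_cat :: "('o \<Rightarrow> 'p) \<Rightarrow> ('a \<Rightarrow> 'b) \<Rightarrow> ('o, 'a) cat \<Rightarrow> ('p, 'b) cat" where
  "image_cat j k C = mk_cat (j ` Obj C) (k ` Arr C) (\<lambda>u. j (Dom C (inv k u))) (\<lambda>u. j (Cod C (inv k u)))
     (\<lambda>A. k (Ident C (inv j A))) (\<lambda>v u. k (inv k v \<cdot>\<^bsub>C\<^esub> inv k u))"

lemma
  assumes C: "category C" and j: "inj j" and k: "inj k"
  shows is_functor_image_cat:
      "is_functor C (image_cat j k C) \<lparr>onO = restrict j (Obj C), onA = restrict k (Arr C)\<rparr>"
    and is_functor_image_cat_inv:
      "is_functor (image_cat j k C) C \<lparr>onO = restrict (inv j) (j ` Obj C), onA = restrict (inv k) (k ` Arr C)\<rparr>"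
proof -
  interpret category C by fact
  note [simp] = inv_f_f[OF j] inv_f_f[OF k] inj_eq[OF j] inj_eq[OF k]
  have I: "category (image_cat j k C)"
    unfolding image_cat_def by (rule category_mk_cat) (auto simp: assoc)
  show "is_functor C (image_cat j k C) \<lparr>onO = restrict j (Obj C), onA = restrict k (Arr C)\<rparr>"
    by (rule is_functorI[OF C I]) (simp_all add: image_cat_def)
  show "is_functor (image_cat j k C) C \<lparr>onO = restrict (inv j) (j ` Obj C), onA = restrict (inv k) (k ` Arr C)\<rparr>"
    by (rule is_functorI[OF I C]) (auto simp: image_cat_def)
qed

lemma ex_presentation_cwa:
  fixes X :: "('o, 'a, 't) cwa" and j :: "'o \<times> 't \<Rightarrow> 'p" and k :: "'a \<times> 't \<Rightarrow> 'b"
  assumes X: "is_cwa X" and j: "inj j" and k: "inj k"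
  shows "\<exists>p :: ('o, 'a, 't, 'p, 'b) pres. presentation p \<and> attr p = X"
proof -
  interpret cwa X by standard fact
  note E = Ext.C.category_axioms
  note p = presentationI[OF X is_functor_image_cat[OF E j k] is_functor_image_cat_inv[OF E j k]]
  have "presentation \<lparr>attr = X,
      cc = \<lparr>Base = Ctx X, Tot = image_cat j k (Elts X),
        Proj = comp_functor (image_cat j k (Elts X)) (elements_proj (Ctx X) (Ty X))
          \<lparr>onO = restrict (inv j) (j ` Obj (Elts X)), onA = restrict (inv k) (k ` Arr (Elts X))\<rparr>,
        Compr = comp_functor (image_cat j k (Elts X)) (compr_functor X)
          \<lparr>onO = restrict (inv j) (j ` Obj (Elts X)), onA = restrict (inv k) (k ` Arr (Elts X))\<rparr>\<rparr>,
      enc = \<lparr>onO = restrict j (Obj (Elts X)), onA = restrict k (Arr (Elts X))\<rparr>,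
      dec = \<lparr>onO = restrict (inv j) (j ` Obj (Elts X)), onA = restrict (inv k) (k ` Arr (Elts X))\<rparr>\<rparr>"
    by (rule p) (auto simp: inv_f_f[OF j] inv_f_f[OF k] image_cat_def)
  then show ?thesis by (metis pres.select_convs(1))
qed

section \<open>The category with attributes formed by the fibres of a discrete comprehension
  category\<close>

locale discrete_compcat = compcat Y for Y :: "('o, 'a, 'p, 'b) compcat" +
  assumes discrete: "is_discrete_fibration (Tot Y) (Base Y) (Proj Y)"
begin

sublocale fib: discrete_fibration "Tot Y" "Base Y" "Proj Y"
  by standard (rule discrete)

definition fibre :: "'o \<Rightarrow> 'p set" where
  "fibre x = {A \<in> Obj (Tot Y). onO (Proj Y) A = x}"

definition fibre_presheaf :: "('o, 'a, 'p) presheaf" where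
  "fibre_presheaf = \<lparr>onO = restrict fibre (Obj (Base Y)),
     onA = (\<lambda>f\<in>Arr (Base Y). (fibre (Cod (Base Y) f),
       (\<lambda>A\<in>fibre (Cod (Base Y) f). Dom (Tot Y) (fib.lift f A)), fibre (Dom (Base Y) f)))\<rparr>"

lemma lift_Ident: "A \<in> Obj (Tot Y) \<Longrightarrow> fib.lift (Ident (Base Y) (onO (Proj Y) A)) A = Ident (Tot Y) A"
  by (rule fib.lift_unique) simp_all

text \<open>Both sides are lifts of the same composite to A. The second clause is the typing that
  makes the inner lift well defined.\<close>

lemma lift_Comp:
  assumes "A \<in> Obj (Tot Y)" "g \<in> Arr (Base Y)" "f \<in> Arr (Base Y)" "Cod (Base Y) g = onO (Proj Y) A"
    "Dom (Base Y) g = Cod (Base Y) f"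
  shows "fib.lift (g \<cdot>\<^bsub>Base Y\<^esub> f) A = fib.lift g A \<cdot>\<^bsub>Tot Y\<^esub> fib.lift f (Dom (Tot Y) (fib.lift g A))"
    and "Cod (Base Y) f = onO (Proj Y) (Dom (Tot Y) (fib.lift g A))"
proof -
  show *: "Cod (Base Y) f = onO (Proj Y) (Dom (Tot Y) (fib.lift g A))"
    using assms by (simp flip: Proj.Dom_onA)
  show "fib.lift (g \<cdot>\<^bsub>Base Y\<^esub> f) A = fib.lift g A \<cdot>\<^bsub>Tot Y\<^esub> fib.lift f (Dom (Tot Y) (fib.lift g A))"
    by (rule fib.lift_unique) (use assms * in simp_all)
qed

lemma is_functor_fibre_presheaf: "is_functor (op_cat (Base Y)) set_cat fibre_presheaf"
proof -
  have Dom_lift: "Dom (Tot Y) (fib.lift f A) \<in> fibre (Dom (Base Y) f)"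
    if "f \<in> Arr (Base Y)" "A \<in> fibre (Cod (Base Y) f)" for f A
    using that unfolding fibre_def by (simp flip: Proj.Dom_onA)
  have arr: "onA fibre_presheaf f \<in> Arr set_cat" if "f \<in> Arr (Base Y)" for f
    using that Dom_lift by (simp add: fibre_presheaf_def set_cat_Arr)
  show ?thesis
  proof (rule is_functorI, goal_cases)
    case (7 x)
    then show ?case
      by (auto simp: fibre_presheaf_def set_cat_Ident fibre_def lift_Ident intro!: restrict_ext)
  next
    case (8 f g)
    then have fg: "f \<in> Arr (Base Y)" "g \<in> Arr (Base Y)" "Cod (Base Y) g = Dom (Base Y) f" by simp_all
    have "Dom (Tot Y) (fib.lift (f \<cdot>\<^bsub>Base Y\<^esub> g) A) = Dom (Tot Y) (fib.lift g (Dom (Tot Y) (fib.lift f A)))"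
      if "A \<in> fibre (Cod (Base Y) f)" for A
      using that fg lift_Comp[of A f g] by (simp add: fibre_def)
    then show ?case
      using fg arr[OF fg(1)] arr[OF fg(2)] Dom_lift
      by (auto simp: fibre_presheaf_def set_cat_Comp compose_def intro!: restrict_ext)
  qed (use arr in \<open>simp_all add: category_op_cat Proj.D.category_axioms category_set_cat\<close>,
      simp_all add: fibre_presheaf_def)
qed

text \<open>An object of the category of elements repeats the base point that A already determines,
  so \<open>snd\<close> loses nothing.\<close>

definition fibre_enc :: "('o \<times> 'p, 'a \<times> 'p, 'p, 'b) ftor" where
  "fibre_enc = \<lparr>onO = restrict snd (Obj (elements_cat (Base Y) fibre_presheaf)),
     onA = (\<lambda>a\<in>Arr (elements_cat (Base Y) fibre_presheaf). fib.lift (fst a) (snd a))\<rparr>"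

definition fibre_dec :: "('p, 'b, 'o \<times> 'p, 'a \<times> 'p) ftor" where
  "fibre_dec = \<lparr>onO = (\<lambda>A\<in>Obj (Tot Y). (onO (Proj Y) A, A)),
     onA = (\<lambda>u\<in>Arr (Tot Y). (onA (Proj Y) u, Cod (Tot Y) u))\<rparr>"

text \<open>Extension consists of the domains and top sides of the comprehension squares, and
  \<open>Pr\<close> of their vertical sides.\<close>

definition fibre_cwa :: "('o, 'a, 'p) cwa" where
  "fibre_cwa = \<lparr>Ctx = Base Y, Ty = fibre_presheaf,
     Ext = \<lparr>onO = (\<lambda>e\<in>Obj (elements_cat (Base Y) fibre_presheaf). Dom (Base Y) (onO (Compr Y) (snd e))),
       onA = (\<lambda>a\<in>Arr (elements_cat (Base Y) fibre_presheaf).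
         top_side (onA (Compr Y) (fib.lift (fst a) (snd a))))\<rparr>,
     Pr = (\<lambda>e\<in>Obj (elements_cat (Base Y) fibre_presheaf). onO (Compr Y) (snd e))\<rparr>"

abbreviation "E \<equiv> elements_cat (Base Y) fibre_presheaf"

lemma E_Obj: "e \<in> Obj E \<longleftrightarrow> snd e \<in> Obj (Tot Y) \<and> fst e = onO (Proj Y) (snd e)"
  by (auto simp: elements_cat_Obj fibre_presheaf_def fibre_def)

lemma E_Arr: "a \<in> Arr E \<longleftrightarrow>
    fst a \<in> Arr (Base Y) \<and> snd a \<in> Obj (Tot Y) \<and> Cod (Base Y) (fst a) = onO (Proj Y) (snd a)"
  by (auto simp: elements_cat_Arr fibre_presheaf_def fibre_def)

lemma E_Dom: "a \<in> Arr E \<Longrightarrow> Dom E a = (Dom (Base Y) (fst a), Dom (Tot Y) (fib.lift (fst a) (snd a)))"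
  using E_Arr[of a] by (simp add: elements_cat_Dom) (simp add: fibre_presheaf_def fibre_def)

lemma category_E: "category E"
  by (rule category_elements_cat[OF Proj.D.category_axioms is_functor_fibre_presheaf])

lemma is_functor_fibre_enc: "is_functor E (Tot Y) fibre_enc"
proof -
  interpret E: category E by (rule category_E)
  have arr: "fib.lift (fst a) (snd a) \<in> Arr (Tot Y)" if "a \<in> Arr E" for a
    using that by (simp add: E_Arr)
  show ?thesis
  proof (rule is_functorI, goal_cases)
    case (5 a)
    then show ?case using E.Dom_Obj[of a] by (simp add: fibre_enc_def E_Dom)
  next
    case (6 a)
    then show ?case using E.Cod_Obj[of a] by (simp add: fibre_enc_def elements_cat_Cod) (simp add: E_Arr)
  next
    case (7 e)
    then show ?case
      using E.Ident_Arr[of e] by (simp add: fibre_enc_def elements_cat_Ident) (simp add: E_Obj lift_Ident)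
  next
    case (8 a b)
    then have "snd a = Dom (Tot Y) (fib.lift (fst b) (snd b))" "Dom (Base Y) (fst b) = Cod (Base Y) (fst a)"
      by (simp_all add: E_Dom elements_cat_Cod)
    then show ?case
      using 8 E.Comp_Arr[OF 8] lift_Comp(1)[of "snd b" "fst b" "fst a"]
      by (simp add: fibre_enc_def elements_cat_Comp) (simp add: E_Arr)
  qed (use arr in \<open>simp_all add: category_E Proj.C.category_axioms\<close>, simp_all add: fibre_enc_def, simp add: E_Obj)
qed

lemma is_functor_fibre_dec: "is_functor (Tot Y) E fibre_dec"
proof -
  interpret E: category E by (rule category_E)
  have O: "(onO (Proj Y) A, A) \<in> Obj E" if "A \<in> Obj (Tot Y)" for A
    using that by (simp add: E_Obj)
  have A: "(onA (Proj Y) u, Cod (Tot Y) u) \<in> Arr E" if "u \<in> Arr (Tot Y)" for u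
    using that by (simp add: E_Arr)
  \<comment> \<open>Every arrow is the lift of its own projection to its own codomain, hence
    recoverable from its code.\<close>
  have L: "fib.lift (onA (Proj Y) u) (Cod (Tot Y) u) = u" if "u \<in> Arr (Tot Y)" for u
    by (rule fib.lift_unique) (use that in simp_all)
  show ?thesis
  proof (rule is_functorI, goal_cases)
    case (8 u v)
    have D: "Dom E (onA (Proj Y) v, Cod (Tot Y) v) = Cod E (onA (Proj Y) u, Cod (Tot Y) u)"
      using 8 by (simp add: E_Dom elements_cat_Cod A L)
    show ?case using 8 elements_cat_Comp[OF A[OF 8(1)] A[OF 8(2)] D] by (simp add: fibre_dec_def)
  qed (simp_all add: category_E Proj.C.category_axioms fibre_dec_def O A E_Dom elements_cat_Cod L
      elements_cat_Ident)
qed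

lemma enc_dec:
  "e \<in> Obj E \<Longrightarrow> onO fibre_dec (onO fibre_enc e) = e"
  "a \<in> Arr E \<Longrightarrow> onA fibre_dec (onA fibre_enc a) = a"
  "A \<in> Obj (Tot Y) \<Longrightarrow> onO fibre_enc (onO fibre_dec A) = A"
  "u \<in> Arr (Tot Y) \<Longrightarrow> onA fibre_enc (onA fibre_dec u) = u"
proof -
  interpret enc: functor_between E "Tot Y" fibre_enc by standard (rule is_functor_fibre_enc)
  interpret dec: functor_between "Tot Y" E fibre_dec by standard (rule is_functor_fibre_dec)
  show "e \<in> Obj E \<Longrightarrow> onO fibre_dec (onO fibre_enc e) = e"
    using enc.onO_Obj[of e] by (simp add: fibre_dec_def fibre_enc_def) (simp add: E_Obj prod_eq_iff)
  show "a \<in> Arr E \<Longrightarrow> onA fibre_dec (onA fibre_enc a) = a"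
    using enc.onA_Arr[of a] by (simp add: fibre_dec_def fibre_enc_def) (simp add: E_Arr)
  show "A \<in> Obj (Tot Y) \<Longrightarrow> onO fibre_enc (onO fibre_dec A) = A"
    using dec.onO_Obj[of A] by (simp add: fibre_dec_def fibre_enc_def)
  show "onA fibre_enc (onA fibre_dec u) = u" if "u \<in> Arr (Tot Y)"
    by (rule fib.lift_unique)
      (use that dec.onA_Arr[of u] in \<open>simp_all add: fibre_dec_def fibre_enc_def\<close>)
qed

lemma fibre_cwa_simps [simp]:
  "Ctx fibre_cwa = Base Y" "Ty fibre_cwa = fibre_presheaf"
  by (simp_all add: fibre_cwa_def)

lemma fibre_cwa_Ext:
  "e \<in> Obj E \<Longrightarrow> onO (Ext fibre_cwa) e = Dom (Base Y) (onO (Compr Y) (onO fibre_enc e))"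
  "a \<in> Arr E \<Longrightarrow> onA (Ext fibre_cwa) a = top_side (onA (Compr Y) (onA fibre_enc a))"
  "e \<in> Obj E \<Longrightarrow> Pr fibre_cwa e = onO (Compr Y) (onO fibre_enc e)"
  by (simp_all add: fibre_cwa_def fibre_enc_def)

text \<open>Naturality of the projections is commutativity of the comprehension squares. They are
  pullbacks because every arrow of the total category is cartesian.\<close>

lemma is_cwa_fibre_cwa: "is_cwa fibre_cwa"
proof -
  interpret enc: functor_between E "Tot Y" fibre_enc by standard (rule is_functor_fibre_enc)
  interpret ar: category "arrow_cat (Base Y)" by (rule category_arrow_cat[OF Proj.D.category_axioms])
  have Proj_enc: "onO (Proj Y) (onO fibre_enc e) = fst e" if "e \<in> Obj E" for e
    using that by (simp add: fibre_enc_def) (simp add: E_Obj)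
  have Proj_enc_A: "onA (Proj Y) (onA fibre_enc a) = fst a" if "a \<in> Arr E" for a
    using that by (simp add: fibre_enc_def) (simp add: E_Arr)
  have Ext: "is_functor E (Base Y) (Ext fibre_cwa)"
  proof (rule is_functorI, goal_cases)
    case (8 a b)
    then show ?case
      by (simp add: fibre_cwa_Ext)
  qed (simp_all add: category_E Proj.D.category_axioms fibre_cwa_Ext, simp_all add: fibre_cwa_def)
  have P: "is_functor E (Base Y) (elements_proj (Base Y) fibre_presheaf)"
    by (rule is_functor_elements_proj[OF Proj.D.category_axioms is_functor_fibre_presheaf])
  have Pr: "nat_trans E (Base Y) (Ext fibre_cwa) (elements_proj (Base Y) fibre_presheaf) (Pr fibre_cwa)"
  proof (rule nat_transI[OF Ext P])
    fix a assume a: "a \<in> Arr E"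
    show "Pr fibre_cwa (Cod E a) \<cdot>\<^bsub>Base Y\<^esub> onA (Ext fibre_cwa) a =
      onA (elements_proj (Base Y) fibre_presheaf) a \<cdot>\<^bsub>Base Y\<^esub> Pr fibre_cwa (Dom E a)"
      using a arrow_cat_commutes[OF Compr.onA_Arr[of "onA fibre_enc a"]]
      by (simp add: fibre_cwa_Ext Proj_enc_A)
  qed (simp_all add: fibre_cwa_Ext Proj_enc, simp add: fibre_cwa_def)
  have pb: "is_pullback (Base Y) (onA (Ext fibre_cwa) a) (Pr fibre_cwa (Dom E a)) (Pr fibre_cwa (Cod E a))
      (onA (elements_proj (Base Y) fibre_presheaf) a)" if a: "a \<in> Arr E" for a
  proof -
    have "is_pullback (Base Y) (top_side (onA (Compr Y) (onA fibre_enc a)))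
        (onO (Compr Y) (Dom (Tot Y) (onA fibre_enc a))) (onO (Compr Y) (Cod (Tot Y) (onA fibre_enc a)))
        (bot_side (onA (Compr Y) (onA fibre_enc a)))"
      using is_compcat fib.is_cartesian[OF enc.onA_Arr[OF a]] unfolding is_compcat_def by blast
    then show ?thesis
      using a by (simp add: fibre_cwa_Ext Proj_enc_A)
  qed
  show ?thesis
    using Ext Pr pb by (simp add: is_cwa_def Proj.D.category_axioms is_functor_fibre_presheaf)
qed

lemma presentation_fibre_cwa: "presentation \<lparr>attr = fibre_cwa, cc = Y, enc = fibre_enc, dec = fibre_dec\<rparr>"
proof -
  interpret dec: functor_between "Tot Y" E fibre_dec by standard (rule is_functor_fibre_dec)
  show ?thesis
    by unfold_locales
      (simp_all add: is_cwa_fibre_cwa is_compcat discrete is_discrete_compcat_def is_functor_fibre_enc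
        is_functor_fibre_dec enc_dec fibre_cwa_Ext, simp_all add: fibre_dec_def)
qed

end

text \<open>The types of this CwA are the objects of the total category, which is why
  \<open>'p\<close> also stands in the place of the carrier of types.\<close>

lemma ex_presentation_compcat:
  fixes Y :: "('o, 'a, 'p, 'b) compcat"
  assumes "is_discrete_compcat Y"
  shows "\<exists>p :: ('o, 'a, 'p, 'p, 'b) pres. presentation p \<and> cc p = Y"
proof -
  interpret discrete_compcat Y
    using assms by unfold_locales (simp_all add: is_discrete_compcat_def)
  show ?thesis
    using presentation_fibre_cwa by (metis pres.select_convs(2))
qed

text \<open>An infinite set has the cardinality of its square. The infinity of the universe enters
  here.\<close>

lemma ex_inj_prod:
  assumes "infinite (UNIV :: 'u set)"
  shows "\<exists>j :: 'u \<times> 'u \<Rightarrow> 'u. inj j"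
  using card_of_Times_same_infinite[OF assms] card_of_ordIso[of "UNIV \<times> UNIV :: ('u \<times> 'u) set" "UNIV :: 'u set"]
  by (auto simp: bij_betw_def)


section \<open>The equivalences\<close>

context category
begin

lemma isomorphic_refl: "x \<in> Obj C \<Longrightarrow> isomorphic C x x"
  unfolding isomorphic_def using is_iso_Ident Ident_hom by blast

end

subsection \<open>Hom-categories\<close>

definition to_cell ::
  "('o, 'a, 't, 'p, 'b) pres \<Rightarrow> ('o, 'a, 't, 'p, 'b) pres \<Rightarrow> ('o, 'a, 't) cwa_cell \<Rightarrow> ('o, 'a, 'p, 'b) cc_cell" where
  "to_cell p q = (\<lambda>(P, \<alpha>, Q). (to_cc p q P, (\<alpha>, total_part p q Q \<alpha>), to_cc p q Q))"

definition hom_functor ::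
  "('o, 'a, 't, 'p, 'b) pres \<Rightarrow> ('o, 'a, 't, 'p, 'b) pres \<Rightarrow>
   (('o, 'a, 't) cwa_pmap, ('o, 'a, 't) cwa_cell, ('o, 'a, 'p, 'b) cc_map, ('o, 'a, 'p, 'b) cc_cell) ftor" where
  "hom_functor p q =
     \<lparr>onO = restrict (to_cc p q) (Obj (cwa_hom (attr p) (attr q))),
      onA = restrict (to_cell p q) (Arr (cwa_hom (attr p) (attr q)))\<rparr>"

lemma cwa_hom_simps [simp]:
  "Obj (cwa_hom X Y) = {P. cwa_pseudo_map X Y P}"
  "(P, \<alpha>, Q) \<in> Arr (cwa_hom X Y) \<longleftrightarrow>
     cwa_pseudo_map X Y P \<and> cwa_pseudo_map X Y Q \<and> cwa_transformation X Y P Q \<alpha>"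
  by (simp_all add: cwa_hom_def)

context
  fixes p q :: "('o, 'a, 't, 'p, 'b) pres"
  assumes p: "presentation p" and q: "presentation q"
begin

text \<open>Obtained by transport along \<open>to_cell\<close>, which is bijective between cells
  with given ends; the hom-category of CwA's thereby inherits its laws.\<close>

lemma
  shows is_functor_hom_functor:
      "is_functor (cwa_hom (attr p) (attr q)) (cc_hom (cc p) (cc q)) (hom_functor p q)"
    and bij_betw_hom_functor: "\<lbrakk>cwa_pseudo_map (attr p) (attr q) P; cwa_pseudo_map (attr p) (attr q) Q\<rbrakk> \<Longrightarrow>
      bij_betw (onA (hom_functor p q)) (hom (cwa_hom (attr p) (attr q)) P Q)
        (hom (cc_hom (cc p) (cc q)) (to_cc p q P) (to_cc p q Q))"
proof -
  interpret p: presentation p by (rule p)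
  interpret q: presentation q by (rule q)
  \<comment> \<open>Only the base component of a transformation is kept; the total component is
    restored by unique lifting.\<close>
  define fr where "fr P Q u = (P, fst (fst (snd u)), Q)"
    for P Q :: "('o, 'a, 't) cwa_pmap" and u :: "('o, 'a, 'p, 'b) cc_cell"
  have D: "category (cc_hom (cc p) (cc q))"
    by (rule category_cc_hom[OF p.is_compcat q.is_compcat])
  have ccF: "ccF (to_cc p q P) = mapF P" for P
    by (simp add: to_cc_def)
  have cell: "to_cell p q (P, \<alpha>, Q) \<in> Arr (cc_hom (cc p) (cc q))"
    if "(P, \<alpha>, Q) \<in> Arr (cwa_hom (attr p) (attr q))" for P \<alpha> Q
    using that by (simp add: to_cell_def cc_pseudo_map_to_cc[OF p q] cc_transformation_to_cc[OF p q])
  have from_hom: "fr P Q u \<in> Arr (cwa_hom (attr p) (attr q)) \<and> to_cell p q (fr P Q u) = u"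
    if P: "cwa_pseudo_map (attr p) (attr q) P" and Q: "cwa_pseudo_map (attr p) (attr q) Q"
      and u: "u \<in> hom (cc_hom (cc p) (cc q)) (to_cc p q P) (to_cc p q Q)" for P Q u
  proof -
    have "fst u = to_cc p q P" "snd (snd u) = to_cc p q Q" "u \<in> Arr (cc_hom (cc p) (cc q))"
      using u by (auto simp: hom_def)
    then obtain \<alpha> \<alpha>' where u': "u = (to_cc p q P, (\<alpha>, \<alpha>'), to_cc p q Q)"
      and t: "cc_transformation (cc p) (cc q) (to_cc p q P) (to_cc p q Q) (\<alpha>, \<alpha>')"
      by (cases u rule: cc_cell_cases) auto
    note t' = cwa_transformation_from_cc[OF p q cc_pseudo_map_to_cc[OF p q P] cc_pseudo_map_to_cc[OF p q Q] t]
      and a' = total_part_from_cc[OF p q cc_pseudo_map_to_cc[OF p q P] cc_pseudo_map_to_cc[OF p q Q] t]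
    show ?thesis
      using P Q t' a' by (simp add: fr_def u' to_cell_def from_cc_to_cc[OF p q])
  qed
  let ?X = "attr p" and ?Y = "attr q"
  let ?Ob = "{P. cwa_pseudo_map ?X ?Y P}"
    and ?Ar = "{(P, \<alpha>, Q). cwa_pseudo_map ?X ?Y P \<and> cwa_pseudo_map ?X ?Y Q \<and> cwa_transformation ?X ?Y P Q \<alpha>}"
    and ?d = "\<lambda>(P, \<alpha>, Q). P" and ?c = "\<lambda>(P, \<alpha>, Q). Q"
    and ?i = "\<lambda>P. (P, \<lambda>x\<in>Obj (Ctx ?X). Ident (Ctx ?Y) (onO (mapF P) x), P)"
    and ?m = "\<lambda>(_, \<beta>, R) (P, \<alpha>, _). (P, \<lambda>x\<in>Obj (Ctx ?X). \<beta> x \<cdot>\<^bsub>Ctx ?Y\<^esub> \<alpha> x, R)"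
  have Ar: "?Ar = Arr (cwa_hom ?X ?Y)"
    by (simp add: cwa_hom_def)
  have fo: "to_cc p q P \<in> Obj (cc_hom (cc p) (cc q))" if "P \<in> ?Ob" for P
    using that by (simp add: cc_pseudo_map_to_cc[OF p q])
  have dc: "?d s \<in> ?Ob" "?c s \<in> ?Ob" if "s \<in> ?Ar" for s
    using that by auto
  have to: "to_cell p q s \<in> hom (cc_hom (cc p) (cc q)) (to_cc p q (?d s)) (to_cc p q (?c s))"
    if s: "s \<in> ?Ar" for s
  proof -
    obtain P \<alpha> Q where s': "s = (P, \<alpha>, Q)" by (metis surj_pair)
    have "to_cell p q s \<in> Arr (cc_hom (cc p) (cc q))"
      unfolding s' by (rule cell) (use s s' in simp)
    then show ?thesis
      by (simp add: hom_def s' to_cell_def del: cc_hom_simps(2))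
  qed
  have fr: "fr P Q u \<in> ?Ar \<and> ?d (fr P Q u) = P \<and> ?c (fr P Q u) = Q \<and> to_cell p q (fr P Q u) = u"
    if "P \<in> ?Ob" "Q \<in> ?Ob" "u \<in> hom (cc_hom (cc p) (cc q)) (to_cc p q P) (to_cc p q Q)" for P Q u
    using from_hom[of P Q u] that unfolding Ar by (simp add: fr_def)
  have fr_to: "fr (?d s) (?c s) (to_cell p q s) = s" if "s \<in> ?Ar" for s
    by (simp add: fr_def to_cell_def split_beta)
  have i: "?i P = fr P P (Ident (cc_hom (cc p) (cc q)) (to_cc p q P))" if "P \<in> ?Ob" for P
    using that by (simp add: fr_def cc_pseudo_map_to_cc[OF p q] ccF p.Base q.Base)
  have m: "?m t s = fr (?d s) (?c t) (to_cell p q t \<cdot>\<^bsub>cc_hom (cc p) (cc q)\<^esub> to_cell p q s)"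
    if s: "s \<in> ?Ar" and t: "t \<in> ?Ar" and eq: "?d t = ?c s" for s t
  proof -
    obtain P \<alpha> Q where s': "s = (P, \<alpha>, Q)" by (metis surj_pair)
    obtain \<beta> R where t': "t = (Q, \<beta>, R)" using eq s' by (cases t) auto
    have "to_cell p q s \<in> Arr (cc_hom (cc p) (cc q))" "to_cell p q t \<in> Arr (cc_hom (cc p) (cc q))"
      unfolding s' t' using s t s' t' by (auto intro!: cell)
    then show ?thesis
      by (simp add: fr_def s' t' to_cell_def p.Base q.Base del: cc_hom_simps(2))
  qed
  note T = transport_category[of "cc_hom (cc p) (cc q)" ?Ob "to_cc p q" ?Ar ?d ?c "to_cell p q" fr ?i ?m,
      OF D fo dc to fr fr_to i m]
  show "is_functor (cwa_hom ?X ?Y) (cc_hom (cc p) (cc q)) (hom_functor p q)"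
    unfolding hom_functor_def cwa_hom_def mk_cat_simps by (rule T(2))
  show "bij_betw (onA (hom_functor p q)) (hom (cwa_hom ?X ?Y) P Q)
        (hom (cc_hom (cc p) (cc q)) (to_cc p q P) (to_cc p q Q))"
    if "cwa_pseudo_map ?X ?Y P" "cwa_pseudo_map ?X ?Y Q"
    unfolding hom_functor_def cwa_hom_def mk_cat_simps ftor.select_convs
    by (rule T(3)) (use that in simp_all)
qed

text \<open>A cell is determined by its two ends and its base component, and the latter is kept
  unchanged, so injectivity on pseudo maps suffices.\<close>

lemma hom_functor_inj:
  "inj_on (onO (hom_functor p q)) (Obj (cwa_hom (attr p) (attr q)))"
  "inj_on (onA (hom_functor p q)) (Arr (cwa_hom (attr p) (attr q)))"
proof -
  have inj: "inj_on (to_cc p q) {P. cwa_pseudo_map (attr p) (attr q) P}"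
    by (rule inj_on_inverseI[where g = "from_cc p q"]) (simp add: from_cc_to_cc[OF p q])
  then show "inj_on (onO (hom_functor p q)) (Obj (cwa_hom (attr p) (attr q)))"
    by (simp add: hom_functor_def inj_on_def)
  show "inj_on (onA (hom_functor p q)) (Arr (cwa_hom (attr p) (attr q)))"
    using inj by (auto simp: hom_functor_def inj_on_def to_cell_def)
qed

text \<open>Every pseudo map of comprehension categories is equal to one in the image, so identities
  witness essential surjectivity.\<close>

lemma cat_equivalence_hom_functor:
  "cat_equivalence (cwa_hom (attr p) (attr q)) (cc_hom (cc p) (cc q)) (hom_functor p q)"
proof (rule cat_equivalenceI[OF is_functor_hom_functor])
  show "bij_betw (onA (hom_functor p q)) (hom (cwa_hom (attr p) (attr q)) P Q)
      (hom (cc_hom (cc p) (cc q)) (onO (hom_functor p q) P) (onO (hom_functor p q) Q))"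
    if "P \<in> Obj (cwa_hom (attr p) (attr q))" "Q \<in> Obj (cwa_hom (attr p) (attr q))" for P Q
    using that bij_betw_hom_functor[of P Q] by (simp add: hom_functor_def)
  interpret D: category "cc_hom (cc p) (cc q)"
    by (rule category_cc_hom[OF p[THEN presentation.is_compcat] q[THEN presentation.is_compcat]])
  show "\<exists>P\<in>Obj (cwa_hom (attr p) (attr q)). isomorphic (cc_hom (cc p) (cc q)) (onO (hom_functor p q) P) Q"
    if "Q \<in> Obj (cc_hom (cc p) (cc q))" for Q
    using that D.isomorphic_refl[of Q]
    by (intro bexI[of _ "from_cc p q Q"])
      (simp_all add: hom_functor_def cwa_pseudo_map_from_cc[OF p q] to_cc_from_cc[OF p q])
qed

end

text \<open>The two sides agree on ends and base components by the formulas for composition. The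
  horizontal composite of comprehension categories is known to be a transformation, so
  \<open>from_cc\<close> makes the composite of CwA's one, and unique lifting identifies the total
  components.\<close>

lemma to_cell_hcomp:
  assumes p: "presentation p" and q: "presentation q" and r: "presentation r"
    and b: "b \<in> Arr (cwa_hom (attr q) (attr r))" and a: "a \<in> Arr (cwa_hom (attr p) (attr q))"
  shows "cwa_hcomp (attr p) (attr r) b a \<in> Arr (cwa_hom (attr p) (attr r))"
    and "to_cell p r (cwa_hcomp (attr p) (attr r) b a) =
      cc_hcomp (cc p) (cc q) (cc r) (to_cell q r b) (to_cell p q a)"
proof -
  interpret p: presentation p by (rule p)
  interpret q: presentation q by (rule q)
  interpret r: presentation r by (rule r)
  obtain P \<alpha> P' where a': "a = (P, \<alpha>, P')" by (metis surj_pair)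
  obtain Q \<beta> Q' where b': "b = (Q, \<beta>, Q')" by (metis surj_pair)
  have P: "cwa_pseudo_map (attr p) (attr q) P" "cwa_pseudo_map (attr p) (attr q) P'"
    and Q: "cwa_pseudo_map (attr q) (attr r) Q" "cwa_pseudo_map (attr q) (attr r) Q'"
    and \<alpha>: "cwa_transformation (attr p) (attr q) P P' \<alpha>"
    and \<beta>: "cwa_transformation (attr q) (attr r) Q Q' \<beta>"
    using a b by (simp_all add: a' b')
  define \<gamma> where "\<gamma> = (\<lambda>x\<in>Obj (ctx p). \<beta> (onO (mapF P') x) \<cdot>\<^bsub>ctx r\<^esub> onA (mapF Q) (\<alpha> x))"
  have h: "cwa_hcomp (attr p) (attr r) b a =
      (cwa_comp (attr p) (attr r) Q P, \<gamma>, cwa_comp (attr p) (attr r) Q' P')"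
    by (simp add: cwa_hcomp_def a' b' \<gamma>_def)
  \<comment> \<open>The total component stays unnamed, as \<open>total_part_from_cc\<close> will
    identify it.\<close>
  obtain \<gamma>' where h': "cc_hcomp (cc p) (cc q) (cc r) (to_cell q r b) (to_cell p q a) =
      (cc_comp (cc p) (cc q) (cc r) (to_cc q r Q) (to_cc p q P), (\<gamma>, \<gamma>'),
       cc_comp (cc p) (cc q) (cc r) (to_cc q r Q') (to_cc p q P'))"
    by (simp add: to_cell_def a' b' cc_hcomp_simps \<gamma>_def p.Base r.Base) (simp add: to_cc_def)
  note comp = cc_pseudo_map_cc_comp[OF p.is_compcat q.is_compcat r.is_compcat
      cc_pseudo_map_to_cc[OF p q] cc_pseudo_map_to_cc[OF q r]]
  have "to_cell p q a \<in> Arr (cc_hom (cc p) (cc q))" "to_cell q r b \<in> Arr (cc_hom (cc q) (cc r))"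
    using P Q \<alpha> \<beta>
    by (simp_all add: a' b' to_cell_def cc_pseudo_map_to_cc[OF p q] cc_pseudo_map_to_cc[OF q r]
        cc_transformation_to_cc[OF p q] cc_transformation_to_cc[OF q r])
  from cc_hcomp_Arr[OF p.is_compcat q.is_compcat r.is_compcat this(2,1)]
  have t: "cc_transformation (cc p) (cc r) (cc_comp (cc p) (cc q) (cc r) (to_cc q r Q) (to_cc p q P))
      (cc_comp (cc p) (cc q) (cc r) (to_cc q r Q') (to_cc p q P')) (\<gamma>, \<gamma>')"
    by (simp add: h')
  show "cwa_hcomp (attr p) (attr r) b a \<in> Arr (cwa_hom (attr p) (attr r))"
    using cwa_transformation_from_cc[OF p r comp[OF P(1) Q(1)] comp[OF P(2) Q(2)] t] P Q
    by (simp add: h cwa_pseudo_map_cwa_comp[OF p q r] from_cc_cc_comp[OF p q r])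
  show "to_cell p r (cwa_hcomp (attr p) (attr r) b a) =
      cc_hcomp (cc p) (cc q) (cc r) (to_cell q r b) (to_cell p q a)"
    unfolding h'
    using total_part_from_cc[OF p r comp[OF P(1) Q(1)] comp[OF P(2) Q(2)] t] P Q
    by (simp add: h to_cell_def from_cc_cc_comp[OF p q r] to_cc_cwa_comp[OF p q r])
qed


subsection \<open>The equivalence of 2-categories\<close>

text \<open>Separates the equivalences from the way presentations are found. The function
  \<open>can\<close> picks a presentation for each CwA individually; maps between the picked ones
  are handled by \<open>to_cc\<close>, which works for any pair.\<close>

locale presentation_choice =
  fixes can :: "('o, 'a, 't) cwa \<Rightarrow> ('o, 'a, 't, 'p, 'b) pres"
  assumes presentation_can [simp]: "is_cwa X \<Longrightarrow> presentation (can X)"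
    and attr_can [simp]: "is_cwa X \<Longrightarrow> attr (can X) = X"
    and ex_presentation: "is_discrete_compcat (Y :: ('o, 'a, 'p, 'b) compcat) \<Longrightarrow>
      \<exists>p :: ('o, 'a, 't, 'p, 'b) pres. presentation p \<and> cc p = Y"
begin

text \<open>A given Y has some presentation, whose CwA also has the chosen one. The identity of that
  CwA connects the two by maps that are inverse on the nose, so the internal equivalence has
  identity 2-cells.\<close>

lemma two_equivalence_can:
  "two_equivalence cwa_ps compcat_disc_ps
    \<lparr>onObj2 = \<lambda>X. cc (can X), onHom2 = \<lambda>X Y. hom_functor (can X) (can Y)\<rparr>"
proof -
  have L: "Obj2 compcat_disc_ps = {Y. is_discrete_compcat Y}" "Hom2 compcat_disc_ps = cc_hom"
    "Ident2 compcat_disc_ps = cc_id"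
    "onO (Comp2 compcat_disc_ps X Y Z) = (\<lambda>(Q, P) \<in> Obj (cc_hom Y Z) \<times> Obj (cc_hom X Y). cc_comp X Y Z Q P)"
    "onA (Comp2 compcat_disc_ps X Y Z) = (\<lambda>(\<beta>, \<alpha>) \<in> Arr (cc_hom Y Z) \<times> Arr (cc_hom X Y). cc_hcomp X Y Z \<beta> \<alpha>)"
    for X Y Z :: "('o, 'a, 'p, 'b) compcat"
    by (simp_all add: compcat_disc_ps_def)
  have K: "Obj2 cwa_ps = {X. is_cwa X}" "Hom2 cwa_ps = cwa_hom" "Ident2 cwa_ps = cwa_id"
    "onO (Comp2 cwa_ps X Y Z) = (\<lambda>(Q, P) \<in> Obj (cwa_hom Y Z) \<times> Obj (cwa_hom X Y). cwa_comp X Z Q P)"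
    "onA (Comp2 cwa_ps X Y Z) = (\<lambda>(\<beta>, \<alpha>) \<in> Arr (cwa_hom Y Z) \<times> Arr (cwa_hom X Y). cwa_hcomp X Z \<beta> \<alpha>)"
    for X Y Z :: "('o, 'a, 't) cwa"
    by (simp_all add: cwa_ps_def)
  note two = two_category_compcat_disc_ps
  have H: "is_functor (cwa_hom X Y) (cc_hom (cc (can X)) (cc (can Y))) (hom_functor (can X) (can Y))"
    if "is_cwa X" "is_cwa Y" for X Y
    using is_functor_hom_functor[of "can X" "can Y"] that by simp
  have inj: "inj_on (onO (hom_functor (can X) (can Y))) (Obj (cwa_hom X Y))"
    "inj_on (onA (hom_functor (can X) (can Y))) (Arr (cwa_hom X Y))"
    if "is_cwa X" "is_cwa Y" for X Y
    using hom_functor_inj[of "can X" "can Y"] that by simp_all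
  have discrete: "is_discrete_compcat (cc (can X))" if "is_cwa X" for X
    using that by (simp add: presentation.discrete)
  have HO: "onO (hom_functor (can X) (can Y)) P = to_cc (can X) (can Y) P"
    if "is_cwa X" "is_cwa Y" "cwa_pseudo_map X Y P" for X Y P
    using that by (simp add: hom_functor_def)
  have HA: "onA (hom_functor (can X) (can Y)) s = to_cell (can X) (can Y) s"
    if "is_cwa X" "is_cwa Y" "s \<in> Arr (cwa_hom X Y)" for X Y s
    using that by (simp add: hom_functor_def)
  have id: "cwa_pseudo_map X X (cwa_id X)" "to_cc (can X) (can X) (cwa_id X) = cc_id (cc (can X))"
    if "is_cwa X" for X
    using cwa_pseudo_map_cwa_id[of "can X"] to_cc_cwa_id[of "can X"] that by simp_all
  have comp: "cwa_pseudo_map X Z (cwa_comp X Z Q P)"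
    "to_cc (can X) (can Z) (cwa_comp X Z Q P) =
      cc_comp (cc (can X)) (cc (can Y)) (cc (can Z)) (to_cc (can Y) (can Z) Q) (to_cc (can X) (can Y) P)"
    if "is_cwa X" "is_cwa Y" "is_cwa Z" "cwa_pseudo_map X Y P" "cwa_pseudo_map Y Z Q" for X Y Z P Q
    using cwa_pseudo_map_cwa_comp[of "can X" "can Y" "can Z" P Q]
      to_cc_cwa_comp[of "can X" "can Y" "can Z" P Q] that by simp_all
  have hcomp: "cwa_hcomp X Z b a \<in> Arr (cwa_hom X Z)"
    "to_cell (can X) (can Z) (cwa_hcomp X Z b a) =
      cc_hcomp (cc (can X)) (cc (can Y)) (cc (can Z)) (to_cell (can Y) (can Z) b) (to_cell (can X) (can Y) a)"
    if "is_cwa X" "is_cwa Y" "is_cwa Z" "a \<in> Arr (cwa_hom X Y)" "b \<in> Arr (cwa_hom Y Z)" for X Y Z a b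
    using to_cell_hcomp[of "can X" "can Y" "can Z" b a] that by simp_all
  have to_cc: "cc_pseudo_map (cc (can X)) (cc (can Y)) (to_cc (can X) (can Y) P)"
    if "is_cwa X" "is_cwa Y" "cwa_pseudo_map X Y P" for X Y P
    using cc_pseudo_map_to_cc[of "can X" "can Y" P] that by simp
  have to_cell: "to_cell (can X) (can Y) s \<in> Arr (cc_hom (cc (can X)) (cc (can Y)))"
    if "is_cwa X" "is_cwa Y" "s \<in> Arr (cwa_hom X Y)" for X Y s
    using functor_between.onA_Arr[OF H[OF that(1,2), folded functor_between_iff] that(3)] that
    by (simp add: HA)
  have two_functor: "is_two_functor cwa_ps compcat_disc_ps
      \<lparr>onObj2 = \<lambda>X. cc (can X), onHom2 = \<lambda>X Y. hom_functor (can X) (can Y)\<rparr>"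
  proof (rule is_two_functor_transport[OF two], unfold K L, goal_cases)
    \<comment> \<open>Cases 9 and 10 are preservation of composites of 1-cells and of
      2-cells.\<close>
    case (9 X Y Z Q P)
    then show ?case by (simp add: HO comp to_cc)
  next
    case (10 X Y Z b a)
    then show ?case by (simp add: HA hcomp to_cell)
  qed (simp_all add: discrete H inj id HO del: cwa_hom_simps, simp_all add: id HO)
  have eso: "\<exists>X\<in>Obj2 cwa_ps. internally_equivalent compcat_disc_ps (cc (can X)) Y"
    if disc: "is_discrete_compcat Y" for Y
  proof -
    obtain q :: "('o, 'a, 't, 'p, 'b) pres" where q: "presentation q" and Y: "cc q = Y"
      using ex_presentation[OF disc] by blast
    let ?X = "attr q" and ?p = "can (attr q)"
    have X: "is_cwa ?X" using q by (rule presentation.is_cwa)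
    then have p: "presentation ?p" and eq: "attr ?p = ?X" by simp_all
    interpret p: presentation ?p by (rule p)
    interpret q: presentation q by (rule q)
    let ?f = "to_cc ?p q (cwa_id ?X)" and ?g = "to_cc q ?p (cwa_id ?X)"
    have f: "cc_pseudo_map (cc ?p) Y ?f" and g: "cc_pseudo_map Y (cc ?p) ?g"
      using cc_pseudo_map_to_cc[OF p q] cc_pseudo_map_to_cc[OF q p] id(1)[OF X] by (simp_all add: eq Y)
    have gf: "cc_comp (cc ?p) Y (cc ?p) ?g ?f = cc_id (cc ?p)"
      using to_cc_cwa_id_inverse[OF p q eq] by (simp add: eq Y)
    have fg: "cc_comp Y (cc ?p) Y ?f ?g = cc_id Y"
      using to_cc_cwa_id_inverse[OF q p eq[symmetric]] by (simp add: Y)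
    have iso: "isomorphic (cc_hom Z Z) (cc_id Z) (cc_id Z)"
      if "is_compcat Z" for Z :: "('o, 'a, 'p, 'b) compcat"
      using category.isomorphic_refl[OF category_cc_hom[OF that that]] cc_pseudo_map_cc_id[OF that] by simp
    have "internally_equivalent compcat_disc_ps (cc ?p) Y"
      unfolding internally_equivalent_def L
      using f g gf fg iso[OF p.is_compcat] iso[OF q.is_compcat]
      by (intro bexI[of _ ?f] bexI[of _ ?g]) (simp_all add: Y)
    then show ?thesis using X K(1) by blast
  qed
  have "cat_equivalence (cwa_hom X Y) (cc_hom (cc (can X)) (cc (can Y))) (hom_functor (can X) (can Y))"
    if "is_cwa X" "is_cwa Y" for X Y
    using cat_equivalence_hom_functor[of "can X" "can Y"] that by simp
  then show ?thesis
    using two_functor eso by (simp add: two_equivalence_def K L)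
qed


subsection \<open>The equivalence of 1-categories\<close>

text \<open>The scheme of the hom-categories one level down, with CwA's as objects and strict maps
  as arrows. Here objects are hit only up to isomorphism, again by the identity of a CwA between two
  of its presentations.\<close>

lemma cat_equivalence_can: "\<exists>F. cat_equivalence
    (cwa_str1 :: (('o, 'a, 't) cwa, _) cat) (compcat_disc_str1 :: (('o, 'a, 'p, 'b) compcat, _) cat) F"
proof -
  let ?D = "compcat_disc_str1 :: (('o, 'a, 'p, 'b) compcat, _) cat"
  let ?Ob = "{X. is_cwa X} :: ('o, 'a, 't) cwa set"
    and ?Ar = "{(X, P, Y). is_cwa X \<and> is_cwa Y \<and> cwa_strict_map X Y P} ::
      (('o, 'a, 't) cwa \<times> ('o, 'a, 't) cwa_map \<times> ('o, 'a, 't) cwa) set"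
  define d c :: "('o, 'a, 't) cwa \<times> ('o, 'a, 't) cwa_map \<times> ('o, 'a, 't) cwa \<Rightarrow> ('o, 'a, 't) cwa"
    where "d = (\<lambda>(X, P, Y). X)" and "c = (\<lambda>(X, P, Y). Y)"
  define i :: "('o, 'a, 't) cwa \<Rightarrow> ('o, 'a, 't) cwa \<times> ('o, 'a, 't) cwa_map \<times> ('o, 'a, 't) cwa"
    where "i = (\<lambda>X. (X, cwa_strict_id X, X))"
  define m :: "('o, 'a, 't) cwa \<times> ('o, 'a, 't) cwa_map \<times> ('o, 'a, 't) cwa \<Rightarrow> _ \<Rightarrow> _"
    where "m = (\<lambda>(_, Q, Z) (X, P, _ :: ('o, 'a, 't) cwa). (X, cwa_strict_comp X Q P, Z))"
  note dcim = d_def c_def i_def m_def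
  define fo where "fo X = cc (can X)" for X
  define to where "to = (\<lambda>(X, P, Y). (fo X, to_cc (can X) (can Y) (strict_pmap X Y P), fo Y))"
  \<comment> \<open>The ends X and Y have to be supplied: they are not recoverable from the
    comprehension categories assigned to them.\<close>
  define fr where "fr X Y u = (X, strict_part (from_cc (can X) (can Y) (fst (snd u))), Y)"
    for X Y and u :: "('o, 'a, 'p, 'b) compcat \<times> ('o, 'a, 'p, 'b) cc_map \<times> ('o, 'a, 'p, 'b) compcat"
  interpret D: category ?D by (rule category_compcat_disc_str1)
  have D_Obj: "X \<in> Obj ?D \<longleftrightarrow> is_discrete_compcat X" for X
    by (simp add: compcat_disc_str1_def)
  have D_Arr: "(X, P, Y) \<in> Arr ?D \<longleftrightarrow> is_discrete_compcat X \<and> is_discrete_compcat Y \<and> cc_strict_map X Y P" for X P Y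
    by (simp add: compcat_disc_str1_def)
  have D_Dom: "(X, P, Y) \<in> Arr ?D \<Longrightarrow> Dom ?D (X, P, Y) = X"
    and D_Cod: "(X, P, Y) \<in> Arr ?D \<Longrightarrow> Cod ?D (X, P, Y) = Y" for X P Y
    by (simp_all add: compcat_disc_str1_def)
  have D_Ident: "is_discrete_compcat X \<Longrightarrow> Ident ?D X = (X, cc_id X, X)" for X
    by (simp add: compcat_disc_str1_def)
  have D_Comp: "(X, P, Y) \<in> Arr ?D \<Longrightarrow> (Y, Q, Z) \<in> Arr ?D \<Longrightarrow>
      (Y, Q, Z) \<cdot>\<^bsub>?D\<^esub> (X, P, Y) = (X, cc_comp X Y Z Q P, Z)" for X P Y Q Z
    by (simp add: compcat_disc_str1_def)
  have discrete: "is_discrete_compcat (cc (can X))" if "is_cwa X" for X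
    using that by (simp add: presentation.discrete)
  have to_cc: "cc_strict_map (cc (can X)) (cc (can Y)) (to_cc (can X) (can Y) (strict_pmap X Y P))"
    if "is_cwa X" "is_cwa Y" "cwa_strict_map X Y P" for X Y P
    using cc_strict_map_to_cc[of "can X" "can Y" P] that by simp
  have fo_Obj: "fo X \<in> Obj ?D" if "X \<in> ?Ob" for X
    using that discrete by (simp add: D_Obj fo_def)
  have dc: "d s \<in> ?Ob" "c s \<in> ?Ob" if "s \<in> ?Ar" for s
    using that by (auto simp: dcim)
  have to_Arr: "(fo X, to_cc (can X) (can Y) (strict_pmap X Y P), fo Y) \<in> Arr ?D"
    if "is_cwa X" "is_cwa Y" "cwa_strict_map X Y P" for X Y P
    using that by (simp add: D_Arr discrete to_cc fo_def)
  have to_hom: "to s \<in> hom ?D (fo (d s)) (fo (c s))" if "s \<in> ?Ar" for s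
    using that to_Arr by (auto simp: hom_def D_Dom D_Cod to_def dcim)
  have fr_hom: "fr X Y u \<in> ?Ar \<and> d (fr X Y u) = X \<and> c (fr X Y u) = Y \<and> to (fr X Y u) = u"
    if XY: "X \<in> ?Ob" "Y \<in> ?Ob" and u: "u \<in> hom ?D (fo X) (fo Y)" for X Y u
  proof -
    obtain Q where u': "u = (fo X, Q, fo Y)" and Q: "cc_strict_map (cc (can X)) (cc (can Y)) Q"
      using u by (cases u) (auto simp: hom_def D_Dom D_Cod D_Arr fo_def)
    have "presentation (can X)" "presentation (can Y)" using XY by simp_all
    note * = this Q
    show ?thesis
      using XY cwa_strict_map_from_cc[OF *] strict_pmap_from_cc[OF *]
        to_cc_from_cc[OF *(1,2) cc_strict_mapD[OF Q]]
      by (simp add: u' fr_def to_def fo_def dcim)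
  qed
  have fr_to: "fr (d s) (c s) (to s) = s" if s: "s \<in> ?Ar" for s
  proof -
    obtain X P Y where s': "s = (X, P, Y)" by (metis surj_pair)
    have *: "is_cwa X" "is_cwa Y" "cwa_strict_map X Y P" using s by (simp_all add: s')
    then show ?thesis
      using from_cc_to_cc[of "can X" "can Y"] cwa_pseudo_map_strict_pmap[OF *]
      by (simp add: s' fr_def to_def dcim)
  qed
  have i_eq: "i X = fr X X (Ident ?D (fo X))" if "X \<in> ?Ob" for X
    using that from_cc_cc_id[of "can X"] by (simp add: D_Ident discrete strict_part_cwa_id fr_def fo_def dcim)
  have m_eq: "m t s = fr (d s) (c t) (to t \<cdot>\<^bsub>?D\<^esub> to s)"
    if s: "s \<in> ?Ar" and t: "t \<in> ?Ar" and eq: "d t = c s" for s t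
  proof -
    obtain X P Y where s': "s = (X, P, Y)" by (metis surj_pair)
    obtain Q Z where t': "t = (Y, Q, Z)" using eq s' by (cases t) (auto simp: dcim)
    have *: "is_cwa X" "is_cwa Y" "is_cwa Z" "cwa_strict_map X Y P" "cwa_strict_map Y Z Q"
      using s t by (simp_all add: s' t')
    show ?thesis
      using * from_cc_cc_comp[of "can X" "can Y" "can Z" "strict_pmap X Y P" "strict_pmap Y Z Q"]
        cwa_pseudo_map_strict_pmap[of X Y P] cwa_pseudo_map_strict_pmap[of Y Z Q]
      by (simp add: s' t' to_def fr_def dcim D_Comp[OF to_Arr to_Arr] strict_part_cwa_comp) (simp add: fo_def strict_part_cwa_comp)
  qed
  note T = transport_category[of ?D ?Ob fo ?Ar d c to fr i m,
      OF D.category_axioms fo_Obj dc to_hom fr_hom fr_to i_eq m_eq]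
  \<comment> \<open>This is \<open>cwa_str1\<close> with its components folded; the definitions are
    opened only in the last step.\<close>
  define K where "K = mk_cat ?Ob ?Ar d c i m"
  define F where "F = \<lparr>onO = restrict fo ?Ob, onA = restrict to ?Ar\<rparr>"
  have F_O: "onO F X = fo X" if "is_cwa X" for X
    using that by (simp add: F_def)
  have K_Obj: "X \<in> Obj K \<longleftrightarrow> is_cwa X" for X
    by (simp add: K_def)
  have "cat_equivalence K ?D F"
  proof (rule cat_equivalenceI)
    show "is_functor K ?D F"
      unfolding K_def F_def by (rule T(2))
    fix X Y assume "X \<in> Obj K" "Y \<in> Obj K"
    then have XY: "is_cwa X" "is_cwa Y" by (simp_all only: K_Obj)
    show "bij_betw (onA F) (hom K X Y) (hom ?D (onO F X) (onO F Y))"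
      unfolding F_O[OF XY(1)] F_O[OF XY(2)] unfolding F_def K_def ftor.select_convs
      by (rule T(3)) (simp_all only: mem_Collect_eq XY)
  next
    fix Y assume "Y \<in> Obj ?D"
    then have "is_discrete_compcat Y" by (simp only: D_Obj)
    then obtain q :: "('o, 'a, 't, 'p, 'b) pres" where q: "presentation q" and Y: "cc q = Y"
      using ex_presentation[of Y] by blast
    let ?X = "attr q" and ?p = "can (attr q)"
    have X: "is_cwa ?X" using q by (rule presentation.is_cwa)
    then have p: "presentation ?p" and eq: "attr ?p = ?X" by simp_all
    interpret p: presentation ?p by (rule p)
    interpret q: presentation q by (rule q)
    let ?f = "to_cc ?p q (cwa_id ?X)" and ?g = "to_cc q ?p (cwa_id ?X)"
    \<comment> \<open>Strictness of the identity of a CwA is read off from the identity of the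
      comprehension category that presents it.\<close>
    have id: "strict_pmap ?X ?X (cwa_strict_id ?X) = cwa_id ?X" "cwa_strict_map ?X ?X (cwa_strict_id ?X)"
      using strict_pmap_from_cc[OF q q cc_strict_map_cc_id[OF q.is_compcat]]
        cwa_strict_map_from_cc[OF q q cc_strict_map_cc_id[OF q.is_compcat]]
      by (simp_all add: from_cc_cc_id[OF q] strict_part_cwa_id)
    have "cc_strict_map (cc ?p) Y ?f" "cc_strict_map Y (cc ?p) ?g"
      using cc_strict_map_to_cc[OF p q, unfolded eq Y, OF id(2)]
        cc_strict_map_to_cc[OF q p, unfolded eq Y, OF id(2)] by (simp_all only: id(1))
    then have f: "(cc ?p, ?f, Y) \<in> Arr ?D" and g: "(Y, ?g, cc ?p) \<in> Arr ?D"
      using p.discrete q.discrete by (simp_all add: D_Arr Y)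
    have gf: "cc_comp (cc ?p) Y (cc ?p) ?g ?f = cc_id (cc ?p)"
      using to_cc_cwa_id_inverse[OF p q eq] by (simp add: eq Y)
    have fg: "cc_comp Y (cc ?p) Y ?f ?g = cc_id Y"
      using to_cc_cwa_id_inverse[OF q p eq[symmetric]] by (simp add: Y)
    have "is_iso ?D (cc ?p, ?f, Y)"
      by (rule is_isoI[where g = "(Y, ?g, cc ?p)"])
        (use f g gf fg p.discrete q.discrete in \<open>simp_all add: D_Dom D_Cod D_Comp D_Ident Y\<close>)
    then have "isomorphic ?D (cc ?p) Y"
      unfolding isomorphic_def
      using f by (intro bexI[of _ "(cc ?p, ?f, Y)"]) (simp_all add: hom_def D_Dom D_Cod)
    then have "isomorphic ?D (onO F ?X) Y"
      by (simp only: F_O[OF X] fo_def)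
    then show "\<exists>X\<in>Obj K. isomorphic ?D (onO F X) Y"
      using X K_Obj by blast
  qed
  then show ?thesis
    unfolding cwa_str1_def K_def dcim by (rule exI)
qed

end

theorem proposition38:
  assumes "infinite (UNIV :: 'u set)"
  shows "equivalent_categories
           (cwa_str1 :: ('u small_cwa, 'u small_cwa \<times> 'u small_cwa_map \<times> 'u small_cwa) cat)
           (compcat_disc_str1 ::
             ('u small_compcat, 'u small_compcat \<times> 'u small_cc_map \<times> 'u small_compcat) cat) \<and>
         equivalent_two_categories
           (cwa_ps :: ('u small_cwa, 'u small_cwa_pmap, 'u small_cwa_cell) cat2)
           (compcat_disc_ps :: ('u small_compcat, 'u small_cc_map, 'u small_cc_cell) cat2)"
proof -
  obtain j :: "'u \<times> 'u \<Rightarrow> 'u" where "inj j"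
    using ex_inj_prod[OF assms] by blast
  \<comment> \<open>The condition \<open>is_cwa X\<close> is placed inside the existential so that a
    choice function defined on all records exists.\<close>
  then have "\<forall>X :: 'u small_cwa. \<exists>p :: ('u, 'u, 'u, 'u, 'u) pres. is_cwa X \<longrightarrow> presentation p \<and> attr p = X"
    using ex_presentation_cwa by blast
  then obtain can :: "'u small_cwa \<Rightarrow> ('u, 'u, 'u, 'u, 'u) pres"
    where "\<And>X. is_cwa X \<Longrightarrow> presentation (can X) \<and> attr (can X) = X"
    by metis
  then interpret presentation_choice can
    by (intro presentation_choice.intro) (simp_all add: ex_presentation_compcat)
  show ?thesis
    unfolding equivalent_categories_def equivalent_two_categories_def
    by (rule conjI, rule cat_equivalence_can, rule exI, rule two_equivalence_can)
qed

end
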